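(* Let $X$ be an $m^X$-symmetric Markov process on $E^X$ with regular Dirichlet form $(\mathcal{E}^X,\mathcal{F}^X)$ on $L^2(E^X,m^X)$, and $Y$ an $m^Y$-symmetric Markov process on $E^Y$ with regular Dirichlet form $(\mathcal{E}^Y,\mathcal{F}^Y)$ on $L^2(E^Y,m^Y)$, both forms having no killing inside. Let $Z=(X,Y)$ be the independent coupling process of $X$ and $Y$, and set $E=E^X\times E^Y$, $m=m^X\times m^Y$. Then $Z$ is $m$-symmetric on $E$, and $$\mathcal{F}=L^2(E^Y,\mathcal{F}^X)\cap L^2(E^X,\mathcal{F}^Y),$$ $$\mathcal{E}(u,v)=\int_{E^Y}\mathcal{E}^X(u(\cdot,y),v(\cdot,y))\,m^Y(dy)+\int_{E^X}\mathcal{E}^Y(u(x,\cdot),v(x,\cdot))\,m^X(dx),\quad u,v\in\mathcal{F},$$ is a regular Dirichlet form on $L^2(E,m)$ whose corresponding Markov process is $Z$. Moreover, if $\mathcal{C}^X$ is a core of $(\mathcal{E}^X,\mathcal{F}^X)$ and $\mathcal{C}^Y$ is a core of $(\mathcal{E}^Y,\mathcal{F}^Y)$, then the tensor product $\mathcal{C}:=\mathcal{C}^X\otimes\mathcal{C}^Y$ is a core of $(\mathcal{E},\mathcal{F})$.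
   Context: $E^X,E^Y$ are locally compact separable metric spaces; $m^X,m^Y$ are Radon measures on them with full support. $\mathcal{E}_1(u,v)=\mathcal{E}(u,v)+(u,v)_m$. A Dirichlet form $(\mathcal{E},\mathcal{F})$ on $L^2(E,m)$ is regular if $\mathcal{F}\cap C_\mathrm{c}(E)$ is $\mathcal{E}_1^{1/2}$-dense in $\mathcal{F}$ and uniformly dense in $C_\mathrm{c}(E)$. A core is a subset $\mathcal{C}\subset\mathcal{F}\cap C_\mathrm{c}(E)$ that is $\mathcal{E}_1^{1/2}$-dense in $\mathcal{F}$ and uniformly dense in $C_\mathrm{c}(E)$. No killing inside means the killing measure in the Beurling–Deny decomposition is zero. $\mathcal{C}^X\otimes\mathcal{C}^Y$ is the linear span of the functions $(f\otimes g)(x,y)=f(x)g(y)$, $f\in\mathcal{C}^X$, $g\in\mathcal{C}^Y$. The independent coupling $Z=(X,Y)$ is the Markov process on $E$ whose components $X$ and $Y$ are independent; its transition function satisfies $P^Z_t(f\otimes g)=P^X_tf\otimes P^Y_tg$. "The corresponding Markov process of $(\mathcal{E},\mathcal{F})$ is $Z$" means the $L^2(E,m)$-semigroup of $(\mathcal{E},\mathcal{F})$ is the one generated by the transition function of $Z$. $L^2(E^Y,\mathcal{F}^X)=\{u\in L^2(E,m): u(\cdot,y)\in\mathcal{F}^X \text{ for } m^Y\text{-a.e. }y,\ \|u(\cdot,y)\|_{\mathcal{E}^X_1}\in L^2(E^Y,m^Y)\}$ and $L^2(E^X,\mathcal{F}^Y)=\{u\in L^2(E,m): u(x,\cdot)\in\mathcal{F}^Y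 \text{ for } m^X\text{-a.e. }x,\ \|u(x,\cdot)\|_{\mathcal{E}^Y_1}\in L^2(E^X,m^X)\}$, where $\|w\|_{\mathcal{E}_1}=\mathcal{E}_1(w,w)^{1/2}$. *)

theory Defs
  imports "HOL-Probability.Probability"
begin

section \<open>Measures, function spaces\<close>

text \<open>Borel measures that are finite on compact sets; on a locally compact separable metric
  space these are automatically inner and outer regular.\<close>

definition radon_measure :: "'a::topological_space measure \<Rightarrow> bool" where
  "radon_measure M \<longleftrightarrow> sets M = sets borel \<and> (\<forall>K. compact K \<longrightarrow> emeasure M K < \<infinity>)"

definition full_support :: "'a::topological_space measure \<Rightarrow> bool" where
  "full_support M \<longleftrightarrow> (\<forall>U. open U \<longrightarrow> U \<noteq> {} \<longrightarrow> emeasure M U > 0)"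

definition fun_support :: "('a::topological_space \<Rightarrow> real) \<Rightarrow> 'a set" where
  "fun_support f = closure {x. f x \<noteq> 0}"

definition Cc :: "('a::topological_space \<Rightarrow> real) set" where
  "Cc = {f. continuous_on UNIV f \<and> compact (fun_support f)}"

text \<open>An element of the Hilbert space of square-integrable functions is represented by any of its measurable representatives. Sets of
  representatives that stand for subsets of this space are closed under a.e. equality, see
  \<open>ae_invariant\<close>.\<close>

definition L2 :: "'a measure \<Rightarrow> ('a \<Rightarrow> real) set" where
  "L2 M = {u \<in> borel_measurable M. integrable M (\<lambda>x. (u x)\<^sup>2)}"

definition L2_inner :: "'a measure \<Rightarrow> ('a \<Rightarrow> real) \<Rightarrow> ('a \<Rightarrow> real) \<Rightarrow> real" where
  "L2_inner M u v = (LINT x|M. u x * v x)"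

definition L2_norm :: "'a measure \<Rightarrow> ('a \<Rightarrow> real) \<Rightarrow> real" where
  "L2_norm M u = sqrt (L2_inner M u u)"

section \<open>Dirichlet forms\<close>

type_synonym 'a form = "('a \<Rightarrow> real) \<Rightarrow> ('a \<Rightarrow> real) \<Rightarrow> real"

text \<open>In a pair \<open>\<E>\<close>, \<open>\<F>\<close> only the values of \<open>\<E>\<close> on \<open>\<F> \<times> \<F>\<close> are meaningful.\<close>

definition linear_space :: "('a \<Rightarrow> real) set \<Rightarrow> bool" where
  "linear_space V \<longleftrightarrow> (\<lambda>_. 0) \<in> V \<and>
     (\<forall>u\<in>V. \<forall>v\<in>V. (\<lambda>x. u x + v x) \<in> V) \<and> (\<forall>c. \<forall>u\<in>V. (\<lambda>x. c * u x) \<in> V)"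

definition symmetric_form :: "'a form \<Rightarrow> ('a \<Rightarrow> real) set \<Rightarrow> bool" where
  "symmetric_form \<E> \<F> \<longleftrightarrow> linear_space \<F> \<and>
     (\<forall>u\<in>\<F>. \<forall>v\<in>\<F>. \<E> u v = \<E> v u) \<and>
     (\<forall>u\<in>\<F>. \<forall>v\<in>\<F>. \<forall>w\<in>\<F>. \<E> (\<lambda>x. u x + v x) w = \<E> u w + \<E> v w) \<and>
     (\<forall>c. \<forall>u\<in>\<F>. \<forall>v\<in>\<F>. \<E> (\<lambda>x. c * u x) v = c * \<E> u v) \<and>
     (\<forall>u\<in>\<F>. 0 \<le> \<E> u u)"

definition ae_invariant :: "'a measure \<Rightarrow> 'a form \<Rightarrow> ('a \<Rightarrow> real) set \<Rightarrow> bool" where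
  "ae_invariant M \<E> \<F> \<longleftrightarrow>
     (\<forall>u\<in>\<F>. \<forall>u'\<in>borel_measurable M. (AE x in M. u x = u' x) \<longrightarrow>
        u' \<in> \<F> \<and> (\<forall>v\<in>\<F>. \<E> u v = \<E> u' v))"

definition form1 :: "'a measure \<Rightarrow> 'a form \<Rightarrow> 'a form" where
  "form1 M \<E> u v = \<E> u v + L2_inner M u v"

definition form1_norm :: "'a measure \<Rightarrow> 'a form \<Rightarrow> ('a \<Rightarrow> real) \<Rightarrow> real" where
  "form1_norm M \<E> u = sqrt (form1 M \<E> u u)"

definition form_closed :: "'a measure \<Rightarrow> 'a form \<Rightarrow> ('a \<Rightarrow> real) set \<Rightarrow> bool" where
  "form_closed M \<E> \<F> \<longleftrightarrow>
     (\<forall>u :: nat \<Rightarrow> 'a \<Rightarrow> real. range u \<subseteq> \<F> \<longrightarrow>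
        (\<forall>\<epsilon>>0. \<exists>N. \<forall>i\<ge>N. \<forall>j\<ge>N. form1_norm M \<E> (\<lambda>x. u i x - u j x) < \<epsilon>) \<longrightarrow>
        (\<exists>v\<in>\<F>. (\<lambda>n. form1_norm M \<E> (\<lambda>x. u n x - v x)) \<longlonglongrightarrow> 0))"

definition markovian_form :: "'a form \<Rightarrow> ('a \<Rightarrow> real) set \<Rightarrow> bool" where
  "markovian_form \<E> \<F> \<longleftrightarrow>
     (\<forall>u\<in>\<F>. (\<lambda>x. min (max (u x) 0) 1) \<in> \<F> \<and>
        \<E> (\<lambda>x. min (max (u x) 0) 1) (\<lambda>x. min (max (u x) 0) 1) \<le> \<E> u u)"

definition dirichlet_form :: "'a measure \<Rightarrow> 'a form \<Rightarrow> ('a \<Rightarrow> real) set \<Rightarrow> bool" where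
  "dirichlet_form M \<E> \<F> \<longleftrightarrow>
     \<F> \<subseteq> L2 M \<and> ae_invariant M \<E> \<F> \<and>
     (\<forall>u\<in>L2 M. \<forall>\<epsilon>>0. \<exists>v\<in>\<F>. L2_norm M (\<lambda>x. u x - v x) < \<epsilon>) \<and>
     symmetric_form \<E> \<F> \<and> form_closed M \<E> \<F> \<and> markovian_form \<E> \<F>"

definition core ::
  "'a::topological_space measure \<Rightarrow> 'a form \<Rightarrow> ('a \<Rightarrow> real) set \<Rightarrow> ('a \<Rightarrow> real) set \<Rightarrow> bool" where
  "core M \<E> \<F> \<C> \<longleftrightarrow> \<C> \<subseteq> \<F> \<inter> Cc \<and>
     (\<forall>u\<in>\<F>. \<forall>\<epsilon>>0. \<exists>v\<in>\<C>. form1_norm M \<E> (\<lambda>x. u x - v x) < \<epsilon>) \<and>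
     (\<forall>f\<in>Cc. \<forall>\<epsilon>>0. \<exists>g\<in>\<C>. \<forall>x. \<bar>f x - g x\<bar> < \<epsilon>)"

definition regular_dirichlet_form ::
  "'a::topological_space measure \<Rightarrow> 'a form \<Rightarrow> ('a \<Rightarrow> real) set \<Rightarrow> bool" where
  "regular_dirichlet_form M \<E> \<F> \<longleftrightarrow> dirichlet_form M \<E> \<F> \<and> core M \<E> \<F> (\<F> \<inter> Cc)"

section \<open>Beurling--Deny decomposition\<close>

text \<open>\<open>\<E> u v = \<E>c u v + \<integral>\<integral> (u x - u y) (v x - v y) dJ + \<integral> u v dk\<close> on \<open>\<F> \<inter> Cc\<close>, with strongly
  local part \<open>\<E>c\<close>, jumping measure \<open>J\<close> (a symmetric Radon measure off the diagonal, here extended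
  by zero to the diagonal) and killing measure \<open>k\<close>. For a regular Dirichlet form such a
  decomposition exists and is unique.\<close>

definition beurling_deny ::
  "'a::{metric_space,second_countable_topology} form \<Rightarrow> ('a \<Rightarrow> real) set \<Rightarrow>
   'a form \<Rightarrow> ('a \<times> 'a) measure \<Rightarrow> 'a measure \<Rightarrow> bool" where
  "beurling_deny \<E> \<F> \<E>c J k \<longleftrightarrow>
     symmetric_form \<E>c (\<F> \<inter> Cc) \<and>
     (\<forall>u\<in>\<F> \<inter> Cc. \<forall>v\<in>\<F> \<inter> Cc.
        (\<exists>U c. open U \<and> fun_support u \<subseteq> U \<and> (\<forall>x\<in>U. v x = c)) \<longrightarrow> \<E>c u v = 0) \<and>
     sets J = sets borel \<and> emeasure J {(x, y). x = y} = 0 \<and>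
     (\<forall>K. compact K \<longrightarrow> K \<inter> {(x, y). x = y} = {} \<longrightarrow> emeasure J K < \<infinity>) \<and>
     distr J borel (\<lambda>(x, y). (y, x)) = J \<and>
     radon_measure k \<and>
     (\<forall>u\<in>\<F> \<inter> Cc. \<forall>v\<in>\<F> \<inter> Cc.
        integrable J (\<lambda>(x, y). (u x - u y) * (v x - v y)) \<and> integrable k (\<lambda>x. u x * v x) \<and>
        \<E> u v = \<E>c u v + (LINT (x, y)|J. (u x - u y) * (v x - v y)) + (LINT x|k. u x * v x))"

definition no_killing_inside ::
  "'a::{metric_space,second_countable_topology} form \<Rightarrow> ('a \<Rightarrow> real) set \<Rightarrow> bool" where
  "no_killing_inside \<E> \<F> \<longleftrightarrow> (\<exists>\<E>c J k. beurling_deny \<E> \<F> \<E>c J k \<and> emeasure k UNIV = 0)"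

section \<open>Markov processes\<close>

text \<open>A process with state space \<open>'a\<close> and cemetery \<open>None\<close> is a family \<open>X t\<close> of maps on a sample
  space together with laws \<open>P x\<close>, one for each starting point \<open>x\<close>. The process may have finite
  lifetime even if there is no killing inside, so its transition kernels are sub-Markovian.\<close>

definition cemetery_borel :: "'a::topological_space option measure" where
  "cemetery_borel = sigma UNIV {A. Some -` A \<in> sets borel}"

definition transition ::
  "('a::topological_space \<Rightarrow> 'w measure) \<Rightarrow> (real \<Rightarrow> 'w \<Rightarrow> 'a option) \<Rightarrow> real \<Rightarrow> 'a \<Rightarrow> 'a measure" where
  "transition P X t x =
     distr (restrict_space (P x) {\<omega> \<in> space (P x). X t \<omega> \<noteq> None}) borel (\<lambda>\<omega>. the (X t \<omega>))"

definition past ::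
  "('a::topological_space \<Rightarrow> 'w measure) \<Rightarrow> (real \<Rightarrow> 'w \<Rightarrow> 'a option) \<Rightarrow> 'a \<Rightarrow> real \<Rightarrow> 'w measure" where
  "past P X x s =
     sigma (space (P x)) (\<Union>r\<in>{0..s}. {X r -` A \<inter> space (P x) |A. A \<in> sets cemetery_borel})"

text \<open>The Markov property is required with respect to the natural filtration, with the
  convention that transition probabilities from the cemetery into \<open>'a\<close> vanish.\<close>

definition markov_process ::
  "('a::topological_space \<Rightarrow> 'w measure) \<Rightarrow> (real \<Rightarrow> 'w \<Rightarrow> 'a option) \<Rightarrow> bool" where
  "markov_process P X \<longleftrightarrow>
     (\<forall>x. prob_space (P x)) \<and> (\<forall>x y. sets (P x) = sets (P y)) \<and>
     (\<forall>t\<ge>0. \<forall>x. X t \<in> P x \<rightarrow>\<^sub>M cemetery_borel) \<and>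
     (\<forall>t\<ge>0. \<forall>B\<in>sets borel. (\<lambda>x. measure (transition P X t x) B) \<in> borel_measurable borel) \<and>
     (\<forall>x. AE \<omega> in P x. X 0 \<omega> = Some x) \<and>
     (\<forall>x. \<forall>s\<ge>0. \<forall>t\<ge>0. \<forall>B\<in>sets borel. AE \<omega> in P x.
        real_cond_exp (P x) (past P X x s)
          (indicator {\<omega> \<in> space (P x). X (s + t) \<omega> \<in> Some ` B}) \<omega> =
        (case X s \<omega> of None \<Rightarrow> 0 | Some y \<Rightarrow> measure (transition P X t y) B))"

definition m_symmetric ::
  "'a::topological_space measure \<Rightarrow> ('a \<Rightarrow> 'w measure) \<Rightarrow> (real \<Rightarrow> 'w \<Rightarrow> 'a option) \<Rightarrow> bool" where
  "m_symmetric M P X \<longleftrightarrow>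
     (\<forall>t\<ge>0. \<forall>f\<in>borel_measurable borel. \<forall>g\<in>borel_measurable borel.
        (\<integral>\<^sup>+x. (\<integral>\<^sup>+y. f y \<partial>transition P X t x) * g x \<partial>M) =
        (\<integral>\<^sup>+x. f x * (\<integral>\<^sup>+y. g y \<partial>transition P X t x) \<partial>M))"

definition transition_operator ::
  "('a::topological_space \<Rightarrow> 'w measure) \<Rightarrow> (real \<Rightarrow> 'w \<Rightarrow> 'a option) \<Rightarrow>
   real \<Rightarrow> ('a \<Rightarrow> real) \<Rightarrow> 'a \<Rightarrow> real" where
  "transition_operator P X t u x = (LINT y|transition P X t x. u y)"

section \<open>The semigroup of a form\<close>

definition L2_semigroup :: "'a measure \<Rightarrow> (real \<Rightarrow> ('a \<Rightarrow> real) \<Rightarrow> 'a \<Rightarrow> real) \<Rightarrow> bool" where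
  "L2_semigroup M T \<longleftrightarrow>
     (\<forall>t>0. \<forall>u\<in>L2 M. T t u \<in> L2 M \<and> L2_norm M (T t u) \<le> L2_norm M u) \<and>
     (\<forall>t>0. \<forall>u\<in>L2 M. \<forall>v\<in>L2 M. \<forall>a b.
        AE x in M. T t (\<lambda>x. a * u x + b * v x) x = a * T t u x + b * T t v x) \<and>
     (\<forall>t>0. \<forall>u\<in>L2 M. \<forall>v\<in>L2 M. L2_inner M (T t u) v = L2_inner M u (T t v)) \<and>
     (\<forall>s>0. \<forall>t>0. \<forall>u\<in>L2 M. AE x in M. T (s + t) u x = T s (T t u) x) \<and>
     (\<forall>u\<in>L2 M. ((\<lambda>t. L2_norm M (\<lambda>x. T t u x - u x)) \<longlongrightarrow> 0) (at_right 0))"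

text \<open>The correspondence between symmetric strongly continuous contraction semigroups and closed
  symmetric forms: \<open>\<F>\<close> consists of those \<open>u\<close> for which \<open>(u - T\<^sub>t u, u) / t\<close>, which is nonincreasing
  in \<open>t\<close>, has a finite limit as \<open>t\<close> decreases to 0, and \<open>\<E> u v\<close> is the limit of
  \<open>(u - T\<^sub>t u, v) / t\<close>.\<close>

definition semigroup_of_form ::
  "'a measure \<Rightarrow> 'a form \<Rightarrow> ('a \<Rightarrow> real) set \<Rightarrow> (real \<Rightarrow> ('a \<Rightarrow> real) \<Rightarrow> 'a \<Rightarrow> real) \<Rightarrow> bool" where
  "semigroup_of_form M \<E> \<F> T \<longleftrightarrow> L2_semigroup M T \<and>
     \<F> = {u \<in> L2 M. \<exists>l. ((\<lambda>t. L2_inner M (\<lambda>x. u x - T t u x) u / t) \<longlongrightarrow> l) (at_right 0)} \<and>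
     (\<forall>u\<in>\<F>. \<forall>v\<in>\<F>. ((\<lambda>t. L2_inner M (\<lambda>x. u x - T t u x) v / t) \<longlongrightarrow> \<E> u v) (at_right 0))"

definition form_of_process ::
  "'a::topological_space measure \<Rightarrow> 'a form \<Rightarrow> ('a \<Rightarrow> real) set \<Rightarrow>
   ('a \<Rightarrow> 'w measure) \<Rightarrow> (real \<Rightarrow> 'w \<Rightarrow> 'a option) \<Rightarrow> bool" where
  "form_of_process M \<E> \<F> P X \<longleftrightarrow> semigroup_of_form M \<E> \<F> (transition_operator P X)"

section \<open>Independent coupling and product form\<close>

definition coupling_law ::
  "('a \<Rightarrow> 'v measure) \<Rightarrow> ('b \<Rightarrow> 'w measure) \<Rightarrow> 'a \<times> 'b \<Rightarrow> ('v \<times> 'w) measure" where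
  "coupling_law P Q z = P (fst z) \<Otimes>\<^sub>M Q (snd z)"

text \<open>The coupling is sent to the cemetery as soon as one of its components is.\<close>

definition coupling_process ::
  "(real \<Rightarrow> 'v \<Rightarrow> 'a option) \<Rightarrow> (real \<Rightarrow> 'w \<Rightarrow> 'b option) \<Rightarrow> real \<Rightarrow> 'v \<times> 'w \<Rightarrow> ('a \<times> 'b) option" where
  "coupling_process X Y t \<omega> =
     (case (X t (fst \<omega>), Y t (snd \<omega>)) of (Some x, Some y) \<Rightarrow> Some (x, y) | _ \<Rightarrow> None)"

text \<open>The functions \<open>y \<mapsto> \<parallel>u(\<cdot>, y)\<parallel>\<close> and \<open>y \<mapsto> \<E> (u(\<cdot>, y)) (v(\<cdot>, y))\<close> below are defined only for
  a.e. \<open>y\<close>; they are set to 0 on the exceptional null set.\<close>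

definition L2_sections_fst ::
  "'a measure \<Rightarrow> 'b measure \<Rightarrow> 'a form \<Rightarrow> ('a \<Rightarrow> real) set \<Rightarrow> ('a \<times> 'b \<Rightarrow> real) set" where
  "L2_sections_fst MX MY \<E> \<F> =
     {u \<in> L2 (MX \<Otimes>\<^sub>M MY). (AE y in MY. (\<lambda>x. u (x, y)) \<in> \<F>) \<and>
        (\<lambda>y. if (\<lambda>x. u (x, y)) \<in> \<F> then form1_norm MX \<E> (\<lambda>x. u (x, y)) else 0) \<in> L2 MY}"

definition L2_sections_snd ::
  "'a measure \<Rightarrow> 'b measure \<Rightarrow> 'b form \<Rightarrow> ('b \<Rightarrow> real) set \<Rightarrow> ('a \<times> 'b \<Rightarrow> real) set" where
  "L2_sections_snd MX MY \<E> \<F> =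
     {u \<in> L2 (MX \<Otimes>\<^sub>M MY). (AE x in MX. (\<lambda>y. u (x, y)) \<in> \<F>) \<and>
        (\<lambda>x. if (\<lambda>y. u (x, y)) \<in> \<F> then form1_norm MY \<E> (\<lambda>y. u (x, y)) else 0) \<in> L2 MX}"

definition prod_domain ::
  "'a measure \<Rightarrow> 'b measure \<Rightarrow> 'a form \<Rightarrow> ('a \<Rightarrow> real) set \<Rightarrow> 'b form \<Rightarrow> ('b \<Rightarrow> real) set \<Rightarrow>
   ('a \<times> 'b \<Rightarrow> real) set" where
  "prod_domain MX MY \<E>X \<F>X \<E>Y \<F>Y = L2_sections_fst MX MY \<E>X \<F>X \<inter> L2_sections_snd MX MY \<E>Y \<F>Y"

definition prod_form ::
  "'a measure \<Rightarrow> 'b measure \<Rightarrow> 'a form \<Rightarrow> ('a \<Rightarrow> real) set \<Rightarrow> 'b form \<Rightarrow> ('b \<Rightarrow> real) set \<Rightarrow>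
   ('a \<times> 'b) form" where
  "prod_form MX MY \<E>X \<F>X \<E>Y \<F>Y u v =
     (LINT y|MY. (if (\<lambda>x. u (x, y)) \<in> \<F>X \<and> (\<lambda>x. v (x, y)) \<in> \<F>X
                 then \<E>X (\<lambda>x. u (x, y)) (\<lambda>x. v (x, y)) else 0)) +
     (LINT x|MX. (if (\<lambda>y. u (x, y)) \<in> \<F>Y \<and> (\<lambda>y. v (x, y)) \<in> \<F>Y
                 then \<E>Y (\<lambda>y. u (x, y)) (\<lambda>y. v (x, y)) else 0))"

definition tensor_span ::
  "('a \<Rightarrow> real) set \<Rightarrow> ('b \<Rightarrow> real) set \<Rightarrow> ('a \<times> 'b \<Rightarrow> real) set" where
  "tensor_span C D =
     {(\<lambda>(x, y). \<Sum>i<n. c i * (f i x * g i y)) |(n::nat) c f g.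
        (\<forall>i<n. f i \<in> C) \<and> (\<forall>i<n. g i \<in> D)}"

end

theory Submission
  imports Defs
begin

text \<open>
  The argument is carried by semigroups; no generators, resolvents or spectral measures occur.
  Let \<open>p\<^sub>t\<close> and \<open>q\<^sub>t\<close> be the transition kernels of \<open>X\<close> and \<open>Y\<close>. On the \<open>L\<^sup>2\<close>-space of
  \<open>MX \<Otimes>\<^sub>M MY\<close> let \<open>A\<^sub>t\<close> apply \<open>p\<^sub>t\<close> to the first variable and \<open>B\<^sub>t\<close> apply \<open>q\<^sub>t\<close> to the second.
  The transition kernels of the coupling are the products \<open>p\<^sub>t \<Otimes>\<^sub>M q\<^sub>t\<close>, so its semigroup is
  \<open>T\<^sub>t = A\<^sub>t B\<^sub>t = B\<^sub>t A\<^sub>t\<close>.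

  The form of a symmetric semigroup \<open>S\<close> is the limit, as \<open>t\<close> decreases to 0, of the energies
  \<open>(u - S\<^sub>t u, u) / t\<close>. The function \<open>t \<mapsto> (S\<^sub>t u, u)\<close> is convex (\<open>sg_correlation_convex\<close>), so these
  energies increase to their limit. As a supremum of \<open>L\<^sup>2\<close>-continuous forms the limit is closed
  (\<open>form_closed_sof\<close>). Convexity also shows that \<open>S\<^sub>t\<close> maps all of \<open>L\<^sup>2\<close> boundedly into the domain
  (\<open>sof_smooth\<close>), and \<open>S\<^sub>t u\<close> tends to \<open>u\<close> in the form norm for \<open>u\<close> in the domain
  (\<open>sof_semigroup_tendsto\<close>).

  By Fubini's theorem the energy of \<open>A\<close> at \<open>u\<close> is the integral over \<open>y\<close> of the energies of \<open>X\<close> at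
  \<open>u (\<cdot>, y)\<close>. Monotone convergence then identifies the form of \<open>A\<close> as the integral of the form of \<open>X\<close>
  over the sections, with domain \<open>L2_sections_fst\<close>; the same holds for \<open>B\<close> and \<open>Y\<close>
  (\<open>L2_sections_snd_eq\<close>, \<open>sg_form_lift_eq\<close>). For commuting semigroups the form of the product is the
  sum of the forms, on the intersection of the domains (\<open>sg_form_commuting_product\<close>). Hence the
  product form is the form of \<open>T\<close> (\<open>semigroup_of_prod_form\<close>). It is Markovian because the unit
  contraction acts on each section separately.

  Tensors of \<open>L\<^sup>2\<close>-functions are dense in \<open>L\<^sup>2\<close>, and \<open>T\<^sub>t\<close> maps them to tensors of functions in the
  two domains. By the smoothing property such tensors are dense in the form norm
  (\<open>tensor_span_form_dense\<close>), and each factor can be replaced by an element of the given core because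
  the form norm of a tensor is at most the product of the form norms of its factors
  (\<open>tensor_prod_domain\<close>). Uniform density follows from a partition of unity in the first
  variable (\<open>Cc_tensor_span_dense\<close>).

  The Markov property of each component says that two finite measures on its past agree. Products
  of these measures agree as well, which is the Markov property of the coupling with respect to the
  product of the two pasts, and this product contains the past of the coupling
  (\<open>coupling_markov_rectangle\<close>, \<open>coupling_markov\<close>). Symmetry is Tonelli's theorem
  (\<open>symmetric_kernel_prod\<close>).
\<close>

section \<open>Nonnegative symmetric forms\<close>

context
  fixes B :: "'a form" and V :: "('a \<Rightarrow> real) set"
  assumes S: "symmetric_form B V"
begin

lemma form_zero_mem: "(\<lambda>_. 0) \<in> V"
  and form_add_mem: "u \<in> V \<Longrightarrow> v \<in> V \<Longrightarrow> (\<lambda>x. u x + v x) \<in> V"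
  and form_scale_mem: "u \<in> V \<Longrightarrow> (\<lambda>x. c * u x) \<in> V"
  using S by (auto simp: symmetric_form_def linear_space_def)

lemma form_diff_mem: "u \<in> V \<Longrightarrow> v \<in> V \<Longrightarrow> (\<lambda>x. u x - v x) \<in> V"
  using form_add_mem[of u "\<lambda>x. -1 * v x"] form_scale_mem[of v "-1"] by simp

lemma form_sym: "u \<in> V \<Longrightarrow> v \<in> V \<Longrightarrow> B u v = B v u"
  using S[unfolded symmetric_form_def, THEN conjunct2, THEN conjunct1] by blast

lemma form_add_left: "u \<in> V \<Longrightarrow> v \<in> V \<Longrightarrow> w \<in> V \<Longrightarrow> B (\<lambda>x. u x + v x) w = B u w + B v w"
  using S[unfolded symmetric_form_def, THEN conjunct2, THEN conjunct2, THEN conjunct1]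
  by blast

lemma form_scale_left: "u \<in> V \<Longrightarrow> v \<in> V \<Longrightarrow> B (\<lambda>x. c * u x) v = c * B u v"
  using S[unfolded symmetric_form_def, THEN conjunct2, THEN conjunct2, THEN conjunct2, THEN conjunct1]
  by blast

lemma form_nonneg: "u \<in> V \<Longrightarrow> 0 \<le> B u u"
  using S[unfolded symmetric_form_def, THEN conjunct2, THEN conjunct2, THEN conjunct2, THEN conjunct2]
  by (rule bspec)

lemma form_add_right:
  assumes "u \<in> V" "v \<in> V" "w \<in> V"
  shows "B w (\<lambda>x. u x + v x) = B w u + B w v"
  using form_add_left[OF assms] form_sym[OF assms(3) form_add_mem[OF assms(1,2)]]
    form_sym[OF assms(3,1)] form_sym[OF assms(3,2)] by simp

lemma form_scale_right:
  assumes "u \<in> V" "v \<in> V"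
  shows "B v (\<lambda>x. c * u x) = c * B v u"
  using form_scale_left[OF assms] form_sym[OF assms(2) form_scale_mem[OF assms(1)]]
    form_sym[OF assms(2,1)] by simp

lemma form_diff_left: "u \<in> V \<Longrightarrow> v \<in> V \<Longrightarrow> w \<in> V \<Longrightarrow> B (\<lambda>x. u x - v x) w = B u w - B v w"
  using form_add_left[of u "\<lambda>x. -1 * v x" w] form_scale_left[of v w "-1"] form_scale_mem[of v "-1"]
  by simp

lemma form_diff_right:
  assumes "u \<in> V" "v \<in> V" "w \<in> V"
  shows "B w (\<lambda>x. u x - v x) = B w u - B w v"
  using form_diff_left[OF assms] form_sym[OF assms(3) form_diff_mem[OF assms(1,2)]]
    form_sym[OF assms(3,1)] form_sym[OF assms(3,2)] by simp

lemma form_expand_add: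
  "u \<in> V \<Longrightarrow> v \<in> V \<Longrightarrow> B (\<lambda>x. u x + v x) (\<lambda>x. u x + v x) = B u u + 2 * B u v + B v v"
  using form_add_mem[of u v] form_sym[of v u] by (simp add: form_add_left form_add_right)

lemma form_expand_diff:
  "u \<in> V \<Longrightarrow> v \<in> V \<Longrightarrow> B (\<lambda>x. u x - v x) (\<lambda>x. u x - v x) = B u u - 2 * B u v + B v v"
  using form_diff_mem[of u v] form_sym[of v u] by (simp add: form_diff_left form_diff_right)

lemma form_expand_scale: "u \<in> V \<Longrightarrow> B (\<lambda>x. c * u x) (\<lambda>x. c * u x) = c\<^sup>2 * B u u"
  using form_scale_mem[of u c] by (simp add: form_scale_left form_scale_right power2_eq_square)

lemma form_polarization:
  assumes "u \<in> V" "v \<in> V"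
  shows "B u v = (B (\<lambda>x. u x + v x) (\<lambda>x. u x + v x) - B (\<lambda>x. u x - v x) (\<lambda>x. u x - v x)) / 4"
  using form_expand_add[OF assms] form_expand_diff[OF assms] by simp

lemma form_add_le:
  assumes "u \<in> V" "v \<in> V"
  shows "B (\<lambda>x. u x + v x) (\<lambda>x. u x + v x) \<le> 2 * B u u + 2 * B v v"
  using form_expand_add[OF assms] form_expand_diff[OF assms] form_nonneg[OF form_diff_mem[OF assms]]
  by simp

lemma form_Cauchy_Schwarz_square:
  assumes u: "u \<in> V" and v: "v \<in> V"
  shows "(B u v)\<^sup>2 \<le> B u u * B v v"
proof -
  have q: "0 \<le> B u u - 2 * c * B u v + c\<^sup>2 * B v v" for c
    using form_nonneg[OF form_diff_mem[OF u form_scale_mem[OF v, of c]]]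
      form_expand_diff[OF u form_scale_mem[OF v, of c]] form_scale_right[OF v u, of c]
      form_expand_scale[OF v, of c] by simp
  show ?thesis
  proof (cases "B v v = 0")
    case True
    have "B u v = 0"
    proof (rule ccontr)
      assume n: "B u v \<noteq> 0"
      have "0 \<le> B u u - 2 * ((B u u + 1) / (2 * B u v)) * B u v"
        using q[of "(B u u + 1) / (2 * B u v)"] True by simp
      also have "\<dots> = -1" using n by (simp add: field_simps)
      finally show False by simp
    qed
    then show ?thesis using True by simp
  next
    case False
    then have p: "B v v > 0" using form_nonneg[OF v] by simp
    have "0 \<le> B u u - 2 * (B u v / B v v) * B u v + (B u v / B v v)\<^sup>2 * B v v" by (rule q)
    also have "\<dots> = B u u - (B u v)\<^sup>2 / B v v"
      using p by (simp add: field_simps power2_eq_square)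
    finally show ?thesis using p by (simp add: field_simps)
  qed
qed

lemma form_Cauchy_Schwarz:
  assumes u: "u \<in> V" and v: "v \<in> V"
  shows "\<bar>B u v\<bar> \<le> sqrt (B u u) * sqrt (B v v)"
  using real_sqrt_le_mono[OF form_Cauchy_Schwarz_square[OF u v]] by (simp add: real_sqrt_mult)

lemma form_triangle:
  assumes u: "u \<in> V" and v: "v \<in> V"
  shows "sqrt (B (\<lambda>x. u x + v x) (\<lambda>x. u x + v x)) \<le> sqrt (B u u) + sqrt (B v v)"
proof (rule real_le_lsqrt)
  have "B u v \<le> sqrt (B u u) * sqrt (B v v)" using form_Cauchy_Schwarz[OF u v] by simp
  then show "B (\<lambda>x. u x + v x) (\<lambda>x. u x + v x) \<le> (sqrt (B u u) + sqrt (B v v))\<^sup>2"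
    using form_nonneg[OF u] form_nonneg[OF v]
    by (simp add: form_expand_add[OF u v] power2_sum)
qed (use form_nonneg[OF u] form_nonneg[OF v] in simp)

lemma form_norm_scale:
  "u \<in> V \<Longrightarrow> sqrt (B (\<lambda>x. c * u x) (\<lambda>x. c * u x)) = \<bar>c\<bar> * sqrt (B u u)"
  by (simp add: form_expand_scale real_sqrt_mult)

lemma form_norm_minus_commute:
  assumes "u \<in> V" "v \<in> V"
  shows "B (\<lambda>x. u x - v x) (\<lambda>x. u x - v x) = B (\<lambda>x. v x - u x) (\<lambda>x. v x - u x)"
  using form_expand_diff[of u v] form_expand_diff[of v u] form_sym[of u v] assms by simp

lemma form_zero: "B (\<lambda>_. 0) (\<lambda>_. 0) = 0"
  using form_scale_left[OF form_zero_mem form_zero_mem, of 0] by simp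

lemma form_tendsto:
  assumes u: "\<And>n. u n \<in> V" and v: "v \<in> V"
    and lim: "((\<lambda>n. B (\<lambda>x. u n x - v x) (\<lambda>x. u n x - v x)) \<longlongrightarrow> 0) F"
  shows "((\<lambda>n. B (u n) (u n)) \<longlongrightarrow> B v v) F"
proof -
  define d where "d n = (\<lambda>x. u n x - v x)" for n
  have d: "d n \<in> V" for n unfolding d_def by (rule form_diff_mem) (rule u v)+
  have lim': "((\<lambda>n. B (d n) (d n)) \<longlongrightarrow> 0) F" using lim by (simp add: d_def)
  have "((\<lambda>n. sqrt (B (d n) (d n)) * sqrt (B v v)) \<longlongrightarrow> 0) F"
    using tendsto_mult_right[OF tendsto_real_sqrt[OF lim'], of "sqrt (B v v)"] by simp
  then have "((\<lambda>n. B (d n) v) \<longlongrightarrow> 0) F"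
    by (rule Lim_null_comparison[rotated])
      (use form_Cauchy_Schwarz[OF d v] in \<open>auto intro: always_eventually\<close>)
  then have "((\<lambda>n. B (d n) (d n) + 2 * B (d n) v + B v v) \<longlongrightarrow> 0 + 2 * 0 + B v v) F"
    by (intro tendsto_intros lim')
  moreover have "B (u n) (u n) = B (d n) (d n) + 2 * B (d n) v + B v v" for n
    using form_expand_add[OF d v, of n] by (simp add: d_def)
  ultimately show ?thesis by simp
qed

lemma form_sum_mem: "(\<And>i. i < n \<Longrightarrow> u i \<in> V) \<Longrightarrow> (\<lambda>x. \<Sum>i<(n::nat). u i x) \<in> V"
  by (induction n) (simp_all add: form_zero_mem form_add_mem)

lemma form_norm_sum:
  "(\<And>i. i < n \<Longrightarrow> u i \<in> V) \<Longrightarrow>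
    sqrt (B (\<lambda>x. \<Sum>i<(n::nat). u i x) (\<lambda>x. \<Sum>i<n. u i x)) \<le> (\<Sum>i<n. sqrt (B (u i) (u i)))"
proof (induction n)
  case 0 then show ?case by (simp add: form_zero)
next
  case (Suc n)
  then show ?case using form_triangle[OF form_sum_mem[of n u], of "u n"] by fastforce
qed

text \<open>Log-convexity: with \<open>a n = B (A\<^sup>n u) (A\<^sup>n u)\<close>, symmetry of \<open>A\<close> gives
  \<open>(a (n + 1))\<^sup>2 \<le> a n * a (n + 2)\<close>, so if \<open>a\<close> increased at its first step it would grow
  geometrically. The lemma is used where \<open>A\<close> is a symmetric contraction that commutes with the
  operator of the form, in place of the square root of that operator.\<close>

lemma form_power_bounded_contraction:
  assumes A: "\<And>v. v \<in> V \<Longrightarrow> A v \<in> V"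
    and sym: "\<And>v w. v \<in> V \<Longrightarrow> w \<in> V \<Longrightarrow> B (A v) w = B v (A w)"
    and u: "u \<in> V" and bound: "\<And>n. B ((A ^^ n) u) ((A ^^ n) u) \<le> C"
  shows "B (A u) (A u) \<le> B u u"
proof (rule ccontr)
  define a where "a n = B ((A ^^ n) u) ((A ^^ n) u)" for n
  have mem: "(A ^^ n) u \<in> V" for n by (induction n) (auto intro: A u)
  have a0: "0 \<le> a n" for n unfolding a_def by (intro form_nonneg mem)
  have log: "(a (Suc n))\<^sup>2 \<le> a n * a (Suc (Suc n))" for n
  proof -
    have "a (Suc n) = B ((A ^^ n) u) ((A ^^ Suc (Suc n)) u)"
      using sym[OF mem[of n] mem[of "Suc n"]] by (simp add: a_def)
    then show ?thesis using form_Cauchy_Schwarz_square[OF mem[of n] mem[of "Suc (Suc n)"]]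
      by (simp add: a_def)
  qed
  assume "\<not> ?thesis"
  then have lt: "a 0 < a 1" by (simp add: a_def)
  have pos: "0 < a 0"
    using log[of 0] lt a0[of 0] by (cases "a 0 = 0") (auto simp: order_less_le)
  define r where "r = a 1 / a 0"
  have r: "1 < r" using lt pos by (simp add: r_def)
  have step: "0 < a n \<and> r * a n \<le> a (Suc n)" for n
  proof (induction n)
    case 0 then show ?case using pos by (simp add: r_def)
  next
    case (Suc n)
    then have p: "0 < a n" and q: "r * a n \<le> a (Suc n)" by auto
    have "0 < r * a n" using p r by simp
    then have s: "0 < a (Suc n)" using q by simp
    have "(r * a (Suc n)) * a n \<le> (a (Suc n))\<^sup>2"
      using mult_right_mono[OF q, of "a (Suc n)"] s by (simp add: power2_eq_square algebra_simps)
    also have "\<dots> \<le> a (Suc (Suc n)) * a n" using log[of n] by (simp add: mult.commute)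
    finally show ?case using p s by simp
  qed
  have "r ^ n * a 0 \<le> a n" for n
  proof (induction n)
    case (Suc n)
    have "r ^ Suc n * a 0 = r * (r ^ n * a 0)" by simp
    also have "\<dots> \<le> r * a n" using Suc r by simp
    also have "\<dots> \<le> a (Suc n)" using step[of n] by simp
    finally show ?case .
  qed simp
  moreover obtain n where "C / a 0 < r ^ n" using real_arch_pow[OF r] by blast
  ultimately have "C < a n" using pos
    by (smt (verit) divide_less_eq)
  then show False using bound[of n] by (simp add: a_def)
qed

end

section \<open>Square-integrable functions\<close>

lemma L2_I: "u \<in> borel_measurable M \<Longrightarrow> integrable M (\<lambda>x. (u x)\<^sup>2) \<Longrightarrow> u \<in> L2 M"
  and L2_measurable: "u \<in> L2 M \<Longrightarrow> u \<in> borel_measurable M"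
  and L2_square_integrable: "u \<in> L2 M \<Longrightarrow> integrable M (\<lambda>x. (u x)\<^sup>2)"
  by (auto simp: L2_def)

lemma L2_iff_nn_integral:
  "u \<in> L2 M \<longleftrightarrow> u \<in> borel_measurable M \<and> (\<integral>\<^sup>+x. ennreal ((u x)\<^sup>2) \<partial>M) < \<infinity>"
  by (auto simp: L2_def integrable_iff_bounded)

lemma L2_mult_integrable:
  assumes "u \<in> L2 M" "v \<in> L2 M"
  shows "integrable M (\<lambda>x. u x * v x)"
proof (rule Bochner_Integration.integrable_bound)
  show "integrable M (\<lambda>x. (u x)\<^sup>2 + (v x)\<^sup>2)" using assms by (simp add: L2_def)
  show "AE x in M. norm (u x * v x) \<le> norm ((u x)\<^sup>2 + (v x)\<^sup>2)"
  proof (rule AE_I2)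
    fix x
    have "0 \<le> (\<bar>u x\<bar> - \<bar>v x\<bar>)\<^sup>2" by simp
    then have "2 * (\<bar>u x\<bar> * \<bar>v x\<bar>) \<le> (u x)\<^sup>2 + (v x)\<^sup>2" by (simp add: power2_diff algebra_simps)
    moreover have "0 \<le> \<bar>u x\<bar> * \<bar>v x\<bar>" by simp
    ultimately have "\<bar>u x\<bar> * \<bar>v x\<bar> \<le> (u x)\<^sup>2 + (v x)\<^sup>2" by linarith
    then show "norm (u x * v x) \<le> norm ((u x)\<^sup>2 + (v x)\<^sup>2)" by (simp add: abs_mult)
  qed
qed (use assms in \<open>auto simp: L2_def intro!: borel_measurable_times\<close>)

lemma L2_cmult: "u \<in> L2 M \<Longrightarrow> (\<lambda>x. c * u x) \<in> L2 M"
  by (auto simp: L2_def power_mult_distrib intro!: borel_measurable_times)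

lemma L2_add:
  assumes "u \<in> L2 M" "v \<in> L2 M"
  shows "(\<lambda>x. u x + v x) \<in> L2 M"
proof -
  have "integrable M (\<lambda>x. (u x)\<^sup>2 + (v x)\<^sup>2 + 2 * (u x * v x))"
    using assms L2_mult_integrable[OF assms] by (simp add: L2_def)
  then show ?thesis using assms
    by (auto simp: L2_def power2_sum algebra_simps intro!: borel_measurable_add)
qed

lemma symmetric_form_L2: "symmetric_form (L2_inner M) (L2 M)"
proof -
  have "L2_inner M (\<lambda>x. u x + v x) w = L2_inner M u w + L2_inner M v w"
    if "u \<in> L2 M" "v \<in> L2 M" "w \<in> L2 M" for u v w
    using that by (simp add: L2_inner_def distrib_right L2_mult_integrable)
  moreover have "L2_inner M (\<lambda>x. c * u x) v = c * L2_inner M u v" for c u v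
    by (simp add: L2_inner_def mult.assoc)
  moreover have "0 \<le> L2_inner M u u" for u by (simp add: L2_inner_def)
  moreover have "(\<lambda>_. 0) \<in> L2 M" by (simp add: L2_def)
  moreover have "L2_inner M u v = L2_inner M v u" for u v
    by (simp add: L2_inner_def mult.commute)
  ultimately show ?thesis
    unfolding symmetric_form_def linear_space_def
    by (simp add: L2_add L2_cmult)
qed

lemmas L2_zero = form_zero_mem[OF symmetric_form_L2]
lemmas L2_diff = form_diff_mem[OF symmetric_form_L2]

lemma L2_norm_square: "u \<in> L2 M \<Longrightarrow> (L2_norm M u)\<^sup>2 = L2_inner M u u"
  using form_nonneg[OF symmetric_form_L2] by (simp add: L2_norm_def)

lemma L2_norm_nonneg: "u \<in> L2 M \<Longrightarrow> 0 \<le> L2_norm M u"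
  using form_nonneg[OF symmetric_form_L2] by (simp add: L2_norm_def)

lemma L2_Cauchy_Schwarz:
  "u \<in> L2 M \<Longrightarrow> v \<in> L2 M \<Longrightarrow> \<bar>L2_inner M u v\<bar> \<le> L2_norm M u * L2_norm M v"
  using form_Cauchy_Schwarz[OF symmetric_form_L2] by (simp add: L2_norm_def)

lemma L2_triangle:
  "u \<in> L2 M \<Longrightarrow> v \<in> L2 M \<Longrightarrow> L2_norm M (\<lambda>x. u x + v x) \<le> L2_norm M u + L2_norm M v"
  using form_triangle[OF symmetric_form_L2] by (simp add: L2_norm_def)

lemma L2_norm_minus_commute:
  "u \<in> L2 M \<Longrightarrow> v \<in> L2 M \<Longrightarrow> L2_norm M (\<lambda>x. u x - v x) = L2_norm M (\<lambda>x. v x - u x)"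
  using form_norm_minus_commute[OF symmetric_form_L2] by (simp add: L2_norm_def)

lemma L2_inner_nn_integral:
  "u \<in> L2 M \<Longrightarrow> ennreal (L2_inner M u u) = (\<integral>\<^sup>+x. ennreal ((u x)\<^sup>2) \<partial>M)"
  unfolding L2_inner_def
  by (subst nn_integral_eq_integral) (auto simp: L2_def power2_eq_square)

lemma L2_inner_cong_AE:
  assumes "AE x in M. u x = u' x" "AE x in M. v x = v' x"
    and "u \<in> borel_measurable M" "u' \<in> borel_measurable M"
    and "v \<in> borel_measurable M" "v' \<in> borel_measurable M"
  shows "L2_inner M u v = L2_inner M u' v'"
  unfolding L2_inner_def
  by (rule integral_cong_AE) (use assms in \<open>auto intro!: borel_measurable_times\<close>)

lemma L2_norm_cong_AE:
  assumes "AE x in M. u x = u' x" "u \<in> borel_measurable M" "u' \<in> borel_measurable M"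
  shows "L2_norm M u = L2_norm M u'"
  unfolding L2_norm_def using L2_inner_cong_AE[OF assms(1,1,2,3,2,3)] by simp

lemma L2_cong_AE:
  assumes "u \<in> L2 M" "u' \<in> borel_measurable M" "AE x in M. u x = u' x"
  shows "u' \<in> L2 M"
proof (rule L2_I)
  have m: "(\<lambda>x. (u x)\<^sup>2) \<in> borel_measurable M" "(\<lambda>x. (u' x)\<^sup>2) \<in> borel_measurable M"
    using assms(1,2) by (auto simp: L2_def intro!: borel_measurable_power)
  show "integrable M (\<lambda>x. (u' x)\<^sup>2)"
    by (rule integrable_cong_AE_imp[OF L2_square_integrable[OF assms(1)] m(2)])
      (use assms(3) in auto)
qed fact

text \<open>Fischer--Riesz. Along a subsequence with \<open>\<parallel>u\<^sub>k\<^sub>+\<^sub>1 - u\<^sub>k\<parallel> \<le> 2\<^sup>-\<^sup>k\<close> the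
  sum of \<open>\<bar>u\<^sub>k\<^sub>+\<^sub>1 - u\<^sub>k\<bar>\<close> is square-integrable, hence finite a.e., so the subsequence
  converges a.e.; Fatou's lemma identifies the pointwise limit as the limit in the norm.\<close>

lemma L2_complete:
  fixes u :: "nat \<Rightarrow> 'a \<Rightarrow> real"
  assumes u: "\<And>n. u n \<in> L2 M"
    and Cauchy: "\<And>\<epsilon>. \<epsilon> > 0 \<Longrightarrow> \<exists>N. \<forall>i\<ge>N. \<forall>j\<ge>N. L2_norm M (\<lambda>x. u i x - u j x) < \<epsilon>"
  shows "\<exists>v\<in>L2 M. (\<lambda>n. L2_norm M (\<lambda>x. u n x - v x)) \<longlonglongrightarrow> 0"
proof -
  have meas[measurable]: "u n \<in> borel_measurable M" for n using u by (rule L2_measurable)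
  obtain N where N: "\<And>k i j. i \<ge> N k \<Longrightarrow> j \<ge> N k \<Longrightarrow> L2_norm M (\<lambda>x. u i x - u j x) < (1/2)^k"
    using Cauchy[of "(1/2)^_"] by (metis half_gt_zero_iff zero_less_one zero_less_power)
  define r where "r = rec_nat (N 0) (\<lambda>k rk. max (Suc rk) (N (Suc k)))"
  have rSuc: "r (Suc k) = max (Suc (r k)) (N (Suc k))" for k by (simp add: r_def)
  have rN: "r k \<ge> N k" for k by (cases k) (simp add: r_def, simp add: rSuc)
  have rmono: "strict_mono r" using rSuc by (simp add: strict_mono_Suc_iff less_max_iff_disj)
  define d where "d k x = \<bar>u (r (Suc k)) x - u (r k) x\<bar>" for k x
  have dm[measurable]: "d k \<in> borel_measurable M" for k unfolding d_def by measurable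
  have dL2: "d k \<in> L2 M" for k
    using L2_diff[OF u u, of "r (Suc k)" "r k"] unfolding d_def L2_def by auto
  have dnorm: "L2_norm M (d k) < (1/2)^k" for k
  proof -
    have "L2_norm M (d k) = L2_norm M (\<lambda>x. u (r (Suc k)) x - u (r k) x)"
      by (simp add: d_def L2_norm_def L2_inner_def)
    also have "\<dots> < (1/2)^k"
      using N[of k "r (Suc k)" "r k"] rN[of k] rSuc[of k] by simp
    finally show ?thesis .
  qed
  define S where "S n x = (\<Sum>k<n. d k x)" for n x
  have SL2: "S n \<in> L2 M" for n unfolding S_def
    by (rule form_sum_mem[OF symmetric_form_L2]) (rule dL2)
  have Snorm: "L2_norm M (S n) \<le> 2" for n
  proof -
    have "L2_norm M (S n) \<le> (\<Sum>k<n. L2_norm M (d k))"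
      using form_norm_sum[OF symmetric_form_L2, of n d] dL2 by (simp add: S_def[abs_def] L2_norm_def)
    also have "\<dots> \<le> (\<Sum>k<n. (1/2)^k)" by (intro sum_mono) (simp add: dnorm less_imp_le)
    also have "\<dots> \<le> 2" by (simp add: geometric_sum)
    finally show ?thesis .
  qed
  have S4: "(\<integral>\<^sup>+x. ennreal ((S n x)\<^sup>2) \<partial>M) \<le> ennreal 4" for n
  proof -
    have "L2_inner M (S n) (S n) \<le> 2\<^sup>2"
      using power_mono[OF Snorm L2_norm_nonneg[OF SL2], of n 2] L2_norm_square[OF SL2, of n] by simp
    then have "ennreal (L2_inner M (S n) (S n)) \<le> ennreal 4" by (intro ennreal_leI) simp
    then show ?thesis by (simp only: L2_inner_nn_integral[OF SL2])
  qed
  have S0: "0 \<le> S n x" for n x unfolding S_def d_def by (simp add: sum_nonneg)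
  have Smono: "S n x \<le> S m x" if "n \<le> m" for n m x
    unfolding S_def d_def by (rule sum_mono2) (use that in auto)
  have [measurable]: "S n \<in> borel_measurable M" for n using SL2 by (rule L2_measurable)
  have "(\<integral>\<^sup>+x. (SUP n. ennreal ((S n x)\<^sup>2)) \<partial>M) = (SUP n. \<integral>\<^sup>+x. ennreal ((S n x)\<^sup>2) \<partial>M)"
    by (intro nn_integral_monotone_convergence_SUP)
      (auto simp: incseq_def le_fun_def S0 Smono intro!: ennreal_leI power_mono)
  also have "\<dots> \<le> ennreal 4" by (intro SUP_least S4)
  finally have "(\<integral>\<^sup>+x. (SUP n. ennreal ((S n x)\<^sup>2)) \<partial>M) \<noteq> \<infinity>" by (auto simp: top_unique)
  then have "AE x in M. (SUP n. ennreal ((S n x)\<^sup>2)) \<noteq> \<infinity>" by (intro nn_integral_PInf_AE) auto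
  then have conv: "AE x in M. convergent (\<lambda>k. u (r k) x)"
  proof (eventually_elim)
    case (elim x)
    then obtain c where c: "0 \<le> c" "(SUP n. ennreal ((S n x)\<^sup>2)) = ennreal c"
      by (metis ennreal_cases infinity_ennreal_def)
    have "ennreal ((S n x)\<^sup>2) \<le> ennreal c" for n
      unfolding c(2)[symmetric] by (rule SUP_upper) simp
    then have "S n x \<le> sqrt c" for n
      using c(1) by (intro real_le_rsqrt) (simp add: ennreal_le_iff)
    then have "summable (\<lambda>k. d k x)"
      by (intro summableI_nonneg_bounded[where x="sqrt c"]) (auto simp: d_def S_def)
    then have "summable (\<lambda>k. u (r (Suc k)) x - u (r k) x)"
      unfolding d_def by (rule summable_rabs_cancel)
    then have "convergent (\<lambda>n. \<Sum>k<n. u (r (Suc k)) x - u (r k) x)"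
      by (simp add: summable_iff_convergent)
    then have "convergent (\<lambda>n. u (r n) x - u (r 0) x)"
      by (subst (asm) sum_lessThan_telescope[of "\<lambda>k. u (r k) x"])
    then show ?case using convergent_diff_const_right_iff by blast
  qed
  define v where "v x = lim (\<lambda>k. u (r k) x)" for x
  have vm[measurable]: "v \<in> borel_measurable M" unfolding v_def by measurable
  have lim: "AE x in M. (\<lambda>k. u (r k) x) \<longlonglongrightarrow> v x"
    using conv by eventually_elim (simp add: v_def convergent_LIMSEQ_iff)
  have close: "(\<integral>\<^sup>+x. ennreal ((u i x - v x)\<^sup>2) \<partial>M) \<le> ennreal (e\<^sup>2)"
    if e: "e > 0" and far: "\<And>j. j \<ge> K \<Longrightarrow> L2_norm M (\<lambda>x. u i x - u j x) < e" for i K e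
  proof -
    have "(\<integral>\<^sup>+x. ennreal ((u i x - v x)\<^sup>2) \<partial>M)
        = (\<integral>\<^sup>+x. liminf (\<lambda>k. ennreal ((u i x - u (r k) x)\<^sup>2)) \<partial>M)"
    proof (rule nn_integral_cong_AE, use lim in eventually_elim)
      case (elim x)
      have "(\<lambda>k. ennreal ((u i x - u (r k) x)\<^sup>2)) \<longlonglongrightarrow> ennreal ((u i x - v x)\<^sup>2)"
        by (intro tendsto_intros elim)
      from lim_imp_Liminf[OF trivial_limit_sequentially this] show ?case by (rule sym)
    qed
    also have "\<dots> \<le> liminf (\<lambda>k. \<integral>\<^sup>+x. ennreal ((u i x - u (r k) x)\<^sup>2) \<partial>M)"
      by (rule nn_integral_liminf) measurable
    also have "\<dots> \<le> ennreal (e\<^sup>2)"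
    proof (rule Liminf_le)
      have "eventually (\<lambda>k. r k \<ge> K) sequentially"
        by (rule eventually_sequentiallyI[of K]) (meson rmono seq_suble order_trans)
      then show "\<forall>\<^sub>F k in sequentially. (\<integral>\<^sup>+x. ennreal ((u i x - u (r k) x)\<^sup>2) \<partial>M) \<le> ennreal (e\<^sup>2)"
      proof eventually_elim
        case (elim k)
        have m: "(\<lambda>x. u i x - u (r k) x) \<in> L2 M" by (rule L2_diff) (rule u)+
        have "L2_inner M (\<lambda>x. u i x - u (r k) x) (\<lambda>x. u i x - u (r k) x) \<le> e\<^sup>2"
          using power_mono[OF less_imp_le[OF far[OF elim]] L2_norm_nonneg[OF m], of 2]
            L2_norm_square[OF m] by simp
        then show ?case by (simp add: L2_inner_nn_integral[OF m, symmetric] ennreal_leI)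
      qed
    qed simp
    finally show ?thesis .
  qed
  obtain K where K: "\<forall>i\<ge>K. \<forall>j\<ge>K. L2_norm M (\<lambda>x. u i x - u j x) < 1" using Cauchy[of 1] by auto
  have "(\<lambda>x. u K x - v x) \<in> L2 M"
    using close[of 1 K K] K by (auto simp: L2_iff_nn_integral top_unique less_top[symmetric])
  then have v: "v \<in> L2 M" using L2_diff[OF u[of K]] by fastforce
  have "(\<lambda>n. L2_norm M (\<lambda>x. u n x - v x)) \<longlonglongrightarrow> 0"
  proof (rule LIMSEQ_I)
    fix e :: real assume e: "e > 0"
    obtain K where K: "\<forall>i\<ge>K. \<forall>j\<ge>K. L2_norm M (\<lambda>x. u i x - u j x) < e/2"
      using Cauchy[of "e/2"] e by auto
    have "L2_norm M (\<lambda>x. u i x - v x) \<le> e/2" if "i \<ge> K" for i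
    proof -
      have m: "(\<lambda>x. u i x - v x) \<in> L2 M" by (rule L2_diff) (rule u v)+
      have "L2_inner M (\<lambda>x. u i x - v x) (\<lambda>x. u i x - v x) \<le> (e/2)\<^sup>2"
      proof (rule ennreal_le_iff[THEN iffD1])
        have "L2_norm M (\<lambda>x. u i x - u j x) < e/2" if "j \<ge> K" for j using K that \<open>i \<ge> K\<close> by blast
        then show "ennreal (L2_inner M (\<lambda>x. u i x - v x) (\<lambda>x. u i x - v x)) \<le> ennreal ((e/2)\<^sup>2)"
          unfolding L2_inner_nn_integral[OF m] using e by (intro close[of "e/2" K i]) simp_all
      qed simp
      then show ?thesis unfolding L2_norm_def using e by (intro real_le_lsqrt) auto
    qed
    then show "\<exists>no. \<forall>n\<ge>no. norm (L2_norm M (\<lambda>x. u n x - v x) - 0) < e"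
      using e L2_norm_nonneg[OF L2_diff[OF u v]] by (intro exI[of _ K]) fastforce
  qed
  with v show ?thesis by blast
qed

section \<open>Energies of symmetric semigroups\<close>

text \<open>The difference of \<open>f\<close> and one of its chords satisfies the same midpoint inequality and vanishes at
  the end points of the chord. A positive maximum would then also be attained further to the left.\<close>

lemma midpoint_convex_imp_convex_on:
  fixes f :: "real \<Rightarrow> real"
  assumes cont: "continuous_on {0..} f"
    and mid: "\<And>s t. 0 \<le> s \<Longrightarrow> 0 \<le> t \<Longrightarrow> f ((s + t) / 2) \<le> (f s + f t) / 2"
  shows "convex_on {0..} f"
proof (rule convex_on_linorderI)
  fix t a b :: real
  assume t: "0 < t" "t < 1" and ab: "a \<in> {0..}" "b \<in> {0..}" "a < b"
  define g where "g x = f x - (f a + (f b - f a) * ((x - a) / (b - a)))" for x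
  have ga: "g a = 0" and gb: "g b = 0" using ab by (simp_all add: g_def)
  have gmid: "g ((s + t) / 2) \<le> (g s + g t) / 2" if "0 \<le> s" "0 \<le> t" for s t
  proof -
    have "((s + t) / 2 - a) / (b - a) = ((s - a) / (b - a) + (t - a) / (b - a)) / 2"
      using ab by (simp add: divide_simps) (simp add: algebra_simps)
    then have "(f b - f a) * (((s + t) / 2 - a) / (b - a))
        = ((f b - f a) * ((s - a) / (b - a)) + (f b - f a) * ((t - a) / (b - a))) / 2"
      by (simp add: algebra_simps add_divide_distrib)
    then show ?thesis using mid[OF that] by (simp add: g_def field_simps)
  qed
  have gcont: "continuous_on {a..b} g" unfolding g_def
    by (intro continuous_intros continuous_on_subset[OF cont]) (use ab in auto)
  obtain m where m: "m \<in> {a..b}" "\<And>x. x \<in> {a..b} \<Longrightarrow> g x \<le> g m"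
    using continuous_attains_sup[OF compact_Icc _ gcont] ab by auto
  have "g m \<le> 0"
  proof (rule ccontr)
    \<comment> \<open>At the leftmost maximum the midpoint inequality is violated.\<close>
    assume pos: "\<not> g m \<le> 0"
    define K where "K = {x \<in> {a..b}. g x = g m}"
    have K: "K \<subseteq> {a..b}" by (auto simp: K_def)
    have "closed K"
      unfolding K_def using continuous_closed_preimage_constant[OF gcont closed_atLeastAtMost] .
    then have "compact K"
      using compact_Int_closed[OF compact_Icc[of a b], of K] K by (simp add: Int_absorb1)
    moreover have "K \<noteq> {}" using m by (auto simp: K_def)
    ultimately have "\<exists>c\<in>K. \<forall>x\<in>K. c \<le> x" by (rule compact_attains_inf)
    then obtain c where c: "c \<in> K" "\<And>x. x \<in> K \<Longrightarrow> c \<le> x" by blast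
    have cg: "g c = g m" and cI: "a \<le> c" "c \<le> b" using c(1) by (auto simp: K_def)
    have "c \<noteq> a" "c \<noteq> b" using cg pos ga gb by auto
    then have cab: "a < c" "c < b" using cI by auto
    define h where "h = min (c - a) (b - c)"
    have h: "0 < h" "a \<le> c - h" "c + h \<le> b" using cab by (auto simp: h_def)
    have "c - h \<notin> K" using c(2)[of "c - h"] h by auto
    then have "g (c - h) < g m" using m(2)[of "c - h"] h cab by (auto simp: K_def less_le)
    moreover have "g (c + h) \<le> g m" using m(2)[of "c + h"] h cab by auto
    moreover have "g c \<le> (g (c - h) + g (c + h)) / 2"
      using gmid[of "c - h" "c + h"] h ab cab by auto
    ultimately show False using cg by simp
  qed
  moreover have "(1 - t) * a + t * b \<in> {a..b}"
  proof -
    have "(1 - t) * a + t * b = a + t * (b - a)" by (simp add: algebra_simps)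
    moreover have "0 \<le> t * (b - a)" using t ab by simp
    moreover have "t * (b - a) \<le> 1 * (b - a)" using t ab by (intro mult_right_mono) auto
    ultimately show ?thesis by simp
  qed
  ultimately have "g ((1 - t) * a + t * b) \<le> 0" using m(2) by fastforce
  moreover have "((1 - t) * a + t * b - a) / (b - a) = t" using ab by (simp add: field_simps)
  ultimately have "f ((1 - t) * a + t * b) - (f a + (f b - f a) * t) \<le> 0" by (simp only: g_def)
  then show "f ((1 - t) *\<^sub>R a + t *\<^sub>R b) \<le> (1 - t) * f a + t * f b"
    by (simp add: algebra_simps)
qed simp

lemma eventually_at_right_0I: "(\<And>t::real. 0 < t \<Longrightarrow> P t) \<Longrightarrow> eventually P (at_right 0)"
  by (auto simp: eventually_at_right_field intro: exI[of _ 1])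

lemma antimono_bounded_tendsto_at_right_0:
  fixes f :: "real \<Rightarrow> real"
  assumes anti: "\<And>s t. 0 < s \<Longrightarrow> s \<le> t \<Longrightarrow> f t \<le> f s"
    and bound: "\<And>t. 0 < t \<Longrightarrow> f t \<le> C"
  shows "\<exists>l. (f \<longlongrightarrow> l) (at_right 0)"
proof -
  define l where "l = (SUP t\<in>{0<..}. f t)"
  have bdd: "bdd_above (f ` {0<..})" by (rule bdd_aboveI2[where M=C]) (use bound in simp)
  have le: "f t \<le> l" if "0 < t" for t unfolding l_def using that by (intro cSUP_upper bdd) auto
  have "(f \<longlongrightarrow> l) (at_right 0)"
  proof (rule order_tendstoI)
    fix a assume "a < l"
    then obtain s where s: "0 < s" "a < f s"
      unfolding l_def using less_cSUP_iff[OF _ bdd] by auto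
    then have "a < f t" if "0 < t" "t < s" for t using anti[of t s] that by simp
    then show "eventually (\<lambda>t. a < f t) (at_right 0)"
      using s(1) by (auto simp: eventually_at_right_field)
  next
    fix a assume "l < a"
    then have "f t < a" if "0 < t" for t using le[OF that] by simp
    then show "eventually (\<lambda>t. f t < a) (at_right 0)"
      by (auto simp: eventually_at_right_field intro: exI[of _ 1])
  qed
  then show ?thesis ..
qed

definition sg_energy :: "'a measure \<Rightarrow> (real \<Rightarrow> ('a \<Rightarrow> real) \<Rightarrow> 'a \<Rightarrow> real) \<Rightarrow> real \<Rightarrow> 'a form" where
  "sg_energy M T t u v = L2_inner M (\<lambda>x. u x - T t u x) v / t"

text \<open>The energies are nonincreasing in \<open>t\<close>, so boundedness is the same as convergence to a finite
  limit as \<open>t\<close> decreases to 0 (\<open>sg_domain_iff_tendsto\<close>).\<close>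

definition sg_domain :: "'a measure \<Rightarrow> (real \<Rightarrow> ('a \<Rightarrow> real) \<Rightarrow> 'a \<Rightarrow> real) \<Rightarrow> ('a \<Rightarrow> real) set" where
  "sg_domain M T = {u \<in> L2 M. \<exists>C. \<forall>t>0. sg_energy M T t u u \<le> C}"

definition sg_form :: "'a measure \<Rightarrow> (real \<Rightarrow> ('a \<Rightarrow> real) \<Rightarrow> 'a \<Rightarrow> real) \<Rightarrow> 'a form" where
  "sg_form M T u v = Lim (at_right 0) (\<lambda>t. sg_energy M T t u v)"

context
  fixes M :: "'a measure" and T :: "real \<Rightarrow> ('a \<Rightarrow> real) \<Rightarrow> 'a \<Rightarrow> real"
  assumes SG: "L2_semigroup M T"
begin

lemma sg_L2: "0 < t \<Longrightarrow> u \<in> L2 M \<Longrightarrow> T t u \<in> L2 M"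
  and sg_norm_le: "0 < t \<Longrightarrow> u \<in> L2 M \<Longrightarrow> L2_norm M (T t u) \<le> L2_norm M u"
  and sg_sym: "0 < t \<Longrightarrow> u \<in> L2 M \<Longrightarrow> v \<in> L2 M \<Longrightarrow> L2_inner M (T t u) v = L2_inner M u (T t v)"
  and sg_add_AE: "0 < s \<Longrightarrow> 0 < t \<Longrightarrow> u \<in> L2 M \<Longrightarrow> AE x in M. T (s + t) u x = T s (T t u) x"
  and sg_tendsto: "u \<in> L2 M \<Longrightarrow> ((\<lambda>t. L2_norm M (\<lambda>x. T t u x - u x)) \<longlongrightarrow> 0) (at_right 0)"
  using SG by (simp_all add: L2_semigroup_def)

lemma sg_square_le: "0 < t \<Longrightarrow> u \<in> L2 M \<Longrightarrow> L2_inner M (T t u) (T t u) \<le> L2_inner M u u"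
  using sg_norm_le[of t u] by (simp add: L2_norm_def)

lemma sg_inner_add:
  assumes "0 < s" "0 < t" "u \<in> L2 M" "v \<in> L2 M"
  shows "L2_inner M (T (s + t) u) v = L2_inner M (T s u) (T t v)"
proof -
  have "L2_inner M (T (t + s) u) v = L2_inner M (T t (T s u)) v"
    using assms by (intro L2_inner_cong_AE sg_add_AE) (auto intro!: L2_measurable sg_L2)
  then show ?thesis using assms sg_sym[of t "T s u" v] sg_L2 by (simp add: add.commute)
qed

lemma sg_energy_eq:
  assumes "0 < t" "u \<in> L2 M" "v \<in> L2 M"
  shows "sg_energy M T t u v = (L2_inner M u v - L2_inner M (T t u) v) / t"
  unfolding sg_energy_def using form_diff_left[OF symmetric_form_L2] assms sg_L2 by metis

lemma symmetric_form_sg_energy: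
  assumes t: "0 < t"
  shows "symmetric_form (sg_energy M T t) (L2 M)"
proof -
  note L = symmetric_form_L2[of M]
  have lin: "linear_space (L2 M)" using L by (simp add: symmetric_form_def)
  have "sg_energy M T t u v = sg_energy M T t v u" if "u \<in> L2 M" "v \<in> L2 M" for u v
    using that t form_sym[OF L that] sg_sym[OF t that] form_sym[OF L that(1) sg_L2[OF t that(2)]]
    by (simp add: sg_energy_eq)
  moreover have "sg_energy M T t (\<lambda>x. u x + v x) w = sg_energy M T t u w + sg_energy M T t v w"
    if "u \<in> L2 M" "v \<in> L2 M" "w \<in> L2 M" for u v w
    using that t by (simp add: sg_energy_eq form_add_mem[OF L] sg_sym form_add_left[OF L] sg_L2
        diff_divide_distrib add_divide_distrib)
  moreover have "sg_energy M T t (\<lambda>x. c * u x) v = c * sg_energy M T t u v"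
    if "u \<in> L2 M" "v \<in> L2 M" for c u v
    using that t by (simp add: sg_energy_eq form_scale_mem[OF L] sg_sym form_scale_left[OF L] sg_L2
        right_diff_distrib)
  moreover have "0 \<le> sg_energy M T t u u" if u: "u \<in> L2 M" for u
  proof -
    have "L2_inner M (T t u) u \<le> L2_norm M (T t u) * L2_norm M u"
      using L2_Cauchy_Schwarz[OF sg_L2[OF t u] u] by simp
    also have "\<dots> \<le> (L2_norm M u)\<^sup>2"
      using mult_right_mono[OF sg_norm_le[OF t u] L2_norm_nonneg[OF u]]
      by (simp add: power2_eq_square)
    finally show ?thesis using u t by (simp add: sg_energy_eq L2_norm_square)
  qed
  ultimately show ?thesis using lin unfolding symmetric_form_def by (intro conjI ballI allI)
qed

lemma sg_energy_le:
  assumes t: "0 < t" and u: "u \<in> L2 M"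
  shows "sg_energy M T t u u \<le> 2 * L2_inner M u u / t"
proof -
  have "\<bar>L2_inner M (T t u) u\<bar> \<le> L2_norm M (T t u) * L2_norm M u"
    using L2_Cauchy_Schwarz[OF sg_L2[OF t u] u] by simp
  also have "\<dots> \<le> (L2_norm M u)\<^sup>2"
    using mult_right_mono[OF sg_norm_le[OF t u] L2_norm_nonneg[OF u]]
    by (simp add: power2_eq_square)
  finally show ?thesis using u t
    by (auto simp: sg_energy_eq L2_norm_square intro!: divide_right_mono)
qed

lemma sg_energy_tendsto:
  assumes t: "0 < t" and u: "\<And>n. u n \<in> L2 M" and v: "v \<in> L2 M"
    and lim: "((\<lambda>n. L2_norm M (\<lambda>x. u n x - v x)) \<longlongrightarrow> 0) F"
  shows "((\<lambda>n. sg_energy M T t (u n) (u n)) \<longlongrightarrow> sg_energy M T t v v) F"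
proof (rule form_tendsto[OF symmetric_form_sg_energy[OF t] u v])
  have d: "(\<lambda>x. u n x - v x) \<in> L2 M" for n by (rule L2_diff) (rule u v)+
  have "((\<lambda>n. 2 * (L2_norm M (\<lambda>x. u n x - v x))\<^sup>2 / t) \<longlongrightarrow> 2 * 0\<^sup>2 / t) F"
    by (intro tendsto_intros lim) (use t in auto)
  then have lim': "((\<lambda>n. 2 * (L2_norm M (\<lambda>x. u n x - v x))\<^sup>2 / t) \<longlongrightarrow> 0) F" by simp
  have le: "sg_energy M T t (\<lambda>x. u n x - v x) (\<lambda>x. u n x - v x)
      \<le> 2 * (L2_norm M (\<lambda>x. u n x - v x))\<^sup>2 / t" for n
    using sg_energy_le[OF t d[of n]] by (simp only: L2_norm_square[OF d])
  have ge: "0 \<le> sg_energy M T t (\<lambda>x. u n x - v x) (\<lambda>x. u n x - v x)" for n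
    by (rule form_nonneg[OF symmetric_form_sg_energy[OF t] d])
  show "((\<lambda>n. sg_energy M T t (\<lambda>x. u n x - v x) (\<lambda>x. u n x - v x)) \<longlongrightarrow> 0) F"
    by (rule tendsto_sandwich[OF always_eventually always_eventually tendsto_const lim'])
      (use le ge in blast)+
qed

text \<open>The function \<open>\<phi> t = (T\<^sub>t u, u)\<close> is convex: by Cauchy--Schwarz,
  \<open>\<phi> (s + t) = (T\<^sub>s u, T\<^sub>t u) \<le> (\<phi> (2 * s) * \<phi> (2 * t))\<^sup>\<onehalf>\<close>. Everything that the
  spectral theorem would give about difference quotients of the semigroup is drawn from this
  convexity.\<close>

lemma sg_correlation_convex:
  assumes u: "u \<in> L2 M"
  shows "convex_on {0..} (\<lambda>t. if t = 0 then L2_inner M u u else L2_inner M (T t u) u)"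
proof -
  define S where "S t = (if t = 0 then u else T t u)" for t
  define \<phi> where "\<phi> t = L2_inner M (S t) u" for t
  note L = symmetric_form_L2[of M]
  have S: "S t \<in> L2 M" if "0 \<le> t" for t using that u sg_L2 by (simp add: S_def)
  have add: "\<phi> (s + t) = L2_inner M (S s) (S t)" if "0 \<le> s" "0 \<le> t" for s t
    using that u sg_inner_add[of s t u u] form_sym[OF L u sg_L2[of t u]]
    by (auto simp: \<phi>_def S_def)
  have "convex_on {0..} \<phi>"
  proof (rule midpoint_convex_imp_convex_on)
    fix s t :: real assume st: "0 \<le> s" "0 \<le> t"
    have "\<phi> ((s + t) / 2) = L2_inner M (S (s / 2)) (S (t / 2))"
      using add[of "s / 2" "t / 2"] st by (simp add: add_divide_distrib)
    moreover have "\<phi> s = L2_inner M (S (s / 2)) (S (s / 2))" "\<phi> t = L2_inner M (S (t / 2)) (S (t / 2))"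
      using add[of "s / 2" "s / 2"] add[of "t / 2" "t / 2"] st by simp_all
    ultimately show "\<phi> ((s + t) / 2) \<le> (\<phi> s + \<phi> t) / 2"
      using form_nonneg[OF L form_diff_mem[OF L S S], of "s / 2" "t / 2"] st
        form_expand_diff[OF L S S, of "s / 2" "t / 2"] by simp
  next
    have modulus: "\<bar>\<phi> (t + h) - \<phi> t\<bar> \<le> L2_norm M (\<lambda>x. T h u x - u x) * L2_norm M u"
      if "0 \<le> t" "0 < h" for t h
    proof -
      have d: "(\<lambda>x. T h u x - u x) \<in> L2 M" using that u by (intro L2_diff sg_L2)
      have "\<phi> (t + h) - \<phi> t = L2_inner M (S t) (\<lambda>x. T h u x - u x)"
        using that u add[of t h] form_diff_right[OF L sg_L2[of h u] u S[of t]]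
        by (simp add: \<phi>_def S_def)
      then have "\<bar>\<phi> (t + h) - \<phi> t\<bar> \<le> L2_norm M (S t) * L2_norm M (\<lambda>x. T h u x - u x)"
        using L2_Cauchy_Schwarz[OF S[OF that(1)] d] by simp
      also have "\<dots> \<le> L2_norm M u * L2_norm M (\<lambda>x. T h u x - u x)"
        using that u sg_norm_le[of t u] L2_norm_nonneg[OF d]
        by (intro mult_right_mono) (auto simp: S_def)
      finally show ?thesis by (simp add: mult.commute)
    qed
    have "((\<lambda>h. L2_norm M (\<lambda>x. T h u x - u x) * L2_norm M u) \<longlongrightarrow> 0) (at_right 0)"
      using tendsto_mult_right[OF sg_tendsto[OF u]] by simp
    then have small: "\<exists>d>0. \<forall>h>0. h < d \<longrightarrow> L2_norm M (\<lambda>x. T h u x - u x) * L2_norm M u < e"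
      if "0 < e" for e
      using order_tendstoD(2)[OF _ that] by (fastforce simp: eventually_at_right_field)
    have "uniformly_continuous_on {0..} \<phi>"
      unfolding uniformly_continuous_on_def
    proof (intro allI impI)
      fix e :: real assume e: "0 < e"
      obtain d where d: "0 < d"
        and le: "\<And>h. 0 < h \<Longrightarrow> h < d \<Longrightarrow> L2_norm M (\<lambda>x. T h u x - u x) * L2_norm M u < e"
        using small[OF e] by blast
      have ordered: "\<bar>\<phi> t - \<phi> s\<bar> < e" if "0 \<le> s" "s \<le> t" "t - s < d" for s t
        using modulus[of s "t - s"] le[of "t - s"] that e by (cases "s = t") auto
      have "dist (\<phi> t) (\<phi> s) < e" if "s \<in> {0..}" "t \<in> {0..}" "dist t s < d" for s t
        using ordered[of s t] ordered[of t s] that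
        by (cases "s \<le> t") (auto simp: dist_real_def abs_minus_commute)
      then show "\<exists>d>0. \<forall>x\<in>{0..}. \<forall>x'\<in>{0..}. dist x' x < d \<longrightarrow> dist (\<phi> x') (\<phi> x) < e"
        using d by blast
    qed
    then show "continuous_on {0..} \<phi>" by (rule uniformly_continuous_imp_continuous)
  qed
  moreover have "\<phi> = (\<lambda>t. if t = 0 then L2_inner M u u else L2_inner M (T t u) u)"
    by (auto simp: \<phi>_def S_def)
  ultimately show ?thesis by simp
qed

lemma sg_energy_antimono:
  assumes s: "0 < s" "s \<le> t" and u: "u \<in> L2 M"
  shows "sg_energy M T t u u \<le> sg_energy M T s u u"
proof (cases "s = t")
  case False
  then show ?thesis
    using convex_on_slope_le(1)[OF sg_correlation_convex[OF u], of 0 t s] s u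
    by (simp add: sg_energy_eq)
qed simp

lemma sg_inner_nonneg:
  assumes "0 < t" "u \<in> L2 M"
  shows "0 \<le> L2_inner M (T t u) u"
  using sg_inner_add[of "t / 2" "t / 2" u u] form_nonneg[OF symmetric_form_L2 sg_L2[of "t / 2" u]]
    assms by simp

text \<open>With \<open>\<phi> t = (T\<^sub>t u, u)\<close> the left-hand side is minus the slope of \<open>\<phi>\<close> on \<open>[2t, 2t + s]\<close>, which by
  convexity is at most minus the slope on \<open>[0, 2t]\<close>. The bound does not depend on \<open>s\<close>, so \<open>T\<^sub>t u\<close>
  lies in the domain of the form for every square-integrable \<open>u\<close>.\<close>

lemma sg_energy_smooth:
  assumes s: "0 < s" and t: "0 < t" and u: "u \<in> L2 M"
  shows "sg_energy M T s (T t u) (T t u) \<le> L2_inner M u u / (2 * t)"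
proof -
  note L = symmetric_form_L2[of M]
  define \<phi> where "\<phi> t = (if t = 0 then L2_inner M u u else L2_inner M (T t u) u)" for t
  have Tu: "T t u \<in> L2 M" using t u by (rule sg_L2)
  have 1: "L2_inner M (T t u) (T t u) = \<phi> (2 * t)"
    using sg_inner_add[OF t t u u] t by (simp add: \<phi>_def)
  have "L2_inner M (T s (T t u)) (T t u) = L2_inner M (T (s + t) u) (T t u)"
    using s t u Tu sg_add_AE[OF s t u] by (intro L2_inner_cong_AE) (auto intro!: L2_measurable sg_L2)
  also have "\<dots> = \<phi> (2 * t + s)"
    using sg_inner_add[of "s + t" t u u] s t u by (simp add: \<phi>_def algebra_simps)
  finally have 2: "sg_energy M T s (T t u) (T t u) = (\<phi> (2 * t) - \<phi> (2 * t + s)) / s"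
    using sg_energy_eq[OF s Tu Tu] 1 by simp
  have "convex_on {0..} \<phi>" unfolding \<phi>_def using sg_correlation_convex[OF u] .
  from convex_on_slope_le[OF this, of 0 "2 * t + s" "2 * t"]
  have "(\<phi> (2 * t) - \<phi> (2 * t + s)) / s \<le> (\<phi> 0 - \<phi> (2 * t)) / (2 * t)"
    using s t by (simp add: field_simps)
  also have "\<dots> \<le> \<phi> 0 / (2 * t)"
    using sg_inner_nonneg[of "2 * t" u] t u by (intro divide_right_mono) (auto simp: \<phi>_def)
  finally show ?thesis by (simp add: 2 \<phi>_def)
qed

text \<open>A symmetric contraction \<open>A\<close> that commutes with \<open>T\<^sub>s\<close> is symmetric for the energy form as well, and
  its iterates stay bounded.\<close>

lemma sg_energy_contraction:
  assumes s: "0 < s" and A: "\<And>v. v \<in> L2 M \<Longrightarrow> A v \<in> L2 M"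
    and contr: "\<And>v. v \<in> L2 M \<Longrightarrow> L2_inner M (A v) (A v) \<le> L2_inner M v v"
    and sym: "\<And>v w. v \<in> L2 M \<Longrightarrow> w \<in> L2 M \<Longrightarrow> L2_inner M (A v) w = L2_inner M v (A w)"
    and comm: "\<And>v w. v \<in> L2 M \<Longrightarrow> w \<in> L2 M \<Longrightarrow> L2_inner M (A (T s v)) w = L2_inner M (T s (A v)) w"
    and u: "u \<in> L2 M"
  shows "sg_energy M T s (A u) (A u) \<le> sg_energy M T s u u"
proof (rule form_power_bounded_contraction[OF symmetric_form_sg_energy[OF s], where C="2 * L2_inner M u u / s"])
  show "sg_energy M T s (A v) w = sg_energy M T s v (A w)" if "v \<in> L2 M" "w \<in> L2 M" for v w
    using that s comm[OF that] sym[OF that] sym[OF sg_L2[OF s that(1)] that(2)] A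
    by (simp add: sg_energy_eq)
  have pow: "(A ^^ n) u \<in> L2 M \<and> L2_inner M ((A ^^ n) u) ((A ^^ n) u) \<le> L2_inner M u u" for n
  proof (induction n)
    case (Suc n)
    then show ?case using contr[of "(A ^^ n) u"] A by fastforce
  qed (use u in simp)
  show "sg_energy M T s ((A ^^ n) u) ((A ^^ n) u) \<le> 2 * L2_inner M u u / s" for n
  proof -
    have "sg_energy M T s ((A ^^ n) u) ((A ^^ n) u) \<le> 2 * L2_inner M ((A ^^ n) u) ((A ^^ n) u) / s"
      using pow by (intro sg_energy_le[OF s]) blast
    also have "\<dots> \<le> 2 * L2_inner M u u / s"
      using s pow[of n] by (intro divide_right_mono) auto
    finally show ?thesis .
  qed
qed (use u A in auto)

lemma sg_domain_L2: "u \<in> sg_domain M T \<Longrightarrow> u \<in> L2 M"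
  by (simp add: sg_domain_def)

lemma sg_domainI: "u \<in> L2 M \<Longrightarrow> (\<And>t. 0 < t \<Longrightarrow> sg_energy M T t u u \<le> C) \<Longrightarrow> u \<in> sg_domain M T"
  by (auto simp: sg_domain_def)

lemma sg_domain_tendsto_diag:
  assumes "u \<in> sg_domain M T"
  shows "((\<lambda>t. sg_energy M T t u u) \<longlongrightarrow> sg_form M T u u) (at_right 0)"
proof -
  obtain C where C: "\<And>t. 0 < t \<Longrightarrow> sg_energy M T t u u \<le> C" and u: "u \<in> L2 M"
    using assms by (auto simp: sg_domain_def)
  have "\<exists>l. ((\<lambda>t. sg_energy M T t u u) \<longlongrightarrow> l) (at_right 0)"
    by (rule antimono_bounded_tendsto_at_right_0[where C=C]) (rule sg_energy_antimono[OF _ _ u], assumption+, rule C)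
  then obtain l where l: "((\<lambda>t. sg_energy M T t u u) \<longlongrightarrow> l) (at_right 0)" ..
  show ?thesis unfolding sg_form_def using l tendsto_Lim[OF trivial_limit_at_right_real l] by simp
qed

lemma sg_energy_le_limit:
  assumes u: "u \<in> L2 M" and lim: "((\<lambda>t. sg_energy M T t u u) \<longlongrightarrow> l) (at_right 0)" and t: "0 < t"
  shows "sg_energy M T t u u \<le> l"
proof (rule tendsto_lowerbound[OF lim])
  show "eventually (\<lambda>s. sg_energy M T t u u \<le> sg_energy M T s u u) (at_right 0)"
    using sg_energy_antimono[OF _ _ u] t by (auto simp: eventually_at_right_field intro!: exI[of _ t])
qed simp

lemma sg_domain_iff_tendsto:
  "u \<in> sg_domain M T \<longleftrightarrow> u \<in> L2 M \<and> (\<exists>l. ((\<lambda>t. sg_energy M T t u u) \<longlongrightarrow> l) (at_right 0))"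
proof
  assume "u \<in> sg_domain M T"
  then show "u \<in> L2 M \<and> (\<exists>l. ((\<lambda>t. sg_energy M T t u u) \<longlongrightarrow> l) (at_right 0))"
    using sg_domain_tendsto_diag sg_domain_L2 by blast
next
  assume "u \<in> L2 M \<and> (\<exists>l. ((\<lambda>t. sg_energy M T t u u) \<longlongrightarrow> l) (at_right 0))"
  then obtain l where u: "u \<in> L2 M" and l: "((\<lambda>t. sg_energy M T t u u) \<longlongrightarrow> l) (at_right 0)"
    by blast
  show "u \<in> sg_domain M T" by (rule sg_domainI[OF u sg_energy_le_limit[OF u l]])
qed

lemma linear_space_sg_domain: "linear_space (sg_domain M T)"
  unfolding linear_space_def
proof (intro conjI ballI allI)
  note L = symmetric_form_L2[of M] and E = symmetric_form_sg_energy
  show "(\<lambda>_. 0) \<in> sg_domain M T"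
    using form_zero[OF E] by (intro sg_domainI[where C=0] L2_zero) simp
  fix u assume "u \<in> sg_domain M T"
  then obtain C where C: "\<And>t. 0 < t \<Longrightarrow> sg_energy M T t u u \<le> C" and u: "u \<in> L2 M"
    by (auto simp: sg_domain_def)
  show "(\<lambda>x. c * u x) \<in> sg_domain M T" for c
    using form_expand_scale[OF E u] C u
    by (intro sg_domainI[where C="c\<^sup>2 * C"] L2_cmult) (auto intro: mult_left_mono)
  fix v assume "v \<in> sg_domain M T"
  then obtain D where D: "\<And>t. 0 < t \<Longrightarrow> sg_energy M T t v v \<le> D" and v: "v \<in> L2 M"
    by (auto simp: sg_domain_def)
  show "(\<lambda>x. u x + v x) \<in> sg_domain M T"
  proof (rule sg_domainI[where C="2 * C + 2 * D"])
    fix t :: real assume t: "0 < t"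
    show "sg_energy M T t (\<lambda>x. u x + v x) (\<lambda>x. u x + v x) \<le> 2 * C + 2 * D"
      using form_add_le[OF E[OF t] u v] C[OF t] D[OF t] by simp
  qed (rule L2_add[OF u v])
qed

lemma sg_domain_tendsto:
  assumes u: "u \<in> sg_domain M T" and v: "v \<in> sg_domain M T"
  shows "((\<lambda>t. sg_energy M T t u v) \<longlongrightarrow> sg_form M T u v) (at_right 0)"
proof -
  have mem: "(\<lambda>x. u x + v x) \<in> sg_domain M T" "(\<lambda>x. -1 * v x) \<in> sg_domain M T"
    using linear_space_sg_domain u v unfolding linear_space_def by blast+
  then have mem': "(\<lambda>x. u x - v x) \<in> sg_domain M T"
    using linear_space_sg_domain u unfolding linear_space_def by fastforce
  let ?q = "\<lambda>t w. sg_energy M T t w w"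
  have "((\<lambda>t. (?q t (\<lambda>x. u x + v x) - ?q t (\<lambda>x. u x - v x)) / 4) \<longlongrightarrow>
      (sg_form M T (\<lambda>x. u x + v x) (\<lambda>x. u x + v x) - sg_form M T (\<lambda>x. u x - v x) (\<lambda>x. u x - v x)) / 4)
      (at_right 0)"
    by (intro tendsto_intros sg_domain_tendsto_diag mem mem') simp
  moreover have "\<forall>\<^sub>F t in at_right 0. (?q t (\<lambda>x. u x + v x) - ?q t (\<lambda>x. u x - v x)) / 4 = sg_energy M T t u v"
    using form_polarization[OF symmetric_form_sg_energy sg_domain_L2[OF u] sg_domain_L2[OF v]]
    by (auto simp: eventually_at_right_field intro!: exI[of _ 1])
  ultimately have "((\<lambda>t. sg_energy M T t u v) \<longlongrightarrow>
      (sg_form M T (\<lambda>x. u x + v x) (\<lambda>x. u x + v x) - sg_form M T (\<lambda>x. u x - v x) (\<lambda>x. u x - v x)) / 4)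
      (at_right 0)"
    by (rule Lim_transform_eventually)
  then obtain l where l: "((\<lambda>t. sg_energy M T t u v) \<longlongrightarrow> l) (at_right 0)" by blast
  show ?thesis unfolding sg_form_def using l tendsto_Lim[OF trivial_limit_at_right_real l] by simp
qed

text \<open>A symmetric semigroup determines its form: whatever represents the limit of the energies is
  \<open>sg_form\<close> on \<open>sg_domain\<close>.\<close>

lemma semigroup_of_form_iff:
  "semigroup_of_form M E F T \<longleftrightarrow>
    F = sg_domain M T \<and> (\<forall>u\<in>F. \<forall>v\<in>F. E u v = sg_form M T u v)"
proof -
  have F: "sg_domain M T =
      {u \<in> L2 M. \<exists>l. ((\<lambda>t. L2_inner M (\<lambda>x. u x - T t u x) u / t) \<longlongrightarrow> l) (at_right 0)}"
    using sg_domain_iff_tendsto by (auto simp: sg_energy_def)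
  have E: "((\<lambda>t. L2_inner M (\<lambda>x. u x - T t u x) v / t) \<longlongrightarrow> l) (at_right 0) \<longleftrightarrow> l = sg_form M T u v"
    if "u \<in> sg_domain M T" "v \<in> sg_domain M T" for u v l
    using sg_domain_tendsto[OF that]
      tendsto_unique[OF trivial_limit_at_right_real sg_domain_tendsto[OF that, unfolded sg_energy_def], of l]
    unfolding sg_energy_def by auto
  show ?thesis unfolding semigroup_of_form_def F[symmetric] 
    by (cases "F = sg_domain M T") (simp_all add: SG E)
qed

end

section \<open>The form of a symmetric semigroup\<close>

context
  fixes M :: "'a measure" and E :: "'a form" and F :: "('a \<Rightarrow> real) set"
    and T :: "real \<Rightarrow> ('a \<Rightarrow> real) \<Rightarrow> 'a \<Rightarrow> real"
  assumes SF: "semigroup_of_form M E F T"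
begin

lemma sof_semigroup: "L2_semigroup M T"
  using SF by (simp add: semigroup_of_form_def)

lemma sof_domain: "F = sg_domain M T"
  using SF semigroup_of_form_iff[OF sof_semigroup] by blast

lemma sof_form: "u \<in> F \<Longrightarrow> v \<in> F \<Longrightarrow> E u v = sg_form M T u v"
  using SF semigroup_of_form_iff[OF sof_semigroup] by blast

lemma sof_L2: "u \<in> F \<Longrightarrow> u \<in> L2 M"
  by (simp add: sof_domain sg_domain_def)

lemma sof_tendsto:
  "u \<in> F \<Longrightarrow> v \<in> F \<Longrightarrow> ((\<lambda>t. sg_energy M T t u v) \<longlongrightarrow> E u v) (at_right 0)"
  using sg_domain_tendsto[OF sof_semigroup, of u v] sof_form[of u v] by (simp add: sof_domain)

lemma sof_energy_le: "u \<in> F \<Longrightarrow> 0 < t \<Longrightarrow> sg_energy M T t u u \<le> E u u"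
  by (rule sg_energy_le_limit[OF sof_semigroup sof_L2 sof_tendsto])

lemma sof_memI: "u \<in> L2 M \<Longrightarrow> (\<And>t. 0 < t \<Longrightarrow> sg_energy M T t u u \<le> C) \<Longrightarrow> u \<in> F"
  by (auto simp: sof_domain sg_domain_def)

lemma sof_form_le:
  assumes "u \<in> F" "\<And>t. 0 < t \<Longrightarrow> sg_energy M T t u u \<le> C"
  shows "E u u \<le> C"
  by (rule tendsto_upperbound[OF sof_tendsto[OF assms(1,1)]])
    (use assms(2) in \<open>auto simp: eventually_at_right_field intro: exI[of _ 1]\<close>)

lemma symmetric_form_sof: "symmetric_form E F"
proof -
  note SG = sof_semigroup
  have lin: "linear_space F" unfolding sof_domain by (rule linear_space_sg_domain[OF SG])
  have add: "(\<lambda>x. u x + v x) \<in> F" if "u \<in> F" "v \<in> F" for u v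
    using lin that unfolding linear_space_def by blast
  have scale: "(\<lambda>x. c * u x) \<in> F" if "u \<in> F" for u c
    using lin that unfolding linear_space_def by blast
  note uniq = tendsto_unique[OF trivial_limit_at_right_real]
  have "E u v = E v u" if u: "u \<in> F" and v: "v \<in> F" for u v
  proof (rule uniq[OF sof_tendsto[OF u v] Lim_transform_eventually[OF sof_tendsto[OF v u]]], rule eventually_at_right_0I)
    fix t :: real assume t: "0 < t"
    show "sg_energy M T t v u = sg_energy M T t u v"
      by (rule form_sym[OF symmetric_form_sg_energy[OF SG t] sof_L2[OF v] sof_L2[OF u]])
  qed
  moreover have "E (\<lambda>x. u x + v x) w = E u w + E v w"
    if u: "u \<in> F" and v: "v \<in> F" and w: "w \<in> F" for u v w
  proof (rule uniq[OF sof_tendsto[OF add[OF u v] w]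
        Lim_transform_eventually[OF tendsto_add[OF sof_tendsto[OF u w] sof_tendsto[OF v w]]]], rule eventually_at_right_0I)
    fix t :: real assume t: "0 < t"
    show "sg_energy M T t u w + sg_energy M T t v w = sg_energy M T t (\<lambda>x. u x + v x) w"
      by (rule form_add_left[OF symmetric_form_sg_energy[OF SG t] sof_L2[OF u] sof_L2[OF v] sof_L2[OF w],
            symmetric])
  qed
  moreover have "E (\<lambda>x. c * u x) v = c * E u v"
    if u: "u \<in> F" and v: "v \<in> F" for c u v
  proof (rule uniq[OF sof_tendsto[OF scale[OF u] v]
        Lim_transform_eventually[OF tendsto_mult_left[OF sof_tendsto[OF u v]]]], rule eventually_at_right_0I)
    fix t :: real assume t: "0 < t"
    show "c * sg_energy M T t u v = sg_energy M T t (\<lambda>x. c * u x) v"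
      by (rule form_scale_left[OF symmetric_form_sg_energy[OF SG t] sof_L2[OF u] sof_L2[OF v], symmetric])
  qed
  moreover have "0 \<le> E u u" if u: "u \<in> F" for u
  proof (rule tendsto_lowerbound[OF sof_tendsto[OF u u]], rule eventually_at_right_0I)
    fix t :: real assume t: "0 < t"
    show "0 \<le> sg_energy M T t u u"
      by (rule form_nonneg[OF symmetric_form_sg_energy[OF SG t] sof_L2[OF u]])
  qed simp
  ultimately show ?thesis using lin unfolding symmetric_form_def by (intro conjI ballI allI)
qed

text \<open>By symmetry \<open>(T\<^sub>t u, v) = (u, T\<^sub>t v)\<close>, and the right-hand side sees only the equivalence class
  of \<open>u\<close>.\<close>

lemma ae_invariant_sof: "ae_invariant M E F"
  unfolding ae_invariant_def
proof (intro ballI impI)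
  note SG = sof_semigroup
  fix u u' assume u: "u \<in> F" and u': "u' \<in> borel_measurable M" and ae: "AE x in M. u x = u' x"
  have uL: "u \<in> L2 M" by (rule sof_L2[OF u])
  have u'L: "u' \<in> L2 M" by (rule L2_cong_AE[OF uL u' ae])
  have cong: "L2_inner M u w = L2_inner M u' w" if "w \<in> L2 M" for w
    by (rule L2_inner_cong_AE) (use ae uL u' that in \<open>auto intro: L2_measurable\<close>)
  have energy: "sg_energy M T t u w = sg_energy M T t u' w" if t: "0 < t" and w: "w \<in> L2 M" for t w
    using t w uL u'L cong[OF w] cong[OF sg_L2[OF SG t w]]
    by (simp add: sg_energy_eq[OF SG] sg_sym[OF SG])
  have "sg_energy M T t u' u' \<le> E u u" if t: "0 < t" for t
    using sof_energy_le[OF u t] energy[OF t uL] energy[OF t u'L]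
      form_sym[OF symmetric_form_sg_energy[OF SG t] uL u'L] by simp
  then have u'F: "u' \<in> F" by (rule sof_memI[OF u'L])
  have "E u v = E u' v" if v: "v \<in> F" for v
  proof (rule tendsto_unique[OF trivial_limit_at_right_real sof_tendsto[OF u v]
        Lim_transform_eventually[OF sof_tendsto[OF u'F v]]])
    show "\<forall>\<^sub>F t in at_right 0. sg_energy M T t u' v = sg_energy M T t u v"
      using energy[OF _ sof_L2[OF v]] by (auto simp: eventually_at_right_field intro: exI[of _ 1])
  qed
  with u'F show "u' \<in> F \<and> (\<forall>v\<in>F. E u v = E u' v)" by blast
qed

lemma sof_smooth:
  assumes t: "0 < t" and u: "u \<in> L2 M"
  shows "T t u \<in> F" and "E (T t u) (T t u) \<le> L2_inner M u u / (2 * t)"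
proof -
  show "T t u \<in> F"
    by (rule sof_memI[OF sg_L2[OF sof_semigroup t u] sg_energy_smooth[OF sof_semigroup _ t u]])
  then show "E (T t u) (T t u) \<le> L2_inner M u u / (2 * t)"
    by (rule sof_form_le[OF _ sg_energy_smooth[OF sof_semigroup _ t u]])
qed

lemma sof_dense:
  assumes u: "u \<in> L2 M" and e: "0 < e"
  shows "\<exists>v\<in>F. L2_norm M (\<lambda>x. u x - v x) < e"
proof -
  have "\<forall>\<^sub>F t in at_right 0. L2_norm M (\<lambda>x. T t u x - u x) < e"
    by (rule order_tendstoD(2)[OF sg_tendsto[OF sof_semigroup u] e])
  then obtain b where b: "0 < b" "\<And>t. 0 < t \<Longrightarrow> t < b \<Longrightarrow> L2_norm M (\<lambda>x. T t u x - u x) < e"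
    by (auto simp: eventually_at_right_field)
  have "L2_norm M (\<lambda>x. u x - T (b / 2) u x) < e"
    using b L2_norm_minus_commute[OF u sg_L2[OF sof_semigroup _ u], of "b / 2"] by simp
  then show ?thesis using sof_smooth(1)[of "b / 2" u] b(1) u by auto
qed

lemma sof_contraction:
  assumes t: "0 < t" and u: "u \<in> F"
  shows "E (T t u) (T t u) \<le> E u u"
proof (rule sof_form_le[OF sof_smooth(1)[OF t sof_L2[OF u]]])
  note SG = sof_semigroup
  have uL: "u \<in> L2 M" by (rule sof_L2[OF u])
  fix s :: real assume s: "0 < s"
  have commute: "L2_inner M (T s (T t v)) w = L2_inner M (T s v) (T t w)"
    if "v \<in> L2 M" "w \<in> L2 M" for v w
    using that s t sg_inner_add[OF SG t s that] sg_sym[OF SG s, of "T t v" w] sg_sym[OF SG s, of v "T t w"]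
      sg_inner_add[OF SG s t that] sg_L2[OF SG] by (simp add: add.commute)
  have "sg_energy M T s (T t u) (T t u) \<le> sg_energy M T s u u"
  proof (rule sg_energy_contraction[OF SG s, where A="T t" and u=u, OF sg_L2[OF SG t] sg_square_le[OF SG t] sg_sym[OF SG t] _ uL])
    fix v w assume vw: "v \<in> L2 M" "w \<in> L2 M"
    show "L2_inner M (T t (T s v)) w = L2_inner M (T s (T t v)) w"
      using commute[OF vw] sg_sym[OF SG t sg_L2[OF SG s vw(1)] vw(2)] by simp
  qed
  also have "\<dots> \<le> E u u" by (rule sof_energy_le[OF u s])
  finally show "sg_energy M T s (T t u) (T t u) \<le> E u u" .
qed

lemma form1_norm_eq:
  "u \<in> L2 M \<Longrightarrow> form1_norm M E u = sqrt (E u u + (L2_norm M u)\<^sup>2)"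
  by (simp add: form1_norm_def form1_def L2_norm_square)

text \<open>Since \<open>E\<close> is a supremum of \<open>L\<^sup>2\<close>-continuous forms it is lower semicontinuous, and
  \<open>E (T\<^sub>t u - u, T\<^sub>t u - u) \<le> 2 * E (u, u) - 2 * E (T\<^bsub>t/2\<^esub> u, T\<^bsub>t/2\<^esub> u)\<close>.\<close>

lemma sof_semigroup_tendsto:
  assumes u: "u \<in> F"
  shows "((\<lambda>t. form1_norm M E (\<lambda>x. T t u x - u x)) \<longlongrightarrow> 0) (at_right 0)"
proof -
  note SG = sof_semigroup and S = symmetric_form_sof
  have uL: "u \<in> L2 M" by (rule sof_L2[OF u])
  have TF: "T t u \<in> F" if "0 < t" for t by (rule sof_smooth(1)[OF that uL])
  have half: "E (T t u) u = E (T (t/2) u) (T (t/2) u)" if t: "0 < t" and t2: "0 < t/2" for t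
  proof (rule tendsto_unique[OF trivial_limit_at_right_real sof_tendsto[OF TF[OF t] u]
        Lim_transform_eventually[OF sof_tendsto[OF TF[OF t2] TF[OF t2]]]], rule eventually_at_right_0I)
    fix s :: real assume s: "0 < s"
    let ?w = "T (t/2) u"
    have w: "?w \<in> L2 M" by (rule sg_L2[OF SG t2 uL])
    have 1: "L2_inner M (T t u) u = L2_inner M ?w ?w"
      using sg_inner_add[OF SG t2 t2 uL uL] by simp
    have 2: "L2_inner M (T s (T t u)) u = L2_inner M (T s ?w) ?w"
    proof -
      have Tt: "T t u \<in> L2 M" by (rule sg_L2[OF SG t uL])
      have "L2_inner M (T s (T t u)) u = L2_inner M (T t u) (T s u)"
        by (rule sg_sym[OF SG s Tt uL])
      also have "\<dots> = L2_inner M (T (t + s) u) u"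
        by (rule sg_inner_add[OF SG t s uL uL, symmetric])
      also have "\<dots> = L2_inner M (T ((s + t/2) + t/2) u) u" by (simp add: add.commute)
      also have "\<dots> = L2_inner M (T (s + t/2) u) ?w"
        by (rule sg_inner_add[OF SG _ t2 uL uL]) (use s t in simp)
      also have "\<dots> = L2_inner M (T s ?w) ?w"
        using w s t2 uL sg_add_AE[OF SG s t2 uL]
        by (intro L2_inner_cong_AE) (auto intro!: L2_measurable sg_L2[OF SG])
      finally show ?thesis .
    qed
    show "sg_energy M T s ?w ?w = sg_energy M T s (T t u) u"
      using 1 2 s sg_L2[OF SG t uL] uL w by (simp add: sg_energy_eq[OF SG])
  qed
  have lower: "((\<lambda>t. E (T t u) (T t u)) \<longlongrightarrow> E u u) (at_right 0)"
  proof (rule order_tendstoI)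
    fix a assume a: "a < E u u"
    have "\<forall>\<^sub>F s in at_right 0. a < sg_energy M T s u u"
      by (rule order_tendstoD(1)[OF sof_tendsto[OF u u] a])
    then obtain s where s: "0 < s" "a < sg_energy M T s u u"
      by (auto simp: eventually_at_right_field) (meson field_lbound_gt_zero)
    define S where "S t = (if 0 < t then T t u else u)" for t
    have SL: "S t \<in> L2 M" for t using sg_L2[OF SG _ uL] uL by (simp add: S_def)
    have "((\<lambda>t. L2_norm M (\<lambda>x. S t x - u x)) \<longlongrightarrow> 0) (at_right 0)"
      by (rule Lim_transform_eventually[OF sg_tendsto[OF SG uL]], rule eventually_at_right_0I) (simp add: S_def)
    from sg_energy_tendsto[OF SG s(1) SL uL this]
    have "\<forall>\<^sub>F t in at_right 0. a < sg_energy M T s (S t) (S t)"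
      by (rule order_tendstoD(1)) (rule s(2))
    moreover have "\<forall>\<^sub>F t in at_right 0. sg_energy M T s (S t) (S t) \<le> E (T t u) (T t u)"
      by (rule eventually_at_right_0I) (use sof_energy_le[OF TF s(1)] in \<open>simp add: S_def\<close>)
    ultimately show "\<forall>\<^sub>F t in at_right 0. a < E (T t u) (T t u)"
      by eventually_elim simp
  next
    fix a assume a: "E u u < a"
    show "\<forall>\<^sub>F t in at_right 0. E (T t u) (T t u) < a"
    proof (rule eventually_at_right_0I)
      fix t :: real assume "0 < t"
      from sof_contraction[OF this u] a show "E (T t u) (T t u) < a" by simp
    qed
  qed
  have lower2: "((\<lambda>t. E (T (t/2) u) (T (t/2) u)) \<longlongrightarrow> E u u) (at_right 0)"
  proof (rule filterlim_compose[OF lower])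
    show "filterlim (\<lambda>t::real. t / 2) (at_right 0) (at_right 0)"
      unfolding filterlim_at using tendsto_divide[OF tendsto_ident_at tendsto_const, of 2 0 "{0<..}"]
      by (auto intro: eventually_at_right_0I)
  qed
  have E0: "((\<lambda>t. E (\<lambda>x. T t u x - u x) (\<lambda>x. T t u x - u x)) \<longlongrightarrow> 0) (at_right 0)"
  proof (rule tendsto_sandwich[OF _ _ tendsto_const])
    show "\<forall>\<^sub>F t in at_right 0. 0 \<le> E (\<lambda>x. T t u x - u x) (\<lambda>x. T t u x - u x)"
      by (rule eventually_at_right_0I) (rule form_nonneg[OF S form_diff_mem[OF S TF u]])
    show "((\<lambda>t. 2 * E u u - 2 * E (T (t/2) u) (T (t/2) u)) \<longlongrightarrow> 0) (at_right 0)"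
      using tendsto_diff[OF tendsto_const[of "2 * E u u"] tendsto_mult_left[OF lower2, of 2]] by simp
    show "\<forall>\<^sub>F t in at_right 0. E (\<lambda>x. T t u x - u x) (\<lambda>x. T t u x - u x)
        \<le> 2 * E u u - 2 * E (T (t/2) u) (T (t/2) u)"
    proof (rule eventually_at_right_0I)
      fix t :: real assume t: "0 < t"
      show "E (\<lambda>x. T t u x - u x) (\<lambda>x. T t u x - u x) \<le> 2 * E u u - 2 * E (T (t/2) u) (T (t/2) u)"
        using form_expand_diff[OF S TF[OF t] u] half[OF t] t sof_contraction[OF t u] by simp
    qed
  qed
  have "((\<lambda>t. sqrt (E (\<lambda>x. T t u x - u x) (\<lambda>x. T t u x - u x) + (L2_norm M (\<lambda>x. T t u x - u x))\<^sup>2))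
      \<longlongrightarrow> sqrt (0 + 0\<^sup>2)) (at_right 0)"
    by (intro tendsto_intros E0 sg_tendsto[OF SG uL])
  then have lim: "((\<lambda>t. sqrt (E (\<lambda>x. T t u x - u x) (\<lambda>x. T t u x - u x) + (L2_norm M (\<lambda>x. T t u x - u x))\<^sup>2))
      \<longlongrightarrow> 0) (at_right 0)" by simp
  show ?thesis
    by (rule Lim_transform_eventually[OF lim], rule eventually_at_right_0I)
      (rule form1_norm_eq[OF L2_diff[OF sg_L2[OF SG _ uL] uL], symmetric])
qed

text \<open>A Cauchy sequence has an \<open>L\<^sup>2\<close>-limit. At each fixed time the energy is \<open>L\<^sup>2\<close>-continuous, so the
  Cauchy estimate passes to this limit uniformly in time.\<close>

lemma form_closed_sof: "form_closed M E F"
  unfolding form_closed_def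
proof (intro allI impI)
  note SG = sof_semigroup and S = symmetric_form_sof
  fix u :: "nat \<Rightarrow> 'a \<Rightarrow> real"
  assume uF: "range u \<subseteq> F"
    and Cauchy: "\<forall>\<epsilon>>0. \<exists>N. \<forall>i\<ge>N. \<forall>j\<ge>N. form1_norm M E (\<lambda>x. u i x - u j x) < \<epsilon>"
  have u: "u n \<in> F" for n using uF by auto
  have uL: "u n \<in> L2 M" for n by (rule sof_L2[OF u])
  have dF: "(\<lambda>x. u i x - u j x) \<in> F" for i j by (rule form_diff_mem[OF S u u])
  have norm1: "form1_norm M E (\<lambda>x. u i x - u j x) =
      sqrt (E (\<lambda>x. u i x - u j x) (\<lambda>x. u i x - u j x) + (L2_norm M (\<lambda>x. u i x - u j x))\<^sup>2)" for i j
    by (rule form1_norm_eq[OF sof_L2[OF dF]])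
  have le1: "L2_norm M (\<lambda>x. u i x - u j x) \<le> form1_norm M E (\<lambda>x. u i x - u j x)" for i j
    unfolding norm1 using form_nonneg[OF S dF] by (intro real_le_rsqrt) simp
  have le2: "E (\<lambda>x. u i x - u j x) (\<lambda>x. u i x - u j x) \<le> (form1_norm M E (\<lambda>x. u i x - u j x))\<^sup>2" for i j
    unfolding norm1 using form_nonneg[OF S dF[of i j]] by simp
  have "\<exists>v\<in>L2 M. (\<lambda>n. L2_norm M (\<lambda>x. u n x - v x)) \<longlonglongrightarrow> 0"
  proof (rule L2_complete[OF uL])
    fix e :: real assume "0 < e"
    then obtain N where "\<forall>i\<ge>N. \<forall>j\<ge>N. form1_norm M E (\<lambda>x. u i x - u j x) < e" using Cauchy by blast
    then show "\<exists>N. \<forall>i\<ge>N. \<forall>j\<ge>N. L2_norm M (\<lambda>x. u i x - u j x) < e"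
      using le1 by (meson order_le_less_trans)
  qed
  then obtain v where v: "v \<in> L2 M" and lim: "(\<lambda>n. L2_norm M (\<lambda>x. u n x - v x)) \<longlonglongrightarrow> 0" by blast
  have close: "(\<lambda>x. u n x - v x) \<in> F \<and> E (\<lambda>x. u n x - v x) (\<lambda>x. u n x - v x) \<le> e\<^sup>2"
    if e: "0 < e" and N: "\<forall>i\<ge>N. \<forall>j\<ge>N. form1_norm M E (\<lambda>x. u i x - u j x) < e" and n: "n \<ge> N" for e N n
  proof -
    have w: "(\<lambda>x. u n x - v x) \<in> L2 M" by (rule L2_diff[OF uL v])
    have energy: "sg_energy M T t (\<lambda>x. u n x - v x) (\<lambda>x. u n x - v x) \<le> e\<^sup>2" if t: "0 < t" for t
    proof (rule tendsto_upperbound[OF sg_energy_tendsto[OF SG t sof_L2[OF dF[of n]] w]])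
      have eq: "L2_norm M (\<lambda>x. u n x - u m x - (u n x - v x)) = L2_norm M (\<lambda>x. u m x - v x)" for m
        using L2_norm_minus_commute[OF v uL, of m] by simp
      show "(\<lambda>m. L2_norm M (\<lambda>x. u n x - u m x - (u n x - v x))) \<longlonglongrightarrow> 0"
        unfolding eq by (rule lim)
      show "\<forall>\<^sub>F m in sequentially. sg_energy M T t (\<lambda>x. u n x - u m x) (\<lambda>x. u n x - u m x) \<le> e\<^sup>2"
      proof (rule eventually_sequentiallyI[of N])
        fix m assume m: "N \<le> m"
        have "0 \<le> form1_norm M E (\<lambda>x. u n x - u m x)"
          unfolding norm1 using form_nonneg[OF S dF] by simp
        moreover have "form1_norm M E (\<lambda>x. u n x - u m x) \<le> e" using N n m by (simp add: less_imp_le)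
        ultimately have "(form1_norm M E (\<lambda>x. u n x - u m x))\<^sup>2 \<le> e\<^sup>2" by (simp add: power_mono)
        then show "sg_energy M T t (\<lambda>x. u n x - u m x) (\<lambda>x. u n x - u m x) \<le> e\<^sup>2"
          using le2[of n m] sof_energy_le[OF dF[of n m] t] by linarith
      qed
    qed simp
    have "(\<lambda>x. u n x - v x) \<in> F" by (rule sof_memI[OF w energy])
    then show ?thesis using sof_form_le energy by blast
  qed
  obtain N where "\<forall>i\<ge>N. \<forall>j\<ge>N. form1_norm M E (\<lambda>x. u i x - u j x) < 1"
    using Cauchy[rule_format, of 1] by auto
  from close[OF _ this order_refl] have "(\<lambda>x. u N x - v x) \<in> F" by simp
  from form_diff_mem[OF S u this, of N] have vF: "v \<in> F" by simp
  have dv: "(\<lambda>x. u n x - v x) \<in> F" for n by (rule form_diff_mem[OF S u vF])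
  have E0: "(\<lambda>n. E (\<lambda>x. u n x - v x) (\<lambda>x. u n x - v x)) \<longlonglongrightarrow> 0"
  proof (rule LIMSEQ_I)
    fix r :: real assume r: "0 < r"
    define e where "e = sqrt (r / 2)"
    have e: "0 < e" "e\<^sup>2 < r" using r by (simp_all add: e_def)
    obtain N where N: "\<forall>i\<ge>N. \<forall>j\<ge>N. form1_norm M E (\<lambda>x. u i x - u j x) < e"
      using Cauchy e(1) by blast
    have "norm (E (\<lambda>x. u n x - v x) (\<lambda>x. u n x - v x) - 0) < r" if "n \<ge> N" for n
      using close[OF e(1) N that] e(2) form_nonneg[OF S dv, of n] by simp
    then show "\<exists>no. \<forall>n\<ge>no. norm (E (\<lambda>x. u n x - v x) (\<lambda>x. u n x - v x) - 0) < r" by blast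
  qed
  have "(\<lambda>n. sqrt (E (\<lambda>x. u n x - v x) (\<lambda>x. u n x - v x) + (L2_norm M (\<lambda>x. u n x - v x))\<^sup>2))
      \<longlonglongrightarrow> sqrt (0 + 0\<^sup>2)"
    by (intro tendsto_intros E0 lim)
  then have "(\<lambda>n. form1_norm M E (\<lambda>x. u n x - v x)) \<longlonglongrightarrow> 0"
    using form1_norm_eq[OF sof_L2[OF dv]] by simp
  with vF show "\<exists>v\<in>F. (\<lambda>n. form1_norm M E (\<lambda>x. u n x - v x)) \<longlonglongrightarrow> 0" by blast
qed

lemma symmetric_form_form1: "symmetric_form (form1 M E) F"
proof -
  note S = symmetric_form_sof and L = symmetric_form_L2[of M]
  have lin: "linear_space F" using S by (simp add: symmetric_form_def)
  show ?thesis
    unfolding symmetric_form_def form1_def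
  proof (intro conjI ballI allI lin)
    fix u v assume uv: "u \<in> F" "v \<in> F"
    show "E u v + L2_inner M u v = E v u + L2_inner M v u"
      using form_sym[OF S uv] form_sym[OF L uv[THEN sof_L2]] by simp
    show "E (\<lambda>x. c * u x) v + L2_inner M (\<lambda>x. c * u x) v = c * (E u v + L2_inner M u v)" for c
      using form_scale_left[OF S uv, of c] form_scale_left[OF L uv[THEN sof_L2], of c]
      by (simp add: distrib_left)
    fix w assume w: "w \<in> F"
    show "E (\<lambda>x. u x + v x) w + L2_inner M (\<lambda>x. u x + v x) w = E u w + L2_inner M u w + (E v w + L2_inner M v w)"
      using form_add_left[OF S uv w] form_add_left[OF L uv[THEN sof_L2] sof_L2[OF w]] by simp
  next
    fix u assume u: "u \<in> F"
    show "0 \<le> E u u + L2_inner M u u"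
      using form_nonneg[OF S u] form_nonneg[OF L sof_L2[OF u]] by simp
  qed
qed

end

section \<open>Products of commuting semigroups\<close>

text \<open>For commuting \<open>A\<close> and \<open>B\<close> the energy of \<open>T\<^sub>t = A\<^sub>t B\<^sub>t\<close> splits exactly as that of \<open>A\<close> at \<open>u\<close>
  plus that of \<open>B\<close> at \<open>A\<^bsub>t/2\<^esub> u\<close>. The second summand is at most the energy of \<open>B\<close> at \<open>u\<close>, and it
  tends to the same limit because \<open>A\<^bsub>t/2\<^esub> u \<rightarrow> u\<close>.\<close>

lemma sg_form_commuting_product:
  assumes A: "L2_semigroup M A" and B: "L2_semigroup M B" and T: "L2_semigroup M T"
    and T_eq: "\<And>t u. 0 < t \<Longrightarrow> u \<in> L2 M \<Longrightarrow> AE x in M. T t u x = A t (B t u) x"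
    and commute: "\<And>s t u. 0 < s \<Longrightarrow> 0 < t \<Longrightarrow> u \<in> L2 M \<Longrightarrow> AE x in M. A s (B t u) x = B t (A s u) x"
  shows "sg_domain M T = sg_domain M A \<inter> sg_domain M B"
    and "u \<in> sg_domain M T \<Longrightarrow> sg_form M T u u = sg_form M A u u + sg_form M B u u"
proof -
  note L = symmetric_form_L2[of M]
  have comm: "L2_inner M (A s (B t v)) w = L2_inner M (B t (A s v)) w"
    if "0 < s" "0 < t" "v \<in> L2 M" "w \<in> L2 M" for s t v w
    using that commute[OF that(1,2,3)]
    by (intro L2_inner_cong_AE) (auto intro!: L2_measurable sg_L2[OF A] sg_L2[OF B])
  have split: "sg_energy M T t v v = sg_energy M A t v v + sg_energy M B t (A (t/2) v) (A (t/2) v)"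
    if t: "0 < t" and v: "v \<in> L2 M" for t v
  proof -
    let ?w = "A (t/2) v"
    have t2: "0 < t/2" using t by simp
    have w: "?w \<in> L2 M" by (rule sg_L2[OF A t2 v])
    have Bv: "B t v \<in> L2 M" by (rule sg_L2[OF B t v])
    have "L2_inner M (T t v) v = L2_inner M (A t (B t v)) v"
      using t v T_eq[OF t v] Bv by (intro L2_inner_cong_AE) (auto intro!: L2_measurable sg_L2[OF A] sg_L2[OF T])
    also have "\<dots> = L2_inner M (A (t/2) (B t v)) ?w"
      using sg_inner_add[OF A t2 t2 Bv v] by simp
    also have "\<dots> = L2_inner M (B t ?w) ?w" by (rule comm[OF t2 t v w])
    finally have 1: "L2_inner M (T t v) v = L2_inner M (B t ?w) ?w" .
    have 2: "L2_inner M (A t v) v = L2_inner M ?w ?w"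
      using sg_inner_add[OF A t2 t2 v v] by simp
    show ?thesis using t v w
      by (simp add: sg_energy_eq[OF T] sg_energy_eq[OF A] sg_energy_eq[OF B] 1 2 diff_divide_distrib)
  qed
  have half_le: "sg_energy M B t (A s v) (A s v) \<le> sg_energy M B t v v"
    if t: "0 < t" and s: "0 < s" and v: "v \<in> L2 M" for s t v
    by (rule sg_energy_contraction[OF B t, where A="A s" and u=v,
          OF sg_L2[OF A s] sg_square_le[OF A s] sg_sym[OF A s] comm[OF s t] v])
  note SA = semigroup_of_form_iff[OF A, of "sg_form M A" "sg_domain M A", simplified]
    and SB = semigroup_of_form_iff[OF B, of "sg_form M B" "sg_domain M B", simplified]
    and ST = semigroup_of_form_iff[OF T, of "sg_form M T" "sg_domain M T", simplified]
  have lower_sem: "sg_energy M B s v v \<le> C"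
    if v: "v \<in> L2 M" and C: "\<And>t. 0 < t \<Longrightarrow> t < d \<Longrightarrow> sg_energy M B t (A (t/2) v) (A (t/2) v) \<le> C"
      and d: "0 < d" and s: "0 < s" for v C s d
  proof (rule tendsto_upperbound)
    define S where "S t = (if 0 < t then A (t/2) v else v)" for t
    have S: "S t \<in> L2 M" for t using sg_L2[OF A _ v] v by (simp add: S_def)
    have f: "filterlim (\<lambda>t::real. t / 2) (at_right 0) (at_right 0)"
      unfolding filterlim_at using tendsto_divide[OF tendsto_ident_at tendsto_const, of 2 0 "{0<..}"]
      by (auto simp: eventually_at_right_field intro: exI[of _ 1])
    have "((\<lambda>t. L2_norm M (\<lambda>x. S t x - v x)) \<longlongrightarrow> 0) (at_right 0)"
      by (rule Lim_transform_eventually[OF filterlim_compose[OF sg_tendsto[OF A v] f]])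
        (auto simp: S_def eventually_at_right_field intro!: exI[of _ 1])
    from sg_energy_tendsto[OF B s S v this]
    show "((\<lambda>t. sg_energy M B s (S t) (S t)) \<longlongrightarrow> sg_energy M B s v v) (at_right 0)" .
    have "sg_energy M B s (S t) (S t) \<le> C" if t: "0 < t" "t < min s d" for t
      using sg_energy_antimono[OF B t(1), of s "S t"] S[of t] C[of t] t by (simp add: S_def)
    then show "\<forall>\<^sub>F t in at_right 0. sg_energy M B s (S t) (S t) \<le> C"
      using s d by (auto simp: eventually_at_right_field intro!: exI[of _ "min s d"])
  qed simp
  have le_sum: "sg_energy M T t v v \<le> sg_form M A v v + sg_form M B v v"
    if vA: "v \<in> sg_domain M A" and vB: "v \<in> sg_domain M B" and t: "0 < t" for v t
  proof -
    have t2: "0 < t / 2" using t by simp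
    have v: "v \<in> L2 M" by (rule sg_domain_L2[OF A vA])
    show ?thesis
      using split[OF t v] half_le[OF t t2 v] sof_energy_le[OF SA vA t] sof_energy_le[OF SB vB t] by simp
  qed
  have sub: "sg_domain M A \<inter> sg_domain M B \<subseteq> sg_domain M T"
  proof (intro subsetI, elim IntE)
    fix v assume vA: "v \<in> sg_domain M A" and vB: "v \<in> sg_domain M B"
    show "v \<in> sg_domain M T" by (rule sg_domainI[OF T sg_domain_L2[OF A vA] le_sum[OF vA vB]])
  qed
  have sup: "v \<in> sg_domain M A \<and> v \<in> sg_domain M B \<and> sg_form M T v v = sg_form M A v v + sg_form M B v v"
    if vT: "v \<in> sg_domain M T" for v
  proof -
    have v: "v \<in> L2 M" by (rule sg_domain_L2[OF T vT])
    have Bn: "0 \<le> sg_energy M B t (A (t/2) v) (A (t/2) v)" if t: "0 < t" for t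
      by (rule form_nonneg[OF symmetric_form_sg_energy[OF B t] sg_L2[OF A _ v]]) (use t in simp)
    have An: "0 \<le> sg_energy M A t v v" if t: "0 < t" for t
      by (rule form_nonneg[OF symmetric_form_sg_energy[OF A t] v])
    have le: "sg_energy M A t v v + sg_energy M B t (A (t/2) v) (A (t/2) v) \<le> sg_form M T v v"
      if t: "0 < t" for t
      using sof_energy_le[OF ST vT t] split[OF t v] by simp
    have vA: "v \<in> sg_domain M A"
    proof (rule sg_domainI[OF A v])
      fix t :: real assume t: "0 < t"
      show "sg_energy M A t v v \<le> sg_form M T v v" using le[OF t] Bn[OF t] by simp
    qed
    have vB: "v \<in> sg_domain M B"
    proof (rule sg_domainI[OF B v])
      fix s :: real assume s: "0 < s"
      show "sg_energy M B s v v \<le> sg_form M T v v"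
      proof (rule lower_sem[OF v _ zero_less_one s])
        fix t :: real assume t: "0 < t"
        show "sg_energy M B t (A (t/2) v) (A (t/2) v) \<le> sg_form M T v v" using le[OF t] An[OF t] by simp
      qed
    qed
    have upper: "sg_form M T v v \<le> sg_form M A v v + sg_form M B v v"
      by (rule sof_form_le[OF ST vT le_sum[OF vA vB]])
    have lower: "sg_form M A v v + sg_form M B v v \<le> sg_form M T v v"
    proof (rule field_le_epsilon)
      fix e :: real assume e: "0 < e"
      have "\<forall>\<^sub>F t in at_right 0. sg_form M A v v - e < sg_energy M A t v v"
        by (rule order_tendstoD(1)[OF sof_tendsto[OF SA vA vA]]) (use e in simp)
      then obtain d where d: "0 < d" "\<And>t. 0 < t \<Longrightarrow> t < d \<Longrightarrow> sg_form M A v v - e < sg_energy M A t v v"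
        by (auto simp: eventually_at_right_field)
      have "sg_form M B v v \<le> sg_form M T v v - sg_form M A v v + e"
      proof (rule sof_form_le[OF SB vB])
        fix s :: real assume s: "0 < s"
        show "sg_energy M B s v v \<le> sg_form M T v v - sg_form M A v v + e"
        proof (rule lower_sem[OF v _ d(1) s])
          fix t :: real assume t: "0 < t" "t < d"
          show "sg_energy M B t (A (t/2) v) (A (t/2) v) \<le> sg_form M T v v - sg_form M A v v + e"
            using le[OF t(1)] d(2)[OF t] by simp
        qed
      qed
      then show "sg_form M A v v + sg_form M B v v \<le> sg_form M T v v + e" by simp
    qed
    from vA vB upper lower show ?thesis by auto
  qed
  show "sg_domain M T = sg_domain M A \<inter> sg_domain M B" using sub sup by blast
  show "u \<in> sg_domain M T \<Longrightarrow> sg_form M T u u = sg_form M A u u + sg_form M B u u" using sup by blast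
qed

section \<open>Symmetric sub-Markovian kernels\<close>

definition kernel_op :: "('a \<Rightarrow> 'a measure) \<Rightarrow> ('a \<Rightarrow> real) \<Rightarrow> 'a \<Rightarrow> real" where
  "kernel_op p u x = (LINT y|p x. u y)"

locale symmetric_kernel =
  fixes M :: "'a measure" and p :: "'a \<Rightarrow> 'a measure"
  assumes kernel: "p \<in> M \<rightarrow>\<^sub>M subprob_algebra M"
    and kernel_sym: "f \<in> borel_measurable M \<Longrightarrow> g \<in> borel_measurable M \<Longrightarrow>
      (\<integral>\<^sup>+x. (\<integral>\<^sup>+y. f y \<partial>p x) * g x \<partial>M) = (\<integral>\<^sup>+x. f x * (\<integral>\<^sup>+y. g y \<partial>p x) \<partial>M)"
begin

lemma subprob_p: "x \<in> space M \<Longrightarrow> subprob_space (p x)"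
  and sets_p: "x \<in> space M \<Longrightarrow> sets (p x) = sets M"
  and space_p: "x \<in> space M \<Longrightarrow> space (p x) = space M"
  using measurable_space[OF kernel, of x] sets_eq_imp_space_eq by (auto simp: space_subprob_algebra)

lemma measurable_p: "x \<in> space M \<Longrightarrow> f \<in> M \<rightarrow>\<^sub>M N \<Longrightarrow> f \<in> p x \<rightarrow>\<^sub>M N"
  using sets_p measurable_cong_sets by blast

lemma nn_measurable: "f \<in> borel_measurable M \<Longrightarrow> (\<lambda>x. \<integral>\<^sup>+y. f y \<partial>p x) \<in> borel_measurable M"
  using measurable_compose[OF kernel nn_integral_measurable_subprob_algebra] by blast

lemma kernel_op_measurable: "u \<in> borel_measurable M \<Longrightarrow> kernel_op p u \<in> borel_measurable M"
  using measurable_compose[OF kernel integral_measurable_subprob_algebra, of u]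
  unfolding kernel_op_def[abs_def] by blast

text \<open>Symmetry turns \<open>p x UNIV \<le> 1\<close> into subinvariance of \<open>M\<close>.\<close>

lemma nn_kernel_le:
  assumes f: "f \<in> borel_measurable M"
  shows "(\<integral>\<^sup>+x. (\<integral>\<^sup>+y. f y \<partial>p x) \<partial>M) \<le> (\<integral>\<^sup>+x. f x \<partial>M)"
proof -
  have "(\<integral>\<^sup>+x. (\<integral>\<^sup>+y. f y \<partial>p x) \<partial>M) = (\<integral>\<^sup>+x. f x * (\<integral>\<^sup>+y. 1 \<partial>p x) \<partial>M)"
    using kernel_sym[OF f, of "\<lambda>_. 1"] by simp
  also have "\<dots> \<le> (\<integral>\<^sup>+x. f x * 1 \<partial>M)"
    by (intro nn_integral_mono mult_left_mono)
      (auto simp: subprob_space.subprob_emeasure_le_1[OF subprob_p])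
  finally show ?thesis by simp
qed

lemma AE_kernel:
  assumes "AE y in M. P y"
  shows "AE x in M. AE y in p x. P y"
proof -
  obtain N where N: "{y \<in> space M. \<not> P y} \<subseteq> N" "emeasure M N = 0" "N \<in> sets M"
    using AE_E[OF assms] by blast
  have "(\<integral>\<^sup>+x. (\<integral>\<^sup>+y. indicator N y \<partial>p x) \<partial>M) \<le> (\<integral>\<^sup>+x. indicator N x \<partial>M)"
    using N by (intro nn_kernel_le) auto
  then have "(\<integral>\<^sup>+x. (\<integral>\<^sup>+y. indicator N y \<partial>p x) \<partial>M) = 0" using N by simp
  then have "AE x in M. (\<integral>\<^sup>+y. indicator N y \<partial>p x) = 0"
    using N(3) by (subst (asm) nn_integral_0_iff_AE) (auto intro!: nn_measurable)
  then show ?thesis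
  proof (rule AE_mp, intro AE_I2[where M=M] impI)
    fix x assume x: "x \<in> space M" and "(\<integral>\<^sup>+y. indicator N y \<partial>p x) = 0"
    then have "N \<in> null_sets (p x)" using N(3) sets_p[OF x] by auto
    then show "AE y in p x. P y" by (rule AE_I') (use N(1) space_p[OF x] in auto)
  qed
qed

lemma L2_kernel_AE:
  assumes u: "u \<in> L2 M"
  shows "AE x in M. u \<in> L2 (p x)"
proof -
  have m: "u \<in> borel_measurable M" using u by (rule L2_measurable)
  have "(\<integral>\<^sup>+x. (\<integral>\<^sup>+y. ennreal ((u y)\<^sup>2) \<partial>p x) \<partial>M) \<le> (\<integral>\<^sup>+x. ennreal ((u x)\<^sup>2) \<partial>M)"
    using m by (intro nn_kernel_le) measurable
  also have "\<dots> < \<infinity>" using u by (simp add: L2_iff_nn_integral)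
  finally have "AE x in M. (\<integral>\<^sup>+y. ennreal ((u y)\<^sup>2) \<partial>p x) \<noteq> \<infinity>"
    using m by (intro nn_integral_PInf_AE nn_measurable) (auto simp: top_unique)
  then show ?thesis
    by (rule AE_mp, intro AE_I2 impI)
      (auto simp: L2_iff_nn_integral less_top[symmetric] intro: measurable_p m)
qed

lemma L2_kernel_integrable:
  assumes x: "x \<in> space M" and u: "u \<in> L2 (p x)"
  shows "integrable (p x) u" and "(kernel_op p u x)\<^sup>2 \<le> L2_inner (p x) u u"
proof -
  interpret subprob_space "p x" by (rule subprob_p[OF x])
  have one: "(\<lambda>_. 1) \<in> L2 (p x)" by (simp add: L2_def)
  show "integrable (p x) u" using L2_mult_integrable[OF u one] by simp
  have "(L2_inner (p x) u (\<lambda>_. 1))\<^sup>2 \<le> L2_inner (p x) u u * L2_inner (p x) (\<lambda>_. 1) (\<lambda>_. 1)"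
    by (rule form_Cauchy_Schwarz_square[OF symmetric_form_L2 u one])
  also have "\<dots> \<le> L2_inner (p x) u u * 1"
    using form_nonneg[OF symmetric_form_L2 u] subprob_measure_le_1
    by (intro mult_left_mono) (auto simp: L2_inner_def)
  finally show "(kernel_op p u x)\<^sup>2 \<le> L2_inner (p x) u u" by (simp add: L2_inner_def kernel_op_def)
qed

lemma kernel_integrable_AE:
  assumes "u \<in> L2 M"
  shows "AE x in M. integrable (p x) u"
  using L2_kernel_AE[OF assms] AE_space by eventually_elim (rule L2_kernel_integrable(1))

lemma kernel_op_L2:
  assumes u: "u \<in> L2 M"
  shows "kernel_op p u \<in> L2 M" and "L2_norm M (kernel_op p u) \<le> L2_norm M u"
proof -
  have m: "u \<in> borel_measurable M" using u by (rule L2_measurable)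
  have "(\<integral>\<^sup>+x. ennreal ((kernel_op p u x)\<^sup>2) \<partial>M) \<le> (\<integral>\<^sup>+x. (\<integral>\<^sup>+y. ennreal ((u y)\<^sup>2) \<partial>p x) \<partial>M)"
  proof (rule nn_integral_mono_AE, rule AE_mp[OF L2_kernel_AE[OF u]], intro AE_I2 impI)
    fix x assume x: "x \<in> space M" and ux: "u \<in> L2 (p x)"
    show "ennreal ((kernel_op p u x)\<^sup>2) \<le> (\<integral>\<^sup>+y. ennreal ((u y)\<^sup>2) \<partial>p x)"
      using L2_kernel_integrable(2)[OF x ux] L2_inner_nn_integral[OF ux]
      by (metis ennreal_leI)
  qed
  also have "\<dots> \<le> (\<integral>\<^sup>+x. ennreal ((u x)\<^sup>2) \<partial>M)" using m by (intro nn_kernel_le) measurable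
  finally have le: "(\<integral>\<^sup>+x. ennreal ((kernel_op p u x)\<^sup>2) \<partial>M) \<le> (\<integral>\<^sup>+x. ennreal ((u x)\<^sup>2) \<partial>M)" .
  also have "\<dots> < \<infinity>" using u by (simp add: L2_iff_nn_integral)
  finally show K: "kernel_op p u \<in> L2 M" using m by (simp add: L2_iff_nn_integral kernel_op_measurable)
  have "ennreal (L2_inner M (kernel_op p u) (kernel_op p u)) \<le> ennreal (L2_inner M u u)"
    using le by (simp only: L2_inner_nn_integral[OF K] L2_inner_nn_integral[OF u])
  then have "L2_inner M (kernel_op p u) (kernel_op p u) \<le> L2_inner M u u"
    using form_nonneg[OF symmetric_form_L2 u] by (simp add: ennreal_le_iff)
  then show "L2_norm M (kernel_op p u) \<le> L2_norm M u" by (simp add: L2_norm_def)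
qed

lemma kernel_op_linear_AE:
  assumes "u \<in> L2 M" "v \<in> L2 M"
  shows "AE x in M. kernel_op p (\<lambda>x. a * u x + b * v x) x = a * kernel_op p u x + b * kernel_op p v x"
  using kernel_integrable_AE[OF assms(1)] kernel_integrable_AE[OF assms(2)]
  by eventually_elim (simp add: kernel_op_def)

lemma kernel_op_cong_AE:
  assumes "AE x in M. u x = v x" "u \<in> borel_measurable M" "v \<in> borel_measurable M"
  shows "AE x in M. kernel_op p u x = kernel_op p v x"
  using AE_kernel[OF assms(1)]
proof (rule AE_mp, intro AE_I2 impI)
  fix x assume x: "x \<in> space M" and ae: "AE y in p x. u y = v y"
  show "kernel_op p u x = kernel_op p v x"
    unfolding kernel_op_def
    by (rule integral_cong_AE[OF measurable_p[OF x assms(2)] measurable_p[OF x assms(3)] ae])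
qed

lemma kernel_op_nonneg_AE:
  assumes u: "u \<in> L2 M" and pos: "\<And>x. 0 \<le> u x"
  shows "AE x in M. ennreal (kernel_op p u x) = (\<integral>\<^sup>+y. ennreal (u y) \<partial>p x)"
  using kernel_integrable_AE[OF u]
  by eventually_elim (simp add: kernel_op_def nn_integral_eq_integral pos)

end

lemma L2_pos_part: "u \<in> L2 M \<Longrightarrow> (\<lambda>x. max (u x) 0) \<in> L2 M"
  and L2_neg_part: "u \<in> L2 M \<Longrightarrow> (\<lambda>x. max (- u x) 0) \<in> L2 M"
proof -
  assume u: "u \<in> L2 M"
  then have [measurable]: "u \<in> borel_measurable M" by (rule L2_measurable)
  show "(\<lambda>x. max (u x) 0) \<in> L2 M"
    by (rule L2_I, measurable, rule Bochner_Integration.integrable_bound[OF L2_square_integrable[OF u]])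
      (auto simp: max_def)
  show "(\<lambda>x. max (- u x) 0) \<in> L2 M"
    by (rule L2_I, measurable, rule Bochner_Integration.integrable_bound[OF L2_square_integrable[OF u]])
      (auto simp: max_def)
qed

lemma pos_neg_part: "u x = max (u x) 0 - max (- u x) (0::real)"
  by (simp add: max_def)

context symmetric_kernel
begin

lemma kernel_op_pos_neg_AE:
  assumes "u \<in> L2 M"
  shows "AE x in M. kernel_op p u x =
    kernel_op p (\<lambda>x. max (u x) 0) x - kernel_op p (\<lambda>x. max (- u x) 0) x"
proof -
  have "AE x in M. kernel_op p (\<lambda>x. 1 * max (u x) 0 + (-1) * max (- u x) 0) x =
      1 * kernel_op p (\<lambda>x. max (u x) 0) x + (-1) * kernel_op p (\<lambda>x. max (- u x) 0) x"
    by (rule kernel_op_linear_AE[OF L2_pos_part[OF assms] L2_neg_part[OF assms]])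
  moreover have "(\<lambda>x. 1 * max (u x) 0 + (-1) * max (- u x) 0) = u" by (auto simp: max_def)
  ultimately show ?thesis by simp
qed

lemma kernel_op_sym_nonneg:
  assumes u: "u \<in> L2 M" "\<And>x. 0 \<le> u x" and v: "v \<in> L2 M" "\<And>x. 0 \<le> v x"
  shows "L2_inner M (kernel_op p u) v = L2_inner M u (kernel_op p v)"
proof -
  have K0: "0 \<le> kernel_op p u x" "0 \<le> kernel_op p v x" for x
    using u(2) v(2) by (simp_all add: kernel_op_def)
  have "ennreal (L2_inner M (kernel_op p u) v) = (\<integral>\<^sup>+x. ennreal (kernel_op p u x * v x) \<partial>M)"
    unfolding L2_inner_def using K0 v(2)
    by (subst nn_integral_eq_integral[OF L2_mult_integrable[OF kernel_op_L2(1)[OF u(1)] v(1)]]) auto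
  also have "\<dots> = (\<integral>\<^sup>+x. (\<integral>\<^sup>+y. ennreal (u y) \<partial>p x) * ennreal (v x) \<partial>M)"
    by (rule nn_integral_cong_AE, use kernel_op_nonneg_AE[OF u] in eventually_elim)
      (simp add: ennreal_mult K0 v(2))
  also have "\<dots> = (\<integral>\<^sup>+x. ennreal (u x) * (\<integral>\<^sup>+y. ennreal (v y) \<partial>p x) \<partial>M)"
    by (rule kernel_sym) (use u(1) v(1) in \<open>auto simp: L2_def\<close>)
  also have "\<dots> = (\<integral>\<^sup>+x. ennreal (u x * kernel_op p v x) \<partial>M)"
    by (rule nn_integral_cong_AE, use kernel_op_nonneg_AE[OF v] in eventually_elim)
      (metis ennreal_mult K0(2) u(2))
  also have "\<dots> = ennreal (L2_inner M u (kernel_op p v))"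
    unfolding L2_inner_def using K0 u(2)
    by (subst nn_integral_eq_integral[OF L2_mult_integrable[OF u(1) kernel_op_L2(1)[OF v(1)]]]) auto
  finally show ?thesis
    by (subst (asm) ennreal_inj) (auto simp: L2_inner_def intro!: integral_nonneg_AE AE_I2 mult_nonneg_nonneg K0 u(2) v(2))
qed

text \<open>The integrals that define the operator need to exist only almost everywhere, so symmetry,
  like the composition rule below, is first shown for nonnegative functions, where it is an identity
  of \<open>ennreal\<close>-valued integrals, and then extended by positive and negative parts.\<close>

lemma kernel_op_sym:
  assumes u: "u \<in> L2 M" and v: "v \<in> L2 M"
  shows "L2_inner M (kernel_op p u) v = L2_inner M u (kernel_op p v)"
proof -
  note L = symmetric_form_L2[of M]
  note parts = L2_pos_part L2_neg_part
  have split: "L2_inner M (kernel_op p w) z =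
      L2_inner M (kernel_op p (\<lambda>x. max (w x) 0)) z - L2_inner M (kernel_op p (\<lambda>x. max (- w x) 0)) z"
    if w: "w \<in> L2 M" and z: "z \<in> L2 M" for w z
  proof -
    have "L2_inner M (kernel_op p w) z =
        L2_inner M (\<lambda>x. kernel_op p (\<lambda>x. max (w x) 0) x - kernel_op p (\<lambda>x. max (- w x) 0) x) z"
      using kernel_op_pos_neg_AE[OF w] w z
      by (intro L2_inner_cong_AE) (auto intro!: L2_measurable L2_diff kernel_op_L2 parts)
    also have "\<dots> = L2_inner M (kernel_op p (\<lambda>x. max (w x) 0)) z - L2_inner M (kernel_op p (\<lambda>x. max (- w x) 0)) z"
      by (rule form_diff_left[OF L kernel_op_L2(1)[OF L2_pos_part[OF w]] kernel_op_L2(1)[OF L2_neg_part[OF w]] z])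
    finally show ?thesis .
  qed
  have split': "L2_inner M z w = L2_inner M z (\<lambda>x. max (w x) 0) - L2_inner M z (\<lambda>x. max (- w x) 0)"
    if w: "w \<in> L2 M" and z: "z \<in> L2 M" for w z
    using form_diff_right[OF L L2_pos_part[OF w] L2_neg_part[OF w] z] by (simp flip: pos_neg_part)
  have half: "L2_inner M (kernel_op p u) w = L2_inner M u (kernel_op p w)"
    if w: "w \<in> L2 M" "\<And>x. 0 \<le> w x" for w
    using split[OF u w(1)] split'[OF u kernel_op_L2(1)[OF w(1)]]
      kernel_op_sym_nonneg[OF L2_pos_part[OF u] _ w] kernel_op_sym_nonneg[OF L2_neg_part[OF u] _ w]
      form_sym[OF L kernel_op_L2(1)[OF w(1)] u]
      form_sym[OF L kernel_op_L2(1)[OF w(1)] L2_pos_part[OF u]]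
      form_sym[OF L kernel_op_L2(1)[OF w(1)] L2_neg_part[OF u]] by simp
  show ?thesis
    using split'[OF v kernel_op_L2(1)[OF u]] split[OF v u] half[OF L2_pos_part[OF v]] half[OF L2_neg_part[OF v]]
      form_sym[OF L kernel_op_L2(1)[OF v] u] form_sym[OF L kernel_op_L2(1)[OF L2_pos_part[OF v]] u]
      form_sym[OF L kernel_op_L2(1)[OF L2_neg_part[OF v]] u] by simp
qed

end

lemma kernel_op_bind_AE:
  assumes p: "symmetric_kernel M p" and q: "symmetric_kernel M q" and u: "u \<in> L2 M"
  shows "AE x in M. kernel_op p (kernel_op q u) x = kernel_op (\<lambda>x. p x \<bind> q) u x"
proof -
  interpret p: symmetric_kernel M p by fact
  interpret q: symmetric_kernel M q by fact
  have nonneg: "AE x in M. kernel_op p (kernel_op q f) x = kernel_op (\<lambda>x. p x \<bind> q) f x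
      \<and> integrable (p x \<bind> q) f" if f: "f \<in> L2 M" and pos: "\<And>x. 0 \<le> f x" for f
  proof -
    have m: "f \<in> borel_measurable M" using f by (rule L2_measurable)
    have q0: "0 \<le> kernel_op q f x" for x using pos by (simp add: kernel_op_def)
    show ?thesis
      using p.kernel_op_nonneg_AE[OF q.kernel_op_L2(1)[OF f] q0] p.AE_kernel[OF q.kernel_op_nonneg_AE[OF f pos]]
        AE_space
    proof eventually_elim
      case (elim x)
      have qm: "q \<in> p x \<rightarrow>\<^sub>M subprob_algebra M" by (rule p.measurable_p[OF elim(3) q.kernel])
      have sb: "sets (p x \<bind> q) = sets M"
        by (rule sets_bind[OF sets_kernel[OF qm]]) (use elim(3) p.space_p[OF elim(3)] in auto)
      have mb: "f \<in> borel_measurable (p x \<bind> q)" using m measurable_cong_sets[OF sb refl] by blast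
      have "ennreal (kernel_op p (kernel_op q f) x) = (\<integral>\<^sup>+y. (\<integral>\<^sup>+z. ennreal (f z) \<partial>q y) \<partial>p x)"
        unfolding elim(1) by (rule nn_integral_cong_AE[OF elim(2)])
      also have "\<dots> = (\<integral>\<^sup>+z. ennreal (f z) \<partial>(p x \<bind> q))"
        by (rule nn_integral_bind[OF _ qm, symmetric]) (use m in measurable)
      finally have eq: "(\<integral>\<^sup>+z. ennreal (f z) \<partial>(p x \<bind> q)) = ennreal (kernel_op p (kernel_op q f) x)" ..
      have "0 \<le> kernel_op p (kernel_op q f) x" using q0 unfolding kernel_op_def[of p] by simp
      then show ?case
        using eq integral_eq_nn_integral[OF mb] mb pos
        by (auto simp: kernel_op_def[of "\<lambda>x. p x \<bind> q"] integrable_iff_bounded)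
    qed
  qed
  let ?f = "\<lambda>x. max (u x) 0" and ?g = "\<lambda>x. max (- u x) 0"
  have fg: "?f \<in> L2 M" "?g \<in> L2 M" by (rule L2_pos_part[OF u], rule L2_neg_part[OF u])
  have qu: "kernel_op q u \<in> borel_measurable M" "kernel_op q ?f \<in> L2 M" "kernel_op q ?g \<in> L2 M"
    by (rule L2_measurable[OF q.kernel_op_L2(1)[OF u]]) (rule q.kernel_op_L2(1) fg)+
  have 1: "AE x in M. kernel_op p (kernel_op q u) x = kernel_op p (\<lambda>x. 1 * kernel_op q ?f x + (-1) * kernel_op q ?g x) x"
    using q.kernel_op_pos_neg_AE[OF u]
    by (intro p.kernel_op_cong_AE qu(1) L2_measurable[OF L2_add[OF L2_cmult[OF qu(2)] L2_cmult[OF qu(3)]]]) simp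
  have 2: "AE x in M. kernel_op p (\<lambda>x. 1 * kernel_op q ?f x + (-1) * kernel_op q ?g x) x =
      1 * kernel_op p (kernel_op q ?f) x + (-1) * kernel_op p (kernel_op q ?g) x"
    by (rule p.kernel_op_linear_AE[OF qu(2,3)])
  show ?thesis
    using 1 2 nonneg[OF fg(1) max.cobounded2] nonneg[OF fg(2) max.cobounded2]
  proof (eventually_elim, goal_cases)
    case (1 x)
    have "kernel_op (\<lambda>x. p x \<bind> q) u x = (LINT z|(p x \<bind> q). ?f z - ?g z)"
      unfolding kernel_op_def by (simp flip: pos_neg_part)
    also have "\<dots> = kernel_op (\<lambda>x. p x \<bind> q) ?f x - kernel_op (\<lambda>x. p x \<bind> q) ?g x"
      unfolding kernel_op_def using 1 by (intro Bochner_Integration.integral_diff) auto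
    finally show ?case using 1 by simp
  qed
qed

lemma L2_semigroup_kernel:
  assumes p: "\<And>t. 0 < t \<Longrightarrow> symmetric_kernel M (p t)"
    and add: "\<And>s t x. 0 < s \<Longrightarrow> 0 < t \<Longrightarrow> x \<in> space M \<Longrightarrow> p (s + t) x = p s x \<bind> p t"
    and cont: "\<And>u. u \<in> L2 M \<Longrightarrow> ((\<lambda>t. L2_norm M (\<lambda>x. kernel_op (p t) u x - u x)) \<longlongrightarrow> 0) (at_right 0)"
  shows "L2_semigroup M (\<lambda>t. kernel_op (p t))"
  unfolding L2_semigroup_def
proof (intro conjI allI impI ballI)
  fix s t :: real and u v and a b :: real
  assume u: "u \<in> L2 M" and t: "0 < t"
  interpret p: symmetric_kernel M "p t" by (rule p[OF t])
  show "kernel_op (p t) u \<in> L2 M" "L2_norm M (kernel_op (p t) u) \<le> L2_norm M u"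
    using p.kernel_op_L2[OF u] by auto
  { assume v: "v \<in> L2 M"
    show "AE x in M. kernel_op (p t) (\<lambda>x. a * u x + b * v x) x = a * kernel_op (p t) u x + b * kernel_op (p t) v x"
      by (rule p.kernel_op_linear_AE[OF u v])
    show "L2_inner M (kernel_op (p t) u) v = L2_inner M u (kernel_op (p t) v)"
      by (rule p.kernel_op_sym[OF u v]) }
  assume s: "0 < s"
  show "AE x in M. kernel_op (p (s + t)) u x = kernel_op (p s) (kernel_op (p t) u) x"
    using kernel_op_bind_AE[OF p[OF s] p[OF t] u] AE_space
    by eventually_elim (simp add: kernel_op_def add[OF s t])
qed (rule cont)

section \<open>Products of kernels\<close>

definition prod_kernel :: "('a \<Rightarrow> 'a measure) \<Rightarrow> ('b \<Rightarrow> 'b measure) \<Rightarrow> 'a \<times> 'b \<Rightarrow> ('a \<times> 'b) measure" where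
  "prod_kernel p q z = p (fst z) \<Otimes>\<^sub>M q (snd z)"

lemma symmetric_kernel_return: "symmetric_kernel M (return M)"
proof
  show "return M \<in> M \<rightarrow>\<^sub>M subprob_algebra M" by (rule return_measurable)
  fix f g :: "'a \<Rightarrow> ennreal" assume "f \<in> borel_measurable M" "g \<in> borel_measurable M"
  then show "(\<integral>\<^sup>+x. (\<integral>\<^sup>+y. f y \<partial>return M x) * g x \<partial>M) = (\<integral>\<^sup>+x. f x * (\<integral>\<^sup>+y. g y \<partial>return M x) \<partial>M)"
    by (intro nn_integral_cong) (simp add: nn_integral_return)
qed

locale symmetric_kernel_pair =
  p: symmetric_kernel M p + q: symmetric_kernel N q + pair_sigma_finite M N
  for M :: "'a measure" and p and N :: "'b measure" and q
begin

lemma measurable_prod_kernel: "prod_kernel p q \<in> M \<Otimes>\<^sub>M N \<rightarrow>\<^sub>M subprob_algebra (M \<Otimes>\<^sub>M N)"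
  unfolding prod_kernel_def[abs_def]
  by (intro measurable_pair_measure measurable_compose[OF measurable_fst p.kernel]
      measurable_compose[OF measurable_snd q.kernel])

lemma nn_integral_prod_kernel:
  assumes x: "x \<in> space M" and y: "y \<in> space N" and f: "f \<in> borel_measurable (M \<Otimes>\<^sub>M N)"
  shows "(\<integral>\<^sup>+z. f z \<partial>prod_kernel p q (x, y)) = (\<integral>\<^sup>+y'. \<integral>\<^sup>+x'. f (x', y') \<partial>p x \<partial>q y)"
proof -
  interpret P: subprob_space "p x" by (rule p.subprob_p[OF x])
  interpret Q: subprob_space "q y" by (rule q.subprob_p[OF y])
  interpret PQ: pair_sigma_finite "p x" "q y" ..
  have "f \<in> borel_measurable (p x \<Otimes>\<^sub>M q y)"
    using f measurable_cong_sets[OF sets_pair_measure_cong[OF p.sets_p[OF x] q.sets_p[OF y]] refl] by blast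
  from PQ.nn_integral_snd[OF this] show ?thesis by (simp add: prod_kernel_def)
qed

lemma measurable_nn_fst:
  assumes f: "f \<in> borel_measurable (M \<Otimes>\<^sub>M N)"
  shows "(\<lambda>z. \<integral>\<^sup>+x'. f (x', snd z) \<partial>p (fst z)) \<in> borel_measurable (M \<Otimes>\<^sub>M N)"
  by (rule nn_integral_measurable_subprob_algebra2[OF _ measurable_compose[OF measurable_fst p.kernel]])
    (use f in measurable)

lemma measurable_nn_snd:
  assumes f: "f \<in> borel_measurable (M \<Otimes>\<^sub>M N)"
  shows "(\<lambda>z. \<integral>\<^sup>+y'. f (fst z, y') \<partial>q (snd z)) \<in> borel_measurable (M \<Otimes>\<^sub>M N)"
  by (rule nn_integral_measurable_subprob_algebra2[OF _ measurable_compose[OF measurable_snd q.kernel]])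
    (use f in measurable)

lemma symmetric_kernel_prod: "symmetric_kernel (M \<Otimes>\<^sub>M N) (prod_kernel p q)"
proof
  show "prod_kernel p q \<in> M \<Otimes>\<^sub>M N \<rightarrow>\<^sub>M subprob_algebra (M \<Otimes>\<^sub>M N)" by (rule measurable_prod_kernel)
  fix f g :: "'a \<times> 'b \<Rightarrow> ennreal"
  assume f[measurable]: "f \<in> borel_measurable (M \<Otimes>\<^sub>M N)" and g[measurable]: "g \<in> borel_measurable (M \<Otimes>\<^sub>M N)"
  define Pf where "Pf z = (\<integral>\<^sup>+x'. f (x', snd z) \<partial>p (fst z))" for z
  define Qg where "Qg z = (\<integral>\<^sup>+y'. g (fst z, y') \<partial>q (snd z))" for z
  have [measurable]: "Pf \<in> borel_measurable (M \<Otimes>\<^sub>M N)" "Qg \<in> borel_measurable (M \<Otimes>\<^sub>M N)"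
    unfolding Pf_def Qg_def by (rule measurable_nn_fst[OF f], rule measurable_nn_snd[OF g])
  have [measurable]: "(\<lambda>z. \<integral>\<^sup>+w. h w \<partial>prod_kernel p q z) \<in> borel_measurable (M \<Otimes>\<^sub>M N)"
    if "h \<in> borel_measurable (M \<Otimes>\<^sub>M N)" for h :: "'a \<times> 'b \<Rightarrow> ennreal"
    by (rule measurable_compose[OF measurable_prod_kernel nn_integral_measurable_subprob_algebra[OF that]])
  have [measurable]: "(\<lambda>y. h (x, y)) \<in> borel_measurable N" if "x \<in> space M" "h \<in> borel_measurable (M \<Otimes>\<^sub>M N)"
    for x and h :: "'a \<times> 'b \<Rightarrow> ennreal" using that by measurable
  have [measurable]: "(\<lambda>x. h (x, y)) \<in> borel_measurable M" if "y \<in> space N" "h \<in> borel_measurable (M \<Otimes>\<^sub>M N)"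
    for y and h :: "'a \<times> 'b \<Rightarrow> ennreal" using that by measurable
  have "(\<integral>\<^sup>+z. (\<integral>\<^sup>+w. f w \<partial>prod_kernel p q z) * g z \<partial>(M \<Otimes>\<^sub>M N))
      = (\<integral>\<^sup>+x. \<integral>\<^sup>+y. (\<integral>\<^sup>+w. f w \<partial>prod_kernel p q (x, y)) * g (x, y) \<partial>N \<partial>M)"
    by (subst M2.nn_integral_fst[symmetric]) simp_all
  also have "\<dots> = (\<integral>\<^sup>+x. \<integral>\<^sup>+y. (\<integral>\<^sup>+y'. Pf (x, y') \<partial>q y) * g (x, y) \<partial>N \<partial>M)"
    by (intro nn_integral_cong) (simp add: nn_integral_prod_kernel Pf_def)
  also have "\<dots> = (\<integral>\<^sup>+x. \<integral>\<^sup>+y. Pf (x, y) * Qg (x, y) \<partial>N \<partial>M)"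
    unfolding Qg_def fst_conv snd_conv by (intro nn_integral_cong q.kernel_sym) simp_all
  also have "\<dots> = (\<integral>\<^sup>+y. \<integral>\<^sup>+x. Pf (x, y) * Qg (x, y) \<partial>M \<partial>N)"
    by (rule Fubini'[symmetric]) simp
  also have "\<dots> = (\<integral>\<^sup>+y. \<integral>\<^sup>+x. f (x, y) * (\<integral>\<^sup>+x'. Qg (x', y) \<partial>p x) \<partial>M \<partial>N)"
    unfolding Pf_def fst_conv snd_conv by (intro nn_integral_cong p.kernel_sym) simp_all
  also have "\<dots> = (\<integral>\<^sup>+y. \<integral>\<^sup>+x. f (x, y) * (\<integral>\<^sup>+w. g w \<partial>prod_kernel p q (x, y)) \<partial>M \<partial>N)"
  proof (intro nn_integral_cong arg_cong2[where f="(*)"] refl)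
    fix x y assume y: "y \<in> space N" and x: "x \<in> space M"
    interpret P: subprob_space "p x" by (rule p.subprob_p[OF x])
    interpret Q: subprob_space "q y" by (rule q.subprob_p[OF y])
    interpret PQ: pair_sigma_finite "p x" "q y" ..
    have "g \<in> borel_measurable (p x \<Otimes>\<^sub>M q y)"
      using g measurable_cong_sets[OF sets_pair_measure_cong[OF p.sets_p[OF x] q.sets_p[OF y]] refl] by blast
    from Q.nn_integral_fst[OF this] show "(\<integral>\<^sup>+x'. Qg (x', y) \<partial>p x) = (\<integral>\<^sup>+w. g w \<partial>prod_kernel p q (x, y))"
      by (simp add: prod_kernel_def Qg_def)
  qed
  also have "\<dots> = (\<integral>\<^sup>+z. f z * (\<integral>\<^sup>+w. g w \<partial>prod_kernel p q z) \<partial>(M \<Otimes>\<^sub>M N))"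
    by (subst nn_integral_snd[symmetric]) simp_all
  finally show "(\<integral>\<^sup>+z. (\<integral>\<^sup>+w. f w \<partial>prod_kernel p q z) * g z \<partial>(M \<Otimes>\<^sub>M N))
      = (\<integral>\<^sup>+z. f z * (\<integral>\<^sup>+w. g w \<partial>prod_kernel p q z) \<partial>(M \<Otimes>\<^sub>M N))" .
qed

end

lemma bind_prod_kernel:
  assumes p: "symmetric_kernel M p" "symmetric_kernel M p'" and q: "symmetric_kernel N q" "symmetric_kernel N q'"
    and M: "sigma_finite_measure M" and N: "sigma_finite_measure N"
    and z: "z \<in> space (M \<Otimes>\<^sub>M N)"
  shows "prod_kernel p q z \<bind> prod_kernel p' q' = prod_kernel (\<lambda>x. p x \<bind> p') (\<lambda>y. q y \<bind> q') z"
proof -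
  obtain x y where z_eq: "z = (x, y)" and x: "x \<in> space M" and y: "y \<in> space N"
    using z by (auto simp: space_pair_measure)
  interpret p: symmetric_kernel M p by fact
  interpret p': symmetric_kernel M p' by fact
  interpret q: symmetric_kernel N q by fact
  interpret q': symmetric_kernel N q' by fact
  interpret M: sigma_finite_measure M by fact
  interpret N: sigma_finite_measure N by fact
  interpret PQ': symmetric_kernel_pair M p' N q' ..
  interpret Px: subprob_space "p x" by (rule p.subprob_p[OF x])
  interpret Qy: subprob_space "q y" by (rule q.subprob_p[OF y])
  have p'm: "p' \<in> p x \<rightarrow>\<^sub>M subprob_algebra M" by (rule p.measurable_p[OF x p'.kernel])
  have q'm: "q' \<in> q y \<rightarrow>\<^sub>M subprob_algebra N" by (rule q.measurable_p[OF y q'.kernel])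
  have sets: "sets (p x \<Otimes>\<^sub>M q y) = sets (M \<Otimes>\<^sub>M N)"
    by (rule sets_pair_measure_cong[OF p.sets_p[OF x] q.sets_p[OF y]])
  have pq'm: "prod_kernel p' q' \<in> p x \<Otimes>\<^sub>M q y \<rightarrow>\<^sub>M subprob_algebra (M \<Otimes>\<^sub>M N)"
    using PQ'.measurable_prod_kernel measurable_cong_sets[OF sets refl] by blast
  have sp: "space (p x) \<noteq> {}" "space (q y) \<noteq> {}" using x y p.space_p q.space_p by auto
  have sb: "sets (p x \<bind> p') = sets M" "sets (q y \<bind> q') = sets N"
    using sets_bind[OF sets_kernel[OF p'm] sp(1)] sets_bind[OF sets_kernel[OF q'm] sp(2)] by auto
  have sub: "subprob_space (p x \<bind> p')" "subprob_space (q y \<bind> q')"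
    using subprob_space_bind[OF Px.subprob_space_axioms p'm] subprob_space_bind[OF Qy.subprob_space_axioms q'm] by auto
  have "(p x \<bind> p') \<Otimes>\<^sub>M (q y \<bind> q') = (p x \<Otimes>\<^sub>M q y) \<bind> prod_kernel p' q'"
  proof (rule pair_measure_eqI)
    show "sigma_finite_measure (p x \<bind> p')" "sigma_finite_measure (q y \<bind> q')"
      using sub by (auto intro: subprob_space_imp_sigma_finite)
    show "sets ((p x \<bind> p') \<Otimes>\<^sub>M (q y \<bind> q')) = sets ((p x \<Otimes>\<^sub>M q y) \<bind> prod_kernel p' q')"
    proof -
      have "sets ((p x \<Otimes>\<^sub>M q y) \<bind> prod_kernel p' q') = sets (M \<Otimes>\<^sub>M N)"
        by (rule sets_bind, rule sets_kernel[OF pq'm]) (use sp in \<open>auto simp: space_pair_measure\<close>)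
      then show ?thesis using sets_pair_measure_cong[OF sb] by simp
    qed
    fix A B assume "A \<in> sets (p x \<bind> p')" "B \<in> sets (q y \<bind> q')"
    then have AB: "A \<in> sets M" "B \<in> sets N" by (simp_all add: sb)
    have m: "(\<lambda>x'. emeasure (p' x') A) \<in> borel_measurable (p x)"
      "(\<lambda>y'. emeasure (q' y') B) \<in> borel_measurable (q y)"
      using measurable_emeasure_kernel[OF p'm AB(1)] measurable_emeasure_kernel[OF q'm AB(2)] by auto
    have "emeasure ((p x \<Otimes>\<^sub>M q y) \<bind> prod_kernel p' q') (A \<times> B)
        = (\<integral>\<^sup>+w. emeasure (prod_kernel p' q' w) (A \<times> B) \<partial>(p x \<Otimes>\<^sub>M q y))"
      by (rule emeasure_bind[OF _ pq'm]) (use sp AB in \<open>auto simp: space_pair_measure\<close>)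
    also have "\<dots> = (\<integral>\<^sup>+w. emeasure (p' (fst w)) A * emeasure (q' (snd w)) B \<partial>(p x \<Otimes>\<^sub>M q y))"
    proof (rule nn_integral_cong)
      fix w assume "w \<in> space (p x \<Otimes>\<^sub>M q y)"
      then have w: "fst w \<in> space M" "snd w \<in> space N"
        using p.space_p[OF x] q.space_p[OF y] by (auto simp: space_pair_measure)
      interpret Q: subprob_space "q' (snd w)" by (rule q'.subprob_p[OF w(2)])
      show "emeasure (prod_kernel p' q' w) (A \<times> B) = emeasure (p' (fst w)) A * emeasure (q' (snd w)) B"
        unfolding prod_kernel_def using AB p'.sets_p[OF w(1)] q'.sets_p[OF w(2)]
        by (intro Q.emeasure_pair_measure_Times) auto
    qed
    also have "\<dots> = (\<integral>\<^sup>+x'. emeasure (p' x') A \<partial>p x) * (\<integral>\<^sup>+y'. emeasure (q' y') B \<partial>q y)"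
      using m by (subst Qy.nn_integral_fst[symmetric])
        (auto simp: nn_integral_cmult nn_integral_multc
          intro!: borel_measurable_times_ennreal measurable_compose[OF measurable_fst] measurable_compose[OF measurable_snd])
    also have "\<dots> = emeasure (p x \<bind> p') A * emeasure (q y \<bind> q') B"
      using emeasure_bind[OF sp(1) p'm AB(1)] emeasure_bind[OF sp(2) q'm AB(2)] by simp
    finally show "emeasure (p x \<bind> p') A * emeasure (q y \<bind> q') B
        = emeasure ((p x \<Otimes>\<^sub>M q y) \<bind> prod_kernel p' q') (A \<times> B)" by simp
  qed
  then show ?thesis by (simp add: prod_kernel_def z_eq)
qed

text \<open>The kernel \<open>return N\<close> leaves its variable fixed, so the product kernel acts on one variable only.\<close>

lemma kernel_op_prod_return_right:
  assumes p: "symmetric_kernel M p" and u: "u \<in> borel_measurable (M \<Otimes>\<^sub>M N)"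
    and x: "x \<in> space M" and y: "y \<in> space N"
  shows "kernel_op (prod_kernel p (return N)) u (x, y) = kernel_op p (\<lambda>x. u (x, y)) x"
proof -
  interpret p: symmetric_kernel M p by fact
  interpret Px: subprob_space "p x" by (rule p.subprob_p[OF x])
  interpret R: prob_space "return N y" by (rule prob_space_return[OF y])
  have s: "sets (p x \<Otimes>\<^sub>M return N y) = sets (M \<Otimes>\<^sub>M N)"
    by (rule sets_pair_measure_cong[OF p.sets_p[OF x] sets_return])
  have m: "(\<lambda>x'. (x', y)) \<in> p x \<rightarrow>\<^sub>M p x \<Otimes>\<^sub>M return N y" using y by simp
  have "p x \<Otimes>\<^sub>M return N y = distr (p x) (p x \<Otimes>\<^sub>M return N y) (\<lambda>x'. (x', y))"
  proof (rule pair_measure_eqI)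
    fix A B assume A: "A \<in> sets (p x)" and B: "B \<in> sets (return N y)"
    have "(\<lambda>x'. (x', y)) -` (A \<times> B) \<inter> space (p x) = (if y \<in> B then A else {})"
      using sets.sets_into_space[OF A] by auto
    then show "emeasure (p x) A * emeasure (return N y) B =
        emeasure (distr (p x) (p x \<Otimes>\<^sub>M return N y) (\<lambda>x'. (x', y))) (A \<times> B)"
      using A B by (subst emeasure_distr[OF m]) (auto simp: indicator_def)
  qed (auto intro: Px.sigma_finite_measure_axioms R.sigma_finite_measure_axioms)
  then have "kernel_op (prod_kernel p (return N)) u (x, y) =
      (LINT z|distr (p x) (p x \<Otimes>\<^sub>M return N y) (\<lambda>x'. (x', y)). u z)"
    by (simp add: kernel_op_def prod_kernel_def)
  also have "\<dots> = (LINT x'|p x. u (x', y))"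
    by (rule integral_distr[OF m]) (use u measurable_cong_sets[OF s refl] in blast)
  finally show ?thesis by (simp add: kernel_op_def)
qed

lemma kernel_op_prod_return_left:
  assumes q: "symmetric_kernel N q" and u: "u \<in> borel_measurable (M \<Otimes>\<^sub>M N)"
    and x: "x \<in> space M" and y: "y \<in> space N"
  shows "kernel_op (prod_kernel (return M) q) u (x, y) = kernel_op q (\<lambda>y. u (x, y)) y"
proof -
  interpret q: symmetric_kernel N q by fact
  interpret Qy: subprob_space "q y" by (rule q.subprob_p[OF y])
  interpret R: prob_space "return M x" by (rule prob_space_return[OF x])
  have s: "sets (return M x \<Otimes>\<^sub>M q y) = sets (M \<Otimes>\<^sub>M N)"
    by (rule sets_pair_measure_cong[OF sets_return q.sets_p[OF y]])
  have m: "(\<lambda>y'. (x, y')) \<in> q y \<rightarrow>\<^sub>M return M x \<Otimes>\<^sub>M q y" using x by simp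
  have "return M x \<Otimes>\<^sub>M q y = distr (q y) (return M x \<Otimes>\<^sub>M q y) (\<lambda>y'. (x, y'))"
  proof (rule pair_measure_eqI)
    fix A B assume A: "A \<in> sets (return M x)" and B: "B \<in> sets (q y)"
    have "(\<lambda>y'. (x, y')) -` (A \<times> B) \<inter> space (q y) = (if x \<in> A then B else {})"
      using sets.sets_into_space[OF B] by auto
    then show "emeasure (return M x) A * emeasure (q y) B =
        emeasure (distr (q y) (return M x \<Otimes>\<^sub>M q y) (\<lambda>y'. (x, y'))) (A \<times> B)"
      using A B by (subst emeasure_distr[OF m]) (auto simp: indicator_def)
  qed (auto intro: Qy.sigma_finite_measure_axioms R.sigma_finite_measure_axioms)
  then have "kernel_op (prod_kernel (return M) q) u (x, y) =
      (LINT z|distr (q y) (return M x \<Otimes>\<^sub>M q y) (\<lambda>y'. (x, y')). u z)"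
    by (simp add: kernel_op_def prod_kernel_def)
  also have "\<dots> = (LINT y'|q y. u (x, y'))"
    by (rule integral_distr[OF m]) (use u measurable_cong_sets[OF s refl] in blast)
  finally show ?thesis by (simp add: kernel_op_def)
qed

section \<open>Random points that may be at the cemetery\<close>

lemma sets_cemetery_borel: "sets (cemetery_borel :: 'a::topological_space option measure) = {A. Some -` A \<in> sets borel}"
proof -
  have "sigma_algebra UNIV {A :: 'a option set. Some -` A \<in> sets borel}"
  proof (rule sigma_algebra_iff2[THEN iffD2], safe)
    fix A :: "nat \<Rightarrow> 'a option set" assume "range A \<subseteq> {A. Some -` A \<in> sets borel}"
    then show "Some -` (\<Union>i. A i) \<in> sets borel" by (auto simp: vimage_UN)
  next
    fix A :: "'a option set" assume "Some -` A \<in> sets borel"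
    moreover have "Some -` (UNIV - A) = UNIV - Some -` A" by auto
    ultimately show "Some -` (UNIV - A) \<in> sets borel" using sets.compl_sets[of "Some -` A" borel] by simp
  qed simp_all
  then show ?thesis unfolding cemetery_borel_def
    by (simp add: sigma_algebra.sigma_sets_eq)
qed

lemma space_cemetery_borel [simp]: "space cemetery_borel = UNIV"
  by (simp add: cemetery_borel_def)

lemma measurable_cemetery_borel_iff:
  "g \<in> cemetery_borel \<rightarrow>\<^sub>M L \<longleftrightarrow> g None \<in> space L \<and> (\<lambda>x. g (Some x)) \<in> borel \<rightarrow>\<^sub>M L"
proof -
  have "(\<forall>z. g z \<in> space L) \<longleftrightarrow> g None \<in> space L \<and> (\<forall>x. g (Some x) \<in> space L)"
    by (metis option.exhaust)
  moreover have "Some -` (g -` A) = (\<lambda>x. g (Some x)) -` A" for A by auto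
  ultimately show ?thesis by (auto simp: measurable_def sets_cemetery_borel Pi_iff)
qed

lemma Some_measurable: "Some \<in> borel \<rightarrow>\<^sub>M cemetery_borel"
  by (auto simp: measurable_def sets_cemetery_borel)

lemma the_measurable: "the \<in> cemetery_borel \<rightarrow>\<^sub>M borel"
  by (simp add: measurable_cemetery_borel_iff)

lemma Some_image_sets: "B \<in> sets borel \<Longrightarrow> Some ` B \<in> sets cemetery_borel"
  by (simp add: sets_cemetery_borel inj_vimage_image_eq)

lemma alive_sets: "{z. z \<noteq> None} \<in> sets cemetery_borel"
proof -
  have "Some -` {z. z \<noteq> None} = UNIV" by auto
  then show ?thesis by (simp add: sets_cemetery_borel)
qed

lemma measurable_case_cemetery:
  assumes "f \<in> borel_measurable borel"
  shows "(\<lambda>z. case z of None \<Rightarrow> 0 | Some x \<Rightarrow> f x) \<in> borel_measurable cemetery_borel"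
  using assms by (simp add: measurable_cemetery_borel_iff)

definition alive_law :: "'w measure \<Rightarrow> ('w \<Rightarrow> 'a::topological_space option) \<Rightarrow> 'a measure" where
  "alive_law N Z = distr (restrict_space N {\<omega> \<in> space N. Z \<omega> \<noteq> None}) borel (\<lambda>\<omega>. the (Z \<omega>))"

lemma transition_alive_law: "transition P X t x = alive_law (P x) (X t)"
  by (simp add: transition_def alive_law_def)

lemma sets_alive_law [simp]: "sets (alive_law N Z) = sets borel"
  and space_alive_law [simp]: "space (alive_law N Z) = UNIV"
  by (simp_all add: alive_law_def)

context
  fixes N :: "'w measure" and Z :: "'w \<Rightarrow> 'a::topological_space option"
  assumes Z: "Z \<in> N \<rightarrow>\<^sub>M cemetery_borel"
begin

lemma alive_event: "B \<in> sets borel \<Longrightarrow> {\<omega> \<in> space N. Z \<omega> \<in> Some ` B} \<in> sets N"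
  using measurable_sets[OF Z Some_image_sets, of B] by (simp add: vimage_def Collect_conj_eq Int_commute)

lemma alive_event': "{\<omega> \<in> space N. Z \<omega> \<noteq> None} \<in> sets N"
  using measurable_sets[OF Z alive_sets] by (simp add: vimage_def Collect_conj_eq Int_commute)

lemma alive_the_measurable: "(\<lambda>\<omega>. the (Z \<omega>)) \<in> restrict_space N {\<omega> \<in> space N. Z \<omega> \<noteq> None} \<rightarrow>\<^sub>M borel"
  by (rule measurable_restrict_space1[OF measurable_compose[OF Z the_measurable]])

lemma nn_integral_alive_law:
  assumes f: "f \<in> borel_measurable borel"
  shows "(\<integral>\<^sup>+x. f x \<partial>alive_law N Z) = (\<integral>\<^sup>+\<omega>. (case Z \<omega> of None \<Rightarrow> 0 | Some x \<Rightarrow> f x) \<partial>N)"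
proof -
  have "(\<integral>\<^sup>+x. f x \<partial>alive_law N Z) = (\<integral>\<^sup>+\<omega>. f (the (Z \<omega>)) * indicator {\<omega> \<in> space N. Z \<omega> \<noteq> None} \<omega> \<partial>N)"
    unfolding alive_law_def using alive_event' f
    by (subst nn_integral_distr[OF alive_the_measurable])
      (auto intro!: nn_integral_restrict_space simp: Int_absorb2)
  also have "\<dots> = (\<integral>\<^sup>+\<omega>. (case Z \<omega> of None \<Rightarrow> 0 | Some x \<Rightarrow> f x) \<partial>N)"
    by (intro nn_integral_cong) (auto split: option.split simp: indicator_def)
  finally show ?thesis .
qed

lemma emeasure_alive_law:
  assumes B: "B \<in> sets borel"
  shows "emeasure (alive_law N Z) B = emeasure N {\<omega> \<in> space N. Z \<omega> \<in> Some ` B}"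
proof -
  have "emeasure (alive_law N Z) B = (\<integral>\<^sup>+x. indicator B x \<partial>alive_law N Z)" using B by simp
  also have "\<dots> = (\<integral>\<^sup>+\<omega>. (case Z \<omega> of None \<Rightarrow> 0 | Some x \<Rightarrow> indicator B x) \<partial>N)"
    by (rule nn_integral_alive_law) (use B in simp)
  also have "\<dots> = (\<integral>\<^sup>+\<omega>. indicator {\<omega> \<in> space N. Z \<omega> \<in> Some ` B} \<omega> \<partial>N)"
    by (intro nn_integral_cong) (auto split: option.split simp: indicator_def)
  also have "\<dots> = emeasure N {\<omega> \<in> space N. Z \<omega> \<in> Some ` B}" using alive_event[OF B] by simp
  finally show ?thesis .
qed

lemma alive_law_le: "emeasure (alive_law N Z) B \<le> emeasure N (space N)"
proof (cases "B \<in> sets borel")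
  case True
  then show ?thesis by (auto simp: emeasure_alive_law intro: emeasure_mono)
qed (simp add: emeasure_notin_sets)

lemma subprob_space_alive_law: "prob_space N \<Longrightarrow> subprob_space (alive_law N Z)"
  by (rule subprob_spaceI) (use alive_law_le[of UNIV] in \<open>auto simp: prob_space.emeasure_space_1\<close>)

end

section \<open>Markov processes\<close>

lemma space_past [simp]: "space (past P X x s) = space (P x)"
  by (simp add: past_def space_measure_of_conv)

lemma sets_past:
  "sets (past P X x s) = sigma_sets (space (P x)) (\<Union>r\<in>{0..s}. {X r -` A \<inter> space (P x) |A. A \<in> sets cemetery_borel})"
  unfolding past_def by (rule sets_measure_of) auto

lemma past_measurable:
  fixes X :: "real \<Rightarrow> 'w \<Rightarrow> 'a::topological_space option"
  assumes "0 \<le> r" "r \<le> s"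
  shows "X r \<in> past P X x s \<rightarrow>\<^sub>M cemetery_borel"
proof (rule measurableI)
  fix A :: "'a option set" assume "A \<in> sets cemetery_borel"
  then show "X r -` A \<inter> space (past P X x s) \<in> sets (past P X x s)"
    unfolding sets_past space_past
    by (intro sigma_sets.Basic UN_I[of r]) (use assms in auto)
qed simp

context
  fixes P :: "'a::topological_space \<Rightarrow> 'w measure" and X :: "real \<Rightarrow> 'w \<Rightarrow> 'a option"
  assumes MP: "markov_process P X"
begin

lemma mp_prob: "prob_space (P x)"
  and mp_measurable: "0 \<le> t \<Longrightarrow> X t \<in> P x \<rightarrow>\<^sub>M cemetery_borel"
  and mp_start: "AE \<omega> in P x. X 0 \<omega> = Some x"
  and mp_sets: "sets (P x) = sets (P y)"
  using MP unfolding markov_process_def by blast+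

lemma mp_kernel:
  assumes t: "0 \<le> t"
  shows "transition P X t \<in> borel \<rightarrow>\<^sub>M subprob_algebra borel"
proof (rule measurable_subprob_algebra)
  fix x :: 'a
  show s: "subprob_space (transition P X t x)"
    unfolding transition_alive_law by (rule subprob_space_alive_law[OF mp_measurable[OF t] mp_prob])
  show "sets (transition P X t x) = sets borel" by (simp add: transition_alive_law)
next
  fix B :: "'a set" assume B: "B \<in> sets borel"
  have "emeasure (transition P X t x) B = ennreal (measure (transition P X t x) B)" for x
  proof -
    interpret subprob_space "transition P X t x"
      unfolding transition_alive_law by (rule subprob_space_alive_law[OF mp_measurable[OF t] mp_prob])
    show ?thesis by (rule emeasure_eq_measure)
  qed
  moreover have "(\<lambda>x. measure (transition P X t x) B) \<in> borel_measurable borel"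
    using MP t B unfolding markov_process_def by blast
  ultimately show "(\<lambda>x. emeasure (transition P X t x) B) \<in> borel_measurable borel" by simp
qed

lemma mp_subprob: "0 \<le> t \<Longrightarrow> subprob_space (transition P X t x)"
  unfolding transition_alive_law by (rule subprob_space_alive_law[OF mp_measurable mp_prob])

lemma mp_emeasure_measurable:
  "0 \<le> t \<Longrightarrow> B \<in> sets borel \<Longrightarrow> (\<lambda>y. emeasure (transition P X t y) B) \<in> borel_measurable borel"
  by (rule measurable_emeasure_kernel[OF mp_kernel])

lemma past_subalgebra: "subalgebra (P x) (past P X x s)"
  unfolding subalgebra_def sets_past space_past
proof (intro conjI refl sets.sigma_sets_subset subsetI)
  fix B assume "B \<in> (\<Union>r\<in>{0..s}. {X r -` A \<inter> space (P x) |A. A \<in> sets cemetery_borel})"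
  then obtain r A where "0 \<le> r" "A \<in> sets cemetery_borel" "B = X r -` A \<inter> space (P x)" by auto
  then show "B \<in> sets (P x)" using measurable_sets[OF mp_measurable] by blast
qed

lemma past_cond_exp: "sigma_finite_subalgebra (P x) (past P X x s)"
proof -
  interpret prob_space "P x" by (rule mp_prob)
  have "finite_measure_subalgebra (P x) (past P X x s)"
    by unfold_locales (rule past_subalgebra)
  then show ?thesis by (rule finite_measure_subalgebra_is_sigma_finite)
qed

text \<open>The Markov property without conditional expectations: on an event of the past, the law of
  the future position is the transition kernel averaged over the present position.\<close>

lemma mp_markov:
  assumes s: "0 \<le> s" and t: "0 \<le> t" and B: "B \<in> sets borel" and C: "C \<in> sets (past P X x s)"
  shows "emeasure (P x) (C \<inter> {\<omega> \<in> space (P x). X (s + t) \<omega> \<in> Some ` B}) =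
    (\<integral>\<^sup>+\<omega>. indicator C \<omega> * (case X s \<omega> of None \<Rightarrow> 0 | Some y \<Rightarrow> emeasure (transition P X t y) B) \<partial>P x)"
proof -
  interpret prob_space "P x" by (rule mp_prob)
  interpret F: sigma_finite_subalgebra "P x" "past P X x s" by (rule past_cond_exp)
  define A where "A = {\<omega> \<in> space (P x). X (s + t) \<omega> \<in> Some ` B}"
  define G where "G \<omega> = (case X s \<omega> of None \<Rightarrow> 0 | Some y \<Rightarrow> measure (transition P X t y) B)" for \<omega>
  have A: "A \<in> sets (P x)" unfolding A_def using s t by (intro alive_event[OF mp_measurable B]) simp
  have CP: "C \<in> sets (P x)" using C past_subalgebra unfolding subalgebra_def by blast
  have mtr: "(\<lambda>y. measure (transition P X t y) B) \<in> borel_measurable borel"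
    using MP t B unfolding markov_process_def by blast
  have Gm: "G \<in> borel_measurable (P x)"
    unfolding G_def by (rule measurable_compose[OF mp_measurable[OF s] measurable_case_cemetery[OF mtr]])
  have G01: "0 \<le> G \<omega>" "G \<omega> \<le> 1" for \<omega>
    unfolding G_def using subprob_space.subprob_measure_le_1[OF mp_subprob[OF t]] by (auto split: option.split)
  have GI: "integrable (P x) (\<lambda>\<omega>. indicator C \<omega> * G \<omega>)"
    by (rule integrable_const_bound[of _ 1]) (use G01 CP Gm in \<open>auto simp: indicator_def\<close>)
  have CAI: "integrable (P x) (indicat_real (C \<inter> A))"
    by (rule integrable_real_indicator) (use A CP in \<open>auto simp: less_top[symmetric]\<close>)
  have "AE \<omega> in P x. real_cond_exp (P x) (past P X x s) (indicator A) \<omega> = G \<omega>"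
    using MP s t B unfolding markov_process_def A_def G_def by blast
  then have "(LINT \<omega>|P x. indicator C \<omega> * real_cond_exp (P x) (past P X x s) (indicator A) \<omega>) = (LINT \<omega>|P x. indicator C \<omega> * G \<omega>)"
    using CP Gm by (intro integral_cong_AE) auto
  moreover have "(LINT \<omega>|P x. indicator C \<omega> * real_cond_exp (P x) (past P X x s) (indicator A) \<omega>)
      = (LINT \<omega>|P x. indicator C \<omega> * indicator A \<omega>)"
    by (rule F.real_cond_exp_intg(2))
      (use A C CP CAI in \<open>auto simp flip: indicator_inter_arith\<close>)
  moreover have "(LINT \<omega>|P x. indicator C \<omega> * indicator A \<omega>) = measure (P x) (C \<inter> A)"
    using A CP by (simp flip: indicator_inter_arith)
  ultimately have "ennreal (measure (P x) (C \<inter> A)) = ennreal (LINT \<omega>|P x. indicator C \<omega> * G \<omega>)" by simp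
  also have "\<dots> = (\<integral>\<^sup>+\<omega>. ennreal (indicator C \<omega> * G \<omega>) \<partial>P x)"
    by (rule nn_integral_eq_integral[OF GI, symmetric]) (use G01 in auto)
  also have "\<dots> = (\<integral>\<^sup>+\<omega>. indicator C \<omega> * (case X s \<omega> of None \<Rightarrow> 0 | Some y \<Rightarrow> emeasure (transition P X t y) B) \<partial>P x)"
  proof (rule nn_integral_cong)
    fix \<omega>
    have "emeasure (transition P X t y) B = ennreal (measure (transition P X t y) B)" for y
    proof -
      interpret T: subprob_space "transition P X t y" by (rule mp_subprob[OF t])
      show ?thesis by (rule T.emeasure_eq_measure)
    qed
    then show "ennreal (indicator C \<omega> * G \<omega>) =
        indicator C \<omega> * (case X s \<omega> of None \<Rightarrow> 0 | Some y \<Rightarrow> emeasure (transition P X t y) B)"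
      by (auto simp: G_def indicator_def split: option.split)
  qed
  finally show ?thesis by (simp add: A_def emeasure_eq_measure)
qed

lemma Chapman_Kolmogorov:
  assumes s: "0 \<le> s" and t: "0 \<le> t"
  shows "transition P X (s + t) x = transition P X s x \<bind> transition P X t"
proof (rule measure_eqI)
  have K: "transition P X t \<in> transition P X s x \<rightarrow>\<^sub>M subprob_algebra borel"
    using mp_kernel[OF t] by (simp add: transition_alive_law cong: measurable_cong_sets)
  show "sets (transition P X (s + t) x) = sets (transition P X s x \<bind> transition P X t)"
    by (subst sets_bind[OF sets_kernel[OF K]]) (auto simp: transition_alive_law)
  fix B assume "B \<in> sets (transition P X (s + t) x)"
  then have B: "B \<in> sets borel" by (simp add: transition_alive_law)
  have top: "space (P x) \<in> sets (past P X x s)" using sets.top[of "past P X x s"] by simp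
  have "emeasure (transition P X (s + t) x) B = emeasure (P x) {\<omega> \<in> space (P x). X (s + t) \<omega> \<in> Some ` B}"
    unfolding transition_alive_law using s t by (intro emeasure_alive_law[OF mp_measurable B]) simp
  also have "\<dots> = emeasure (P x) (space (P x) \<inter> {\<omega> \<in> space (P x). X (s + t) \<omega> \<in> Some ` B})"
    by (rule arg_cong2[where f=emeasure]) auto
  also have "\<dots> = (\<integral>\<^sup>+\<omega>. (case X s \<omega> of None \<Rightarrow> 0 | Some y \<Rightarrow> emeasure (transition P X t y) B) \<partial>P x)"
    unfolding mp_markov[OF s t B top] by (intro nn_integral_cong) simp
  also have "\<dots> = (\<integral>\<^sup>+y. emeasure (transition P X t y) B \<partial>transition P X s x)"
    unfolding transition_alive_law[of P X s x]
    by (rule nn_integral_alive_law[OF mp_measurable[OF s] mp_emeasure_measurable[OF t B], symmetric])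
  also have "\<dots> = emeasure (transition P X s x \<bind> transition P X t) B"
    by (rule emeasure_bind[OF _ K B, symmetric]) (simp add: transition_alive_law)
  finally show "emeasure (transition P X (s + t) x) B = emeasure (transition P X s x \<bind> transition P X t) B" .
qed

lemma symmetric_kernel_transition:
  assumes M: "sets M = sets borel" and sym: "m_symmetric M P X" and t: "0 \<le> t"
  shows "symmetric_kernel M (transition P X t)"
proof
  show "transition P X t \<in> M \<rightarrow>\<^sub>M subprob_algebra M"
    using mp_kernel[OF t] M by (simp cong: measurable_cong_sets subprob_algebra_cong)
  fix f g :: "'a \<Rightarrow> ennreal" assume "f \<in> borel_measurable M" "g \<in> borel_measurable M"
  then have "f \<in> borel_measurable borel" "g \<in> borel_measurable borel"
    using measurable_cong_sets[OF M refl] by blast+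
  then show "(\<integral>\<^sup>+x. (\<integral>\<^sup>+y. f y \<partial>transition P X t x) * g x \<partial>M) = (\<integral>\<^sup>+x. f x * (\<integral>\<^sup>+y. g y \<partial>transition P X t x) \<partial>M)"
    using sym t unfolding m_symmetric_def by blast
qed

end

section \<open>The independent coupling\<close>

lemma coupling_measurable:
  fixes X :: "real \<Rightarrow> 'v \<Rightarrow> 'a::second_countable_topology option"
    and Y :: "real \<Rightarrow> 'w \<Rightarrow> 'b::second_countable_topology option"
  assumes X: "X t \<in> N1 \<rightarrow>\<^sub>M cemetery_borel" and Y: "Y t \<in> N2 \<rightarrow>\<^sub>M cemetery_borel"
  shows "coupling_process X Y t \<in> N1 \<Otimes>\<^sub>M N2 \<rightarrow>\<^sub>M cemetery_borel"
proof -
  have Xm: "(\<lambda>\<omega>. X t (fst \<omega>)) \<in> N1 \<Otimes>\<^sub>M N2 \<rightarrow>\<^sub>M cemetery_borel"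
    and Ym: "(\<lambda>\<omega>. Y t (snd \<omega>)) \<in> N1 \<Otimes>\<^sub>M N2 \<rightarrow>\<^sub>M cemetery_borel"
    using measurable_compose[OF measurable_fst X] measurable_compose[OF measurable_snd Y] by auto
  have "(\<lambda>\<omega>. (the (X t (fst \<omega>)), the (Y t (snd \<omega>)))) \<in> N1 \<Otimes>\<^sub>M N2 \<rightarrow>\<^sub>M borel \<Otimes>\<^sub>M borel"
    by (intro measurable_Pair measurable_compose[OF Xm the_measurable] measurable_compose[OF Ym the_measurable])
  then have pair: "(\<lambda>\<omega>. Some (the (X t (fst \<omega>)), the (Y t (snd \<omega>)))) \<in> N1 \<Otimes>\<^sub>M N2 \<rightarrow>\<^sub>M cemetery_borel"
    unfolding borel_prod by (rule measurable_compose[OF _ Some_measurable])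
  have alive: "{\<omega> \<in> space (N1 \<Otimes>\<^sub>M N2). X t (fst \<omega>) \<noteq> None \<and> Y t (snd \<omega>) \<noteq> None} \<in> sets (N1 \<Otimes>\<^sub>M N2)"
    using sets.Int[OF alive_event'[OF Xm] alive_event'[OF Ym]] by (simp add: Collect_conj_eq[symmetric] Int_def conj_ac)
  have "(\<lambda>\<omega>. if X t (fst \<omega>) \<noteq> None \<and> Y t (snd \<omega>) \<noteq> None then Some (the (X t (fst \<omega>)), the (Y t (snd \<omega>))) else None)
      \<in> N1 \<Otimes>\<^sub>M N2 \<rightarrow>\<^sub>M cemetery_borel"
    by (rule measurable_If[OF pair _ alive]) simp
  moreover have "coupling_process X Y t = (\<lambda>\<omega>. if X t (fst \<omega>) \<noteq> None \<and> Y t (snd \<omega>) \<noteq> None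
      then Some (the (X t (fst \<omega>)), the (Y t (snd \<omega>))) else None)"
    by (auto simp: coupling_process_def fun_eq_iff split: option.split)
  ultimately show ?thesis by simp
qed

lemma coupling_mem_rectangle:
  "coupling_process X Y t \<omega> \<in> Some ` (A \<times> B) \<longleftrightarrow> X t (fst \<omega>) \<in> Some ` A \<and> Y t (snd \<omega>) \<in> Some ` B"
  by (auto simp: coupling_process_def split: option.split)

lemma subalgebra_pair:
  assumes "subalgebra P F" "subalgebra Q G"
  shows "subalgebra (P \<Otimes>\<^sub>M Q) (F \<Otimes>\<^sub>M G)"
proof -
  have sp: "space F \<times> space G = space (P \<Otimes>\<^sub>M Q)"
    using assms by (simp add: subalgebra_def space_pair_measure)
  have "sets (F \<Otimes>\<^sub>M G) \<subseteq> sets (P \<Otimes>\<^sub>M Q)"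
    unfolding sets_pair_measure[of F G] sp
    by (rule sets.sigma_sets_subset) (use assms in \<open>auto simp: subalgebra_def\<close>)
  then show ?thesis by (simp add: subalgebra_def sp[symmetric]) (simp add: space_pair_measure)
qed

text \<open>For a component of the coupling with past \<open>F\<close>, the Markov property reads
  \<open>restr_to_subalg (density P f) F = restr_to_subalg (density P f') F\<close>, where \<open>f\<close> is the indicator of
  a future event and \<open>f'\<close> its probability given the present. By this lemma two such
  identities can be multiplied.\<close>

lemma restr_to_subalg_density_pair:
  assumes P: "prob_space P" and Q: "prob_space Q" and F: "subalgebra P F" and G: "subalgebra Q G"
    and f: "f \<in> borel_measurable P" "\<And>\<omega>. f \<omega> \<le> (1::ennreal)" and g: "g \<in> borel_measurable Q" "\<And>\<omega>. g \<omega> \<le> (1::ennreal)"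
  shows "restr_to_subalg (density P f) F \<Otimes>\<^sub>M restr_to_subalg (density Q g) G =
    restr_to_subalg (density (P \<Otimes>\<^sub>M Q) (\<lambda>\<omega>. f (fst \<omega>) * g (snd \<omega>))) (F \<Otimes>\<^sub>M G)"
proof -
  interpret P: prob_space P by fact
  interpret Q: prob_space Q by fact
  interpret PQ: pair_sigma_finite P Q ..
  have F': "subalgebra (density P f) F" and G': "subalgebra (density Q g) G"
    using F G by (simp_all add: subalgebra_def)
  have FG: "subalgebra (P \<Otimes>\<^sub>M Q) (F \<Otimes>\<^sub>M G)" by (rule subalgebra_pair[OF F G])
  have FG': "subalgebra (density (P \<Otimes>\<^sub>M Q) (\<lambda>\<omega>. f (fst \<omega>) * g (snd \<omega>))) (F \<Otimes>\<^sub>M G)"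
    using FG by (simp add: subalgebra_def)
  have fm: "(\<lambda>\<omega>. f (fst \<omega>) * g (snd \<omega>)) \<in> borel_measurable (P \<Otimes>\<^sub>M Q)"
    by (intro borel_measurable_times_ennreal measurable_compose[OF measurable_fst f(1)] measurable_compose[OF measurable_snd g(1)])
  have fin: "finite_measure (restr_to_subalg (density R h) H)"
    if "prob_space R" "subalgebra R H" "h \<in> borel_measurable R" "\<And>\<omega>. h \<omega> \<le> (1::ennreal)" for R H and h :: "'x \<Rightarrow> ennreal"
  proof (rule finite_measure_restr_to_subalg)
    show "subalgebra (density R h) H" using that(2) by (simp add: subalgebra_def)
    have "emeasure (density R h) (space R) = (\<integral>\<^sup>+\<omega>. h \<omega> * indicator (space R) \<omega> \<partial>R)"
      by (rule emeasure_density[OF that(3)]) simp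
    also have "\<dots> \<le> (\<integral>\<^sup>+\<omega>. 1 \<partial>R)" by (intro nn_integral_mono) (auto simp: indicator_def that(4))
    also have "\<dots> = 1" using that(1) by (simp add: prob_space.emeasure_space_1)
    finally show "finite_measure (density R h)" by (intro finite_measureI) (auto simp: top_unique)
  qed
  show ?thesis
  proof (rule pair_measure_eqI)
    show "sigma_finite_measure (restr_to_subalg (density P f) F)"
      using fin[OF P F f] by (rule finite_measure.sigma_finite_measure)
    show "sigma_finite_measure (restr_to_subalg (density Q g) G)"
      using fin[OF Q G g] by (rule finite_measure.sigma_finite_measure)
    show "sets (restr_to_subalg (density P f) F \<Otimes>\<^sub>M restr_to_subalg (density Q g) G) =
        sets (restr_to_subalg (density (P \<Otimes>\<^sub>M Q) (\<lambda>\<omega>. f (fst \<omega>) * g (snd \<omega>))) (F \<Otimes>\<^sub>M G))"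
      unfolding sets_restr_to_subalg[OF FG']
      by (rule sets_pair_measure_cong) (rule sets_restr_to_subalg F' G')+
    fix A B assume "A \<in> sets (restr_to_subalg (density P f) F)" "B \<in> sets (restr_to_subalg (density Q g) G)"
    then have A: "A \<in> sets F" and B: "B \<in> sets G"
      by (simp_all add: sets_restr_to_subalg F' G')
    then have AB: "A \<in> sets P" "B \<in> sets Q" using F G by (auto simp: subalgebra_def)
    have "emeasure (restr_to_subalg (density (P \<Otimes>\<^sub>M Q) (\<lambda>\<omega>. f (fst \<omega>) * g (snd \<omega>))) (F \<Otimes>\<^sub>M G)) (A \<times> B)
        = emeasure (density (P \<Otimes>\<^sub>M Q) (\<lambda>\<omega>. f (fst \<omega>) * g (snd \<omega>))) (A \<times> B)"
      by (rule emeasure_restr_to_subalg[OF FG']) (use A B in auto)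
    also have "\<dots> = (\<integral>\<^sup>+\<omega>. f (fst \<omega>) * g (snd \<omega>) * indicator (A \<times> B) \<omega> \<partial>(P \<Otimes>\<^sub>M Q))"
      by (rule emeasure_density[OF fm]) (use AB in auto)
    also have "\<dots> = (\<integral>\<^sup>+\<omega>. (f (fst \<omega>) * indicator A (fst \<omega>)) * (g (snd \<omega>) * indicator B (snd \<omega>)) \<partial>(P \<Otimes>\<^sub>M Q))"
      by (intro nn_integral_cong) (auto simp: indicator_def)
    also have "\<dots> = (\<integral>\<^sup>+x. \<integral>\<^sup>+y. (f x * indicator A x) * (g y * indicator B y) \<partial>Q \<partial>P)"
      using f(1) g(1) AB
      by (subst Q.nn_integral_fst[symmetric])
        (auto intro!: borel_measurable_times_ennreal measurable_compose[OF measurable_fst]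
          measurable_compose[OF measurable_snd] borel_measurable_indicator)
    also have "\<dots> = (\<integral>\<^sup>+x. f x * indicator A x \<partial>P) * (\<integral>\<^sup>+y. g y * indicator B y \<partial>Q)"
      using f(1) g(1) AB
      by (simp add: nn_integral_cmult nn_integral_multc borel_measurable_times_ennreal)
    also have "\<dots> = emeasure (restr_to_subalg (density P f) F) A * emeasure (restr_to_subalg (density Q g) G) B"
      using f(1) g(1) AB by (simp add: emeasure_restr_to_subalg[OF F' A] emeasure_restr_to_subalg[OF G' B] emeasure_density)
    finally show "emeasure (restr_to_subalg (density P f) F) A * emeasure (restr_to_subalg (density Q g) G) B =
        emeasure (restr_to_subalg (density (P \<Otimes>\<^sub>M Q) (\<lambda>\<omega>. f (fst \<omega>) * g (snd \<omega>))) (F \<Otimes>\<^sub>M G)) (A \<times> B)" by simp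
  qed
qed

lemma borel_measure_eqI_rectangles:
  fixes \<mu> \<nu> :: "('a::second_countable_topology \<times> 'b::second_countable_topology) measure"
  assumes sets: "sets \<mu> = sets borel" "sets \<nu> = sets borel"
    and eq: "\<And>A B. A \<in> sets borel \<Longrightarrow> B \<in> sets borel \<Longrightarrow> emeasure \<mu> (A \<times> B) = emeasure \<nu> (A \<times> B)"
    and fin: "emeasure \<mu> UNIV \<noteq> \<infinity>"
  shows "\<mu> = \<nu>"
proof (rule measure_eqI_generator_eq[where \<Omega>=UNIV and A="\<lambda>_. UNIV"])
  let ?E = "{a \<times> b |a b. a \<in> sets (borel :: 'a measure) \<and> b \<in> sets (borel :: 'b measure)}"
  show "Int_stable ?E" by (rule Int_stable_pair_measure_generator)
  have "sets (borel :: ('a \<times> 'b) measure) = sigma_sets UNIV ?E"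
    unfolding borel_prod[symmetric] sets_pair_measure by simp
  then show "sets \<mu> = sigma_sets UNIV ?E" "sets \<nu> = sigma_sets UNIV ?E" using sets by auto
  have "(UNIV :: ('a \<times> 'b) set) \<in> ?E"
    by (rule CollectI, rule exI[of _ UNIV], rule exI[of _ UNIV]) simp
  then show "range (\<lambda>_. UNIV) \<subseteq> ?E" unfolding image_subset_iff by (intro ballI)
qed (use eq fin in auto)

context
  fixes P :: "'a::{metric_space,second_countable_topology} \<Rightarrow> 'v measure" and X :: "real \<Rightarrow> 'v \<Rightarrow> 'a option"
    and Q :: "'b::{metric_space,second_countable_topology} \<Rightarrow> 'w measure" and Y :: "real \<Rightarrow> 'w \<Rightarrow> 'b option"
  assumes MX: "markov_process P X" and MY: "markov_process Q Y"
begin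

lemma coupling_prob: "prob_space (coupling_law P Q z)"
  unfolding coupling_law_def by (rule prob_space_pair[OF mp_prob[OF MX] mp_prob[OF MY]])

lemma coupling_process_measurable:
  "0 \<le> t \<Longrightarrow> coupling_process X Y t \<in> coupling_law P Q z \<rightarrow>\<^sub>M cemetery_borel"
  unfolding coupling_law_def by (intro coupling_measurable mp_measurable[OF MX] mp_measurable[OF MY])

lemma transition_coupling:
  assumes t: "0 \<le> t"
  shows "transition (coupling_law P Q) (coupling_process X Y) t = prod_kernel (transition P X t) (transition Q Y t)"
proof
  fix z :: "'a \<times> 'b"
  obtain x y where z: "z = (x, y)" by (cases z)
  interpret P: prob_space "P x" by (rule mp_prob[OF MX])
  interpret Q: prob_space "Q y" by (rule mp_prob[OF MY])
  interpret TP: subprob_space "transition P X t x" by (rule mp_subprob[OF MX t])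
  interpret TQ: subprob_space "transition Q Y t y" by (rule mp_subprob[OF MY t])
  have "transition P X t x \<Otimes>\<^sub>M transition Q Y t y = alive_law (P x \<Otimes>\<^sub>M Q y) (coupling_process X Y t)"
  proof (rule pair_measure_eqI)
    show "sets (transition P X t x \<Otimes>\<^sub>M transition Q Y t y) = sets (alive_law (P x \<Otimes>\<^sub>M Q y) (coupling_process X Y t))"
      by (simp add: transition_alive_law borel_prod[symmetric] cong: sets_pair_measure_cong)
    fix A B assume "A \<in> sets (transition P X t x)" "B \<in> sets (transition Q Y t y)"
    then have A: "A \<in> sets borel" and B: "B \<in> sets borel" by (simp_all add: transition_alive_law)
    have "emeasure (alive_law (P x \<Otimes>\<^sub>M Q y) (coupling_process X Y t)) (A \<times> B) =
        emeasure (P x \<Otimes>\<^sub>M Q y) {\<omega> \<in> space (P x \<Otimes>\<^sub>M Q y). coupling_process X Y t \<omega> \<in> Some ` (A \<times> B)}"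
      using A B t
      by (intro emeasure_alive_law coupling_measurable mp_measurable[OF MX] mp_measurable[OF MY])
        (auto simp flip: borel_prod)
    also have "{\<omega> \<in> space (P x \<Otimes>\<^sub>M Q y). coupling_process X Y t \<omega> \<in> Some ` (A \<times> B)} =
        {\<omega> \<in> space (P x). X t \<omega> \<in> Some ` A} \<times> {\<omega> \<in> space (Q y). Y t \<omega> \<in> Some ` B}"
      by (auto simp: coupling_mem_rectangle space_pair_measure simp del: Some_image_sets)
    also have "emeasure (P x \<Otimes>\<^sub>M Q y) \<dots> = emeasure (transition P X t x) A * emeasure (transition Q Y t y) B"
      unfolding transition_alive_law emeasure_alive_law[OF mp_measurable[OF MX t] A]
        emeasure_alive_law[OF mp_measurable[OF MY t] B]
      by (intro Q.emeasure_pair_measure_Times alive_event[OF mp_measurable[OF MX t] A] alive_event[OF mp_measurable[OF MY t] B])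
    finally show "emeasure (transition P X t x) A * emeasure (transition Q Y t y) B =
        emeasure (alive_law (P x \<Otimes>\<^sub>M Q y) (coupling_process X Y t)) (A \<times> B)" by simp
  qed (auto intro: TP.sigma_finite_measure_axioms TQ.sigma_finite_measure_axioms)
  then show "transition (coupling_law P Q) (coupling_process X Y) t z = prod_kernel (transition P X t) (transition Q Y t) z"
    by (simp add: transition_alive_law[of "coupling_law P Q"] coupling_law_def prod_kernel_def z)
qed

lemma past_coupling_subset:
  assumes s: "0 \<le> s"
  shows "sets (past (coupling_law P Q) (coupling_process X Y) (x, y) s) \<subseteq> sets (past P X x s \<Otimes>\<^sub>M past Q Y y s)"
proof -
  have sp: "space (coupling_law P Q (x, y)) = space (past P X x s \<Otimes>\<^sub>M past Q Y y s)"
    by (simp add: coupling_law_def space_pair_measure )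
  have "sets (past (coupling_law P Q) (coupling_process X Y) (x, y) s) =
      sigma_sets (space (past P X x s \<Otimes>\<^sub>M past Q Y y s))
        (\<Union>r\<in>{0..s}. {coupling_process X Y r -` A \<inter> space (past P X x s \<Otimes>\<^sub>M past Q Y y s) |A. A \<in> sets cemetery_borel})"
    unfolding past_def sp[unfolded past_def] by (rule sets_measure_of) auto
  also have "\<dots> \<subseteq> sets (past P X x s \<Otimes>\<^sub>M past Q Y y s)"
  proof (intro sets.sigma_sets_subset subsetI)
    fix B assume "B \<in> (\<Union>r\<in>{0..s}. {coupling_process X Y r -` A \<inter> space (past P X x s \<Otimes>\<^sub>M past Q Y y s) |A. A \<in> sets cemetery_borel})"
    then obtain r A where r: "0 \<le> r" "r \<le> s" and A: "A \<in> sets cemetery_borel"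
      and B: "B = coupling_process X Y r -` A \<inter> space (past P X x s \<Otimes>\<^sub>M past Q Y y s)" by auto
    show "B \<in> sets (past P X x s \<Otimes>\<^sub>M past Q Y y s)"
      unfolding B
      by (rule measurable_sets[OF coupling_measurable[OF past_measurable[OF r] past_measurable[OF r]] A])
  qed
  finally show ?thesis .
qed

lemma coupling_past_product_sets:
  "C \<in> sets (past P X x s \<Otimes>\<^sub>M past Q Y y s) \<Longrightarrow> C \<in> sets (P x \<Otimes>\<^sub>M Q y)"
  using subalgebra_pair[OF past_subalgebra[OF MX, of x s] past_subalgebra[OF MY, of y s]]
  by (auto simp: subalgebra_def)

text \<open>The product of the Markov properties of the two components, as identities between measures
  on the product of the two pasts.\<close>

lemma coupling_markov_rectangle:
  assumes s: "0 \<le> s" and t: "0 \<le> t" and A: "A \<in> sets borel" and B: "B \<in> sets borel"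
    and C: "C \<in> sets (past P X x s \<Otimes>\<^sub>M past Q Y y s)"
  shows "emeasure (P x \<Otimes>\<^sub>M Q y) (C \<inter> {\<omega> \<in> space (P x \<Otimes>\<^sub>M Q y). coupling_process X Y (s + t) \<omega> \<in> Some ` (A \<times> B)}) =
    (\<integral>\<^sup>+\<omega>. indicator C \<omega> * (case coupling_process X Y s \<omega> of None \<Rightarrow> 0
       | Some z \<Rightarrow> emeasure (prod_kernel (transition P X t) (transition Q Y t) z) (A \<times> B)) \<partial>(P x \<Otimes>\<^sub>M Q y))"
proof -
  interpret P: prob_space "P x" by (rule mp_prob[OF MX])
  interpret Q: prob_space "Q y" by (rule mp_prob[OF MY])
  interpret PQ: pair_sigma_finite "P x" "Q y" ..
  have st: "0 \<le> s + t" using s t by simp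
  define a where "a = {\<omega> \<in> space (P x). X (s + t) \<omega> \<in> Some ` A}"
  define b where "b = {\<omega> \<in> space (Q y). Y (s + t) \<omega> \<in> Some ` B}"
  define f where "f \<omega> = (case X s \<omega> of None \<Rightarrow> 0 | Some y \<Rightarrow> emeasure (transition P X t y) A)" for \<omega>
  define g where "g \<omega> = (case Y s \<omega> of None \<Rightarrow> 0 | Some y \<Rightarrow> emeasure (transition Q Y t y) B)" for \<omega>
  have a: "a \<in> sets (P x)" unfolding a_def by (rule alive_event[OF mp_measurable[OF MX st] A])
  have b: "b \<in> sets (Q y)" unfolding b_def by (rule alive_event[OF mp_measurable[OF MY st] B])
  have f: "f \<in> borel_measurable (P x)" "\<And>\<omega>. f \<omega> \<le> 1"
    unfolding f_def
    using measurable_compose[OF mp_measurable[OF MX s] measurable_case_cemetery[OF mp_emeasure_measurable[OF MX t A]]]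
      subprob_space.subprob_emeasure_le_1[OF mp_subprob[OF MX t]] by (auto split: option.split)
  have g: "g \<in> borel_measurable (Q y)" "\<And>\<omega>. g \<omega> \<le> 1"
    unfolding g_def
    using measurable_compose[OF mp_measurable[OF MY s] measurable_case_cemetery[OF mp_emeasure_measurable[OF MY t B]]]
      subprob_space.subprob_emeasure_le_1[OF mp_subprob[OF MY t]] by (auto split: option.split)
  have ind: "indicator a \<in> borel_measurable (P x)" "\<And>\<omega>. indicator a \<omega> \<le> (1::ennreal)"
    "indicator b \<in> borel_measurable (Q y)" "\<And>\<omega>. indicator b \<omega> \<le> (1::ennreal)"
    using a b by (auto simp: indicator_def)
  let ?F = "past P X x s" and ?G = "past Q Y y s"
  have F: "subalgebra (P x) ?F" and G: "subalgebra (Q y) ?G"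
    by (rule past_subalgebra[OF MX], rule past_subalgebra[OF MY])
  have sub: "subalgebra (density (P x) h) ?F" "subalgebra (density (Q y) k) ?G" for h k
    using F G by (simp_all add: subalgebra_def)
  have 1: "restr_to_subalg (density (P x) (indicator a)) ?F = restr_to_subalg (density (P x) f) ?F"
  proof (rule measure_eqI)
    fix D assume "D \<in> sets (restr_to_subalg (density (P x) (indicator a)) ?F)"
    then have D: "D \<in> sets ?F" by (simp add: sets_restr_to_subalg[OF sub(1)])
    then have DP: "D \<in> sets (P x)" using F by (auto simp: subalgebra_def)
    show "emeasure (restr_to_subalg (density (P x) (indicator a)) ?F) D = emeasure (restr_to_subalg (density (P x) f) ?F) D"
      using mp_markov[OF MX s t A D] emeasure_restricted[OF a DP]
      by (simp add: emeasure_restr_to_subalg[OF sub(1) D] emeasure_density f(1) DP a_def f_def Int_commute mult.commute)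
  qed (simp add: sets_restr_to_subalg[OF sub(1)])
  have 2: "restr_to_subalg (density (Q y) (indicator b)) ?G = restr_to_subalg (density (Q y) g) ?G"
  proof (rule measure_eqI)
    fix D assume "D \<in> sets (restr_to_subalg (density (Q y) (indicator b)) ?G)"
    then have D: "D \<in> sets ?G" by (simp add: sets_restr_to_subalg[OF sub(2)])
    then have DP: "D \<in> sets (Q y)" using G by (auto simp: subalgebra_def)
    show "emeasure (restr_to_subalg (density (Q y) (indicator b)) ?G) D = emeasure (restr_to_subalg (density (Q y) g) ?G) D"
      using mp_markov[OF MY s t B D] emeasure_restricted[OF b DP]
      by (simp add: emeasure_restr_to_subalg[OF sub(2) D] emeasure_density g(1) DP b_def g_def Int_commute mult.commute)
  qed (simp add: sets_restr_to_subalg[OF sub(2)])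
  have eq: "restr_to_subalg (density (P x \<Otimes>\<^sub>M Q y) (\<lambda>\<omega>. indicator a (fst \<omega>) * indicator b (snd \<omega>))) (?F \<Otimes>\<^sub>M ?G) =
      restr_to_subalg (density (P x \<Otimes>\<^sub>M Q y) (\<lambda>\<omega>. f (fst \<omega>) * g (snd \<omega>))) (?F \<Otimes>\<^sub>M ?G)"
    using restr_to_subalg_density_pair[OF P.prob_space_axioms Q.prob_space_axioms F G ind]
      restr_to_subalg_density_pair[OF P.prob_space_axioms Q.prob_space_axioms F G f g] 1 2 by simp
  have FGsub: "sets (?F \<Otimes>\<^sub>M ?G) \<subseteq> sets (P x \<Otimes>\<^sub>M Q y)"
    using coupling_past_product_sets by blast
  then have FG: "subalgebra (density (P x \<Otimes>\<^sub>M Q y) h) (?F \<Otimes>\<^sub>M ?G)" for h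
    by (auto simp: subalgebra_def space_pair_measure )
  have CP: "C \<in> sets (P x \<Otimes>\<^sub>M Q y)" using C FGsub by blast
  have rect: "{\<omega> \<in> space (P x \<Otimes>\<^sub>M Q y). coupling_process X Y (s + t) \<omega> \<in> Some ` (A \<times> B)} = a \<times> b"
    by (auto simp: coupling_mem_rectangle space_pair_measure a_def b_def)
  have "emeasure (P x \<Otimes>\<^sub>M Q y) (C \<inter> (a \<times> b)) = (\<integral>\<^sup>+\<omega>. indicator a (fst \<omega>) * indicator b (snd \<omega>) * indicator C \<omega> \<partial>(P x \<Otimes>\<^sub>M Q y))"
  proof -
    have "(\<lambda>\<omega>. indicator a (fst \<omega>) * indicator b (snd \<omega>) * indicator C \<omega>) = (indicator (C \<inter> (a \<times> b)) :: _ \<Rightarrow> ennreal)"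
      by (auto simp: indicator_def fun_eq_iff)
    then show ?thesis using CP a b by simp
  qed
  also have "\<dots> = (\<integral>\<^sup>+\<omega>. f (fst \<omega>) * g (snd \<omega>) * indicator C \<omega> \<partial>(P x \<Otimes>\<^sub>M Q y))"
  proof -
    have m: "(\<lambda>\<omega>. indicator a (fst \<omega>) * indicator b (snd \<omega>) :: ennreal) \<in> borel_measurable (P x \<Otimes>\<^sub>M Q y)"
      "(\<lambda>\<omega>. f (fst \<omega>) * g (snd \<omega>)) \<in> borel_measurable (P x \<Otimes>\<^sub>M Q y)"
      by (intro borel_measurable_times_ennreal measurable_compose[OF measurable_fst ind(1)]
          measurable_compose[OF measurable_snd ind(3)] measurable_compose[OF measurable_fst f(1)]
          measurable_compose[OF measurable_snd g(1)])+
    show ?thesis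
      using arg_cong[OF eq, of "\<lambda>\<mu>. emeasure \<mu> C"]
      by (simp add: emeasure_restr_to_subalg[OF FG C] emeasure_density m CP)
  qed
  also have "\<dots> = (\<integral>\<^sup>+\<omega>. indicator C \<omega> * (case coupling_process X Y s \<omega> of None \<Rightarrow> 0
       | Some z \<Rightarrow> emeasure (prod_kernel (transition P X t) (transition Q Y t) z) (A \<times> B)) \<partial>(P x \<Otimes>\<^sub>M Q y))"
  proof (rule nn_integral_cong)
    fix \<omega>
    have "emeasure (prod_kernel (transition P X t) (transition Q Y t) (x', y')) (A \<times> B) =
        emeasure (transition P X t x') A * emeasure (transition Q Y t y') B" for x' y'
    proof -
      interpret T: subprob_space "transition Q Y t y'" by (rule mp_subprob[OF MY t])
      show ?thesis unfolding prod_kernel_def fst_conv snd_conv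
        by (rule T.emeasure_pair_measure_Times) (use A B in \<open>simp_all add: transition_alive_law\<close>)
    qed
    then show "f (fst \<omega>) * g (snd \<omega>) * indicator C \<omega> = indicator C \<omega> * (case coupling_process X Y s \<omega> of None \<Rightarrow> 0
       | Some z \<Rightarrow> emeasure (prod_kernel (transition P X t) (transition Q Y t) z) (A \<times> B))"
      by (auto simp: f_def g_def coupling_process_def indicator_def split: option.split)
  qed
  finally show ?thesis unfolding rect .
qed

text \<open>For a fixed event of the past both sides are finite measures in the target set \<open>B\<close>, and these are
  determined by their values on rectangles.\<close>

lemma coupling_markov:
  assumes s: "0 \<le> s" and t: "0 \<le> t" and B: "B \<in> sets borel"
    and C: "C \<in> sets (past P X x s \<Otimes>\<^sub>M past Q Y y s)"
  shows "emeasure (P x \<Otimes>\<^sub>M Q y) (C \<inter> {\<omega> \<in> space (P x \<Otimes>\<^sub>M Q y). coupling_process X Y (s + t) \<omega> \<in> Some ` B}) =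
    (\<integral>\<^sup>+\<omega>. indicator C \<omega> * (case coupling_process X Y s \<omega> of None \<Rightarrow> 0
       | Some z \<Rightarrow> emeasure (transition (coupling_law P Q) (coupling_process X Y) t z) B) \<partial>(P x \<Otimes>\<^sub>M Q y))"
proof -
  let ?Z = "coupling_process X Y" and ?K = "prod_kernel (transition P X t) (transition Q Y t)"
  let ?N = "density (P x \<Otimes>\<^sub>M Q y) (indicator C)"
  interpret PQ: prob_space "P x \<Otimes>\<^sub>M Q y" by (rule prob_space_pair[OF mp_prob[OF MX] mp_prob[OF MY]])
  have st: "0 \<le> s + t" using s t by simp
  have CP: "C \<in> sets (P x \<Otimes>\<^sub>M Q y)" by (rule coupling_past_product_sets[OF C])
  have Zm: "?Z r \<in> P x \<Otimes>\<^sub>M Q y \<rightarrow>\<^sub>M cemetery_borel" if "0 \<le> r" for r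
    using coupling_process_measurable[OF that, of "(x, y)"] by (simp add: coupling_law_def)
  have ZN: "?Z r \<in> ?N \<rightarrow>\<^sub>M cemetery_borel" if "0 \<le> r" for r
    using Zm[OF that] by simp
  have K: "?K \<in> borel \<rightarrow>\<^sub>M subprob_algebra borel"
    unfolding prod_kernel_def[abs_def] borel_prod[symmetric]
    by (intro measurable_pair_measure measurable_compose[OF measurable_fst mp_kernel[OF MX t]]
        measurable_compose[OF measurable_snd mp_kernel[OF MY t]])
  have K': "?K \<in> alive_law ?N (?Z s) \<rightarrow>\<^sub>M subprob_algebra borel"
    using K by (simp cong: measurable_cong_sets)
  have law: "emeasure (alive_law ?N (?Z (s + t))) D = emeasure (P x \<Otimes>\<^sub>M Q y) (C \<inter> {\<omega> \<in> space (P x \<Otimes>\<^sub>M Q y). ?Z (s + t) \<omega> \<in> Some ` D})"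
    if D: "D \<in> sets borel" for D
    using emeasure_alive_law[OF ZN[OF st] D] emeasure_restricted[OF CP alive_event[OF Zm[OF st] D]] by simp
  have bind: "emeasure (alive_law ?N (?Z s) \<bind> ?K) D =
      (\<integral>\<^sup>+\<omega>. indicator C \<omega> * (case ?Z s \<omega> of None \<Rightarrow> 0 | Some z \<Rightarrow> emeasure (?K z) D) \<partial>(P x \<Otimes>\<^sub>M Q y))"
    if D: "D \<in> sets borel" for D
  proof -
    have m: "(\<lambda>z. emeasure (?K z) D) \<in> borel_measurable borel" by (rule measurable_emeasure_kernel[OF K D])
    have "emeasure (alive_law ?N (?Z s) \<bind> ?K) D = (\<integral>\<^sup>+z. emeasure (?K z) D \<partial>alive_law ?N (?Z s))"
      by (rule emeasure_bind[OF _ K' D]) simp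
    also have "\<dots> = (\<integral>\<^sup>+\<omega>. (case ?Z s \<omega> of None \<Rightarrow> 0 | Some z \<Rightarrow> emeasure (?K z) D) \<partial>?N)"
      by (rule nn_integral_alive_law[OF ZN[OF s] m])
    also have "\<dots> = (\<integral>\<^sup>+\<omega>. indicator C \<omega> * (case ?Z s \<omega> of None \<Rightarrow> 0 | Some z \<Rightarrow> emeasure (?K z) D) \<partial>(P x \<Otimes>\<^sub>M Q y))"
      by (rule nn_integral_density) (use CP measurable_compose[OF Zm[OF s] measurable_case_cemetery[OF m]] in auto)
    finally show ?thesis .
  qed
  have "alive_law ?N (?Z (s + t)) = alive_law ?N (?Z s) \<bind> ?K"
  proof (rule borel_measure_eqI_rectangles)
    show "sets (alive_law ?N (?Z s) \<bind> ?K) = sets borel"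
      by (rule sets_bind[OF sets_kernel[OF K']]) auto
    fix A :: "'a set" and B :: "'b set" assume A: "A \<in> sets borel" and B: "B \<in> sets borel"
    have AB: "A \<times> B \<in> sets borel" unfolding borel_prod[symmetric] using A B by simp
    show "emeasure (alive_law ?N (?Z (s + t))) (A \<times> B) = emeasure (alive_law ?N (?Z s) \<bind> ?K) (A \<times> B)"
      unfolding law[OF AB] bind[OF AB] by (rule coupling_markov_rectangle[OF s t A B C])
  next
    have "emeasure (alive_law ?N (?Z (s + t))) UNIV \<le> 1"
      unfolding law[OF borel_open[OF open_UNIV]] by (rule PQ.emeasure_le_1)
    then show "emeasure (alive_law ?N (?Z (s + t))) UNIV \<noteq> \<infinity>" by (auto simp: top_unique)
  qed simp
  then show ?thesis unfolding transition_coupling[OF t] using law[OF B] bind[OF B] by simp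
qed

end

lemma real_cond_exp_indicator_eqI:
  assumes N: "prob_space N" and F: "subalgebra N F" and A: "A \<in> sets N"
    and G: "G \<in> borel_measurable F" "\<And>\<omega>. 0 \<le> G \<omega>" "\<And>\<omega>. G \<omega> \<le> 1"
    and eq: "\<And>C. C \<in> sets F \<Longrightarrow> emeasure N (C \<inter> A) = (\<integral>\<^sup>+\<omega>. indicator C \<omega> * ennreal (G \<omega>) \<partial>N)"
  shows "AE \<omega> in N. real_cond_exp N F (indicator A) \<omega> = G \<omega>"
proof -
  interpret N: prob_space N by fact
  have "finite_measure_subalgebra N F" by unfold_locales (rule F)
  then interpret F: sigma_finite_subalgebra N F by (rule finite_measure_subalgebra_is_sigma_finite)
  have Gm: "G \<in> borel_measurable N" by (rule measurable_from_subalg[OF F G(1)])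
  show ?thesis
  proof (rule F.real_cond_exp_charact)
    fix C assume C: "C \<in> sets F"
    then have CN: "C \<in> sets N" using F by (auto simp: subalgebra_def)
    have GI: "integrable N (\<lambda>\<omega>. indicator C \<omega> * G \<omega>)"
      by (rule N.integrable_const_bound[of _ 1]) (use G CN Gm in \<open>auto simp: indicator_def\<close>)
    have "ennreal (LINT \<omega>|N. indicator C \<omega> * G \<omega>) = (\<integral>\<^sup>+\<omega>. ennreal (indicator C \<omega> * G \<omega>) \<partial>N)"
      by (rule nn_integral_eq_integral[OF GI, symmetric]) (use G in auto)
    also have "\<dots> = (\<integral>\<^sup>+\<omega>. indicator C \<omega> * ennreal (G \<omega>) \<partial>N)"
      by (intro nn_integral_cong) (auto simp: indicator_def)
    also have "\<dots> = ennreal (measure N (C \<inter> A))"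
      by (simp add: eq[OF C, symmetric] N.emeasure_eq_measure)
    finally have "(LINT \<omega>|N. indicator C \<omega> * G \<omega>) = measure N (C \<inter> A)"
      by (subst (asm) ennreal_inj) (use G in \<open>auto intro!: integral_nonneg_AE AE_I2\<close>)
    then show "(LINT \<omega>:C|N. indicator A \<omega>) = (LINT \<omega>:C|N. G \<omega>)"
      using A CN by (simp add: set_lebesgue_integral_def flip: indicator_inter_arith)
  next
    show "integrable N (indicat_real A)"
      by (rule integrable_real_indicator) (use A in \<open>auto simp: less_top[symmetric]\<close>)
    show "integrable N G"
      by (rule N.integrable_const_bound[of _ 1]) (use G Gm in auto)
  qed (rule G(1))
qed

context
  fixes P :: "'a::{metric_space,second_countable_topology} \<Rightarrow> 'v measure" and X :: "real \<Rightarrow> 'v \<Rightarrow> 'a option"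
    and Q :: "'b::{metric_space,second_countable_topology} \<Rightarrow> 'w measure" and Y :: "real \<Rightarrow> 'w \<Rightarrow> 'b option"
  assumes MX: "markov_process P X" and MY: "markov_process Q Y"
begin

lemma coupling_kernel:
  assumes t: "0 \<le> t"
  shows "transition (coupling_law P Q) (coupling_process X Y) t \<in> borel \<rightarrow>\<^sub>M subprob_algebra borel"
  unfolding transition_coupling[OF MX MY t] prod_kernel_def[abs_def] borel_prod[symmetric]
  by (intro measurable_pair_measure measurable_compose[OF measurable_fst mp_kernel[OF MX t]]
      measurable_compose[OF measurable_snd mp_kernel[OF MY t]])

lemma markov_process_coupling: "markov_process (coupling_law P Q) (coupling_process X Y)"
  unfolding markov_process_def
proof (intro conjI allI impI ballI)
  let ?P = "coupling_law P Q" and ?Z = "coupling_process X Y"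
  fix z z' :: "'a \<times> 'b" and s t :: real and B :: "('a \<times> 'b) set"
  obtain x y where z: "z = (x, y)" by (cases z)
  interpret P: prob_space "P x" by (rule mp_prob[OF MX])
  interpret Q: prob_space "Q y" by (rule mp_prob[OF MY])
  interpret Pz: prob_space "?P z" by (rule coupling_prob[OF MX MY])
  have Pz_eq: "?P z = P x \<Otimes>\<^sub>M Q y" by (simp add: coupling_law_def z)
  show "prob_space (?P z)" by (rule Pz.prob_space_axioms)
  show "sets (?P z) = sets (?P z')"
    unfolding coupling_law_def
    by (rule sets_pair_measure_cong) (rule mp_sets[OF MX], rule mp_sets[OF MY])
  show "AE \<omega> in ?P z. ?Z 0 \<omega> = Some z"
  proof -
    let ?a = "{\<omega> \<in> space (P x). X 0 \<omega> \<in> Some ` {x}}" and ?b = "{\<omega> \<in> space (Q y). Y 0 \<omega> \<in> Some ` {y}}"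
    have ab: "?a \<in> sets (P x)" "?b \<in> sets (Q y)"
      by (intro alive_event mp_measurable[OF MX] mp_measurable[OF MY]; simp)+
    have "emeasure (P x) ?a = 1" "emeasure (Q y) ?b = 1"
      using mp_start[OF MX, of x] mp_start[OF MY, of y] ab
      by (auto intro!: P.emeasure_eq_1_AE Q.emeasure_eq_1_AE elim!: AE_mp intro: AE_I2)
    then have "emeasure (P x \<Otimes>\<^sub>M Q y) (?a \<times> ?b) = 1"
      using Q.emeasure_pair_measure_Times[OF ab] by simp
    then have "Pz.prob (?a \<times> ?b) = 1" by (simp add: measure_def Pz_eq)
    then have "AE \<omega> in ?P z. \<omega> \<in> ?a \<times> ?b" by (rule Pz.AE_prob_1)
    then show ?thesis by (rule AE_mp, intro AE_I2) (auto simp: coupling_process_def z)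
  qed
  assume t: "0 \<le> t"
  show "?Z t \<in> ?P z \<rightarrow>\<^sub>M cemetery_borel" by (rule coupling_process_measurable[OF MX MY t])
  assume B: "B \<in> sets borel"
  have Km: "(\<lambda>x. measure (transition ?P ?Z t x) B) \<in> borel_measurable borel"
    by (rule measurable_compose[OF coupling_kernel[OF t] measurable_measure_subprob_algebra[OF B]])
  show "(\<lambda>x. measure (transition ?P ?Z t x) B) \<in> borel_measurable borel" by (rule Km)
  assume s: "0 \<le> s"
  have K: "subprob_space (transition ?P ?Z t w)" for w
    using measurable_space[OF coupling_kernel[OF t], of w] by (simp add: space_subprob_algebra)
  have past: "subalgebra (?P z) (past ?P ?Z z s)"
    using past_coupling_subset[OF MX MY s, of x y] coupling_past_product_sets[OF MX MY, of _ x s y]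
    unfolding subalgebra_def space_past z coupling_law_def fst_conv snd_conv by blast
  show "AE \<omega> in ?P z. real_cond_exp (?P z) (past ?P ?Z z s)
      (indicator {\<omega> \<in> space (?P z). ?Z (s + t) \<omega> \<in> Some ` B}) \<omega> =
      (case ?Z s \<omega> of None \<Rightarrow> 0 | Some y \<Rightarrow> measure (transition ?P ?Z t y) B)"
  proof (rule real_cond_exp_indicator_eqI[OF Pz.prob_space_axioms past])
    show "{\<omega> \<in> space (?P z). ?Z (s + t) \<omega> \<in> Some ` B} \<in> sets (?P z)"
      using s t by (intro alive_event coupling_process_measurable[OF MX MY] B) simp
    show "(\<lambda>\<omega>. case ?Z s \<omega> of None \<Rightarrow> 0 | Some y \<Rightarrow> measure (transition ?P ?Z t y) B) \<in> borel_measurable (past ?P ?Z z s)"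
      by (rule measurable_compose[OF past_measurable[OF s order_refl] measurable_case_cemetery[OF Km]])
    fix \<omega>
    show "0 \<le> (case ?Z s \<omega> of None \<Rightarrow> 0 | Some y \<Rightarrow> measure (transition ?P ?Z t y) B)"
      "(case ?Z s \<omega> of None \<Rightarrow> 0 | Some y \<Rightarrow> measure (transition ?P ?Z t y) B) \<le> 1"
      using subprob_space.subprob_measure_le_1[OF K] by (auto split: option.split)
  next
    fix C assume "C \<in> sets (past ?P ?Z z s)"
    then have C: "C \<in> sets (past P X x s \<Otimes>\<^sub>M past Q Y y s)"
      using past_coupling_subset[OF MX MY s] z by blast
    have "ennreal (case ?Z s \<omega> of None \<Rightarrow> 0 | Some y \<Rightarrow> measure (transition ?P ?Z t y) B) =
        (case ?Z s \<omega> of None \<Rightarrow> 0 | Some y \<Rightarrow> emeasure (transition ?P ?Z t y) B)" for \<omega>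
      using finite_measure.emeasure_eq_measure[OF subprob_space.axioms(1)[OF K]]
      by (auto split: option.split)
    then show "emeasure (?P z) (C \<inter> {\<omega> \<in> space (?P z). ?Z (s + t) \<omega> \<in> Some ` B}) =
        (\<integral>\<^sup>+\<omega>. indicator C \<omega> * ennreal (case ?Z s \<omega> of None \<Rightarrow> 0 | Some y \<Rightarrow> measure (transition ?P ?Z t y) B) \<partial>?P z)"
      unfolding Pz_eq by (simp only: coupling_markov[OF MX MY s t B C])
  qed
qed

lemma m_symmetric_coupling:
  assumes sets: "sets MX = sets borel" "sets MY = sets borel"
    and sf: "sigma_finite_measure MX" "sigma_finite_measure MY"
    and sym: "m_symmetric MX P X" "m_symmetric MY Q Y"
  shows "m_symmetric (MX \<Otimes>\<^sub>M MY) (coupling_law P Q) (coupling_process X Y)"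
  unfolding m_symmetric_def
proof (intro allI impI ballI)
  fix t :: real and f g :: "'a \<times> 'b \<Rightarrow> ennreal"
  assume t: "0 \<le> t" and fg: "f \<in> borel_measurable borel" "g \<in> borel_measurable borel"
  interpret p: symmetric_kernel MX "transition P X t" by (rule symmetric_kernel_transition[OF MX sets(1) sym(1) t])
  interpret q: symmetric_kernel MY "transition Q Y t" by (rule symmetric_kernel_transition[OF MY sets(2) sym(2) t])
  interpret MX: sigma_finite_measure MX by fact
  interpret MY: sigma_finite_measure MY by fact
  interpret pq: symmetric_kernel_pair MX "transition P X t" MY "transition Q Y t" ..
  interpret pq': symmetric_kernel "MX \<Otimes>\<^sub>M MY" "prod_kernel (transition P X t) (transition Q Y t)"
    by (rule pq.symmetric_kernel_prod)
  have s: "sets (MX \<Otimes>\<^sub>M MY) = sets borel"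
    using sets_pair_measure_cong[OF sets] by (simp only: borel_prod)
  have "f \<in> borel_measurable (MX \<Otimes>\<^sub>M MY)" "g \<in> borel_measurable (MX \<Otimes>\<^sub>M MY)"
    using fg measurable_cong_sets[OF s refl] by blast+
  then show "(\<integral>\<^sup>+x. (\<integral>\<^sup>+y. f y \<partial>transition (coupling_law P Q) (coupling_process X Y) t x) * g x \<partial>(MX \<Otimes>\<^sub>M MY)) =
      (\<integral>\<^sup>+x. f x * (\<integral>\<^sup>+y. g y \<partial>transition (coupling_law P Q) (coupling_process X Y) t x) \<partial>(MX \<Otimes>\<^sub>M MY))"
    unfolding transition_coupling[OF MX MY t] by (rule pq'.kernel_sym)
qed

end

section \<open>Semigroups acting on one variable\<close>

locale symmetric_kernel_semigroup = sigma_finite_measure M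
  for M :: "'a measure" +
  fixes p :: "real \<Rightarrow> 'a \<Rightarrow> 'a measure"
  assumes symmetric: "0 < t \<Longrightarrow> symmetric_kernel M (p t)"
    and bind: "0 < s \<Longrightarrow> 0 < t \<Longrightarrow> x \<in> space M \<Longrightarrow> p (s + t) x = p s x \<bind> p t"
    and semigroup: "L2_semigroup M (\<lambda>t. kernel_op (p t))"

lemma L2_inner_cong:
  "(\<And>x. x \<in> space M \<Longrightarrow> u x = u' x) \<Longrightarrow> (\<And>x. x \<in> space M \<Longrightarrow> v x = v' x) \<Longrightarrow> L2_inner M u v = L2_inner M u' v'"
  unfolding L2_inner_def by (rule Bochner_Integration.integral_cong) auto

text \<open>The kernels act on the second variable of \<open>N \<Otimes>\<^sub>M M\<close>; the first one is a parameter.\<close>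

locale kernel_sections = K: symmetric_kernel_semigroup M p + N: sigma_finite_measure N
  for M :: "'a measure" and p and N :: "'c measure"
begin

sublocale pair_sigma_finite N M ..

abbreviation lift :: "real \<Rightarrow> ('c \<times> 'a \<Rightarrow> real) \<Rightarrow> 'c \<times> 'a \<Rightarrow> real" where
  "lift t \<equiv> kernel_op (prod_kernel (return N) (p t))"

abbreviation sec :: "('c \<times> 'a \<Rightarrow> real) \<Rightarrow> 'c \<Rightarrow> 'a \<Rightarrow> real" where
  "sec w y \<equiv> (\<lambda>x. w (y, x))"

lemma sec_measurable: "w \<in> borel_measurable (N \<Otimes>\<^sub>M M) \<Longrightarrow> y \<in> space N \<Longrightarrow> sec w y \<in> borel_measurable M"
  by (rule measurable_compose[OF measurable_Pair1'])

lemma sec_L2_sets: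
  assumes w[measurable]: "w \<in> borel_measurable (N \<Otimes>\<^sub>M M)"
  shows "{y \<in> space N. sec w y \<in> L2 M} \<in> sets N"
proof -
  have "{y \<in> space N. sec w y \<in> L2 M} = {y \<in> space N. (\<integral>\<^sup>+x. ennreal ((w (y, x))\<^sup>2) \<partial>M) < \<infinity>}"
    by (auto simp: L2_iff_nn_integral intro: sec_measurable[OF w])
  also have "\<dots> \<in> sets N" by measurable
  finally show ?thesis .
qed

lemma sec_L2_AE:
  assumes "w \<in> L2 (N \<Otimes>\<^sub>M M)"
  shows "AE y in N. sec w y \<in> L2 M"
proof -
  have [measurable]: "w \<in> borel_measurable (N \<Otimes>\<^sub>M M)" using assms by (rule L2_measurable)
  have "(\<integral>\<^sup>+y. (\<integral>\<^sup>+x. ennreal ((w (y, x))\<^sup>2) \<partial>M) \<partial>N) = (\<integral>\<^sup>+z. ennreal ((w z)\<^sup>2) \<partial>(N \<Otimes>\<^sub>M M))"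
    by (rule K.nn_integral_fst) measurable
  also have "\<dots> < \<infinity>" using assms by (simp add: L2_iff_nn_integral)
  finally have "AE y in N. (\<integral>\<^sup>+x. ennreal ((w (y, x))\<^sup>2) \<partial>M) \<noteq> \<infinity>"
    by (intro nn_integral_PInf_AE) auto
  then show ?thesis
    by (rule AE_mp, intro AE_I2 impI) (auto simp: L2_iff_nn_integral less_top[symmetric])
qed

lemma L2_inner_sec:
  assumes "u \<in> L2 (N \<Otimes>\<^sub>M M)" "v \<in> L2 (N \<Otimes>\<^sub>M M)"
  shows "integrable N (\<lambda>y. L2_inner M (sec u y) (sec v y))"
    and "L2_inner (N \<Otimes>\<^sub>M M) u v = (LINT y|N. L2_inner M (sec u y) (sec v y))"
  using integrable_fst'[OF L2_mult_integrable[OF assms]] integral_fst'[OF L2_mult_integrable[OF assms]]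
  by (simp_all add: L2_inner_def)

lemma lift_sec:
  assumes "0 < t" "w \<in> borel_measurable (N \<Otimes>\<^sub>M M)" "y \<in> space N" "x \<in> space M"
  shows "lift t w (y, x) = kernel_op (p t) (sec w y) x"
  by (rule kernel_op_prod_return_left[OF K.symmetric assms(2,3,4)]) (rule assms(1))

lemma symmetric_kernel_lift:
  assumes "0 < t"
  shows "symmetric_kernel (N \<Otimes>\<^sub>M M) (prod_kernel (return N) (p t))"
proof -
  interpret r: symmetric_kernel N "return N" by (rule symmetric_kernel_return)
  interpret p: symmetric_kernel M "p t" by (rule K.symmetric[OF assms])
  interpret symmetric_kernel_pair N "return N" M "p t" ..
  show ?thesis by (rule symmetric_kernel_prod)
qed

text \<open>The squared distance is the integral over the parameter of the squared distances of the sections,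
  which tend to 0 and are at most four times the squared norm of the section.\<close>

lemma lift_tendsto:
  assumes w: "w \<in> L2 (N \<Otimes>\<^sub>M M)"
  shows "((\<lambda>t. L2_norm (N \<Otimes>\<^sub>M M) (\<lambda>z. lift t w z - w z)) \<longlongrightarrow> 0) (at_right 0)"
proof -
  have wm: "w \<in> borel_measurable (N \<Otimes>\<^sub>M M)" using w by (rule L2_measurable)
  let ?T = "\<lambda>t. kernel_op (p t)"
  define D where "D t y = L2_inner M (\<lambda>x. ?T t (sec w y) x - sec w y x) (\<lambda>x. ?T t (sec w y) x - sec w y x)" for t y
  have lw: "lift t w \<in> L2 (N \<Otimes>\<^sub>M M)" if "0 < t" for t
    by (rule symmetric_kernel.kernel_op_L2(1)[OF symmetric_kernel_lift[OF that] w])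
  have d: "(\<lambda>z. lift t w z - w z) \<in> L2 (N \<Otimes>\<^sub>M M)" if "0 < t" for t
    by (rule L2_diff[OF lw[OF that] w])
  have D_sec: "L2_inner M (sec (\<lambda>z. lift t w z - w z) y) (sec (\<lambda>z. lift t w z - w z) y) = D t y"
    if "0 < t" "y \<in> space N" for t y
    unfolding D_def by (rule L2_inner_cong) (simp_all add: lift_sec[OF that(1) wm that(2)])
  have norm: "L2_inner (N \<Otimes>\<^sub>M M) (\<lambda>z. lift t w z - w z) (\<lambda>z. lift t w z - w z) = (LINT y|N. D t y)"
    if t: "0 < t" for t
    unfolding L2_inner_sec(2)[OF d[OF t] d[OF t]] by (rule Bochner_Integration.integral_cong) (simp_all add: D_sec[OF t])
  have Dm: "D t \<in> borel_measurable N" if t: "0 < t" for t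
  proof -
    have "integrable N (D t)"
      using L2_inner_sec(1)[OF d[OF t] d[OF t]] D_sec[OF t] by (simp cong: Bochner_Integration.integrable_cong)
    then show ?thesis by simp
  qed
  have bound: "D t y \<le> 4 * L2_inner M (sec w y) (sec w y)" if t: "0 < t" and y: "sec w y \<in> L2 M" for t y
  proof -
    note L = symmetric_form_L2[of M]
    have T: "?T t (sec w y) \<in> L2 M" by (rule sg_L2[OF K.semigroup t y])
    have "D t y \<le> 2 * L2_inner M (?T t (sec w y)) (?T t (sec w y)) + 2 * L2_inner M (sec w y) (sec w y)"
      using form_add_le[OF L T form_scale_mem[OF L y, of "-1"]] form_expand_scale[OF L y, of "-1"]
      by (simp add: D_def)
    then show ?thesis using sg_square_le[OF K.semigroup t y] by simp
  qed
  have D0: "0 \<le> D t y" if "0 < t" "sec w y \<in> L2 M" for t y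
    unfolding D_def by (rule form_nonneg[OF symmetric_form_L2 L2_diff[OF sg_L2[OF K.semigroup that] that(2)]])
  have "((\<lambda>t. LINT y|N. D t y) \<longlongrightarrow> 0) (at_right 0)"
    unfolding tendsto_at_iff_sequentially
  proof (intro allI impI)
    fix t :: "nat \<Rightarrow> real" assume t: "\<forall>i. t i \<in> {0<..} - {0}" and lim: "t \<longlonglongrightarrow> 0"
    have tp: "0 < t i" for i using t by auto
    have tr: "filterlim t (at_right 0) sequentially"
      unfolding filterlim_at using lim tp by (auto intro!: always_eventually simp: less_imp_neq[symmetric])
    have "(\<lambda>i. LINT y|N. D (t i) y) \<longlonglongrightarrow> (LINT y|N. 0)"
    proof (rule integral_dominated_convergence[where w="\<lambda>y. 4 * L2_inner M (sec w y) (sec w y)"])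
      show "integrable N (\<lambda>y. 4 * L2_inner M (sec w y) (sec w y))"
        using L2_inner_sec(1)[OF w w] by simp
      show "AE y in N. (\<lambda>i. D (t i) y) \<longlonglongrightarrow> 0"
        using sec_L2_AE[OF w]
      proof eventually_elim
        case (elim y)
        have "((\<lambda>s. (L2_norm M (\<lambda>x. ?T s (sec w y) x - sec w y x))\<^sup>2) \<longlongrightarrow> 0\<^sup>2) (at_right 0)"
          by (intro tendsto_intros sg_tendsto[OF K.semigroup elim])
        from filterlim_compose[OF this tr] show ?case
          using L2_norm_square[OF L2_diff[OF sg_L2[OF K.semigroup tp elim] elim]] by (simp add: D_def)
      qed
      show "AE y in N. norm (D (t i) y) \<le> 4 * L2_inner M (sec w y) (sec w y)" for i
        using sec_L2_AE[OF w] by eventually_elim (use D0[OF tp] bound[OF tp] in auto)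
    qed (use Dm[OF tp] in auto)
    then show "((\<lambda>t. LINT y|N. D t y) \<circ> t) \<longlonglongrightarrow> 0" by (simp add: comp_def)
  qed
  then have "((\<lambda>t. sqrt (LINT y|N. D t y)) \<longlongrightarrow> sqrt 0) (at_right 0)" by (rule tendsto_real_sqrt)
  then have lim: "((\<lambda>t. sqrt (LINT y|N. D t y)) \<longlongrightarrow> 0) (at_right 0)" by simp
  show ?thesis
    by (rule Lim_transform_eventually[OF lim])
      (auto simp: eventually_at_right_field L2_norm_def norm intro!: exI[of _ 1])
qed

lemma L2_semigroup_lift: "L2_semigroup (N \<Otimes>\<^sub>M M) lift"
proof (rule L2_semigroup_kernel[OF symmetric_kernel_lift])
  fix s t :: real and z assume s: "0 < s" and t: "0 < t" and z: "z \<in> space (N \<Otimes>\<^sub>M M)"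
  then have z': "fst z \<in> space N" "snd z \<in> space M" by (auto simp: space_pair_measure)
  have "prod_kernel (return N) (p s) z \<bind> prod_kernel (return N) (p t) =
      prod_kernel (\<lambda>x. return N x \<bind> return N) (\<lambda>y. p s y \<bind> p t) z"
    by (rule bind_prod_kernel[OF symmetric_kernel_return symmetric_kernel_return K.symmetric[OF s]
          K.symmetric[OF t] N.sigma_finite_measure_axioms K.sigma_finite_measure_axioms z])
  also have "\<dots> = prod_kernel (return N) (p (s + t)) z"
    unfolding prod_kernel_def using z' K.bind[OF s t z'(2)] bind_return[OF return_measurable z'(1)] by simp
  finally show "prod_kernel (return N) (p (s + t)) z = prod_kernel (return N) (p s) z \<bind> prod_kernel (return N) (p t)" ..
qed (assumption, rule lift_tendsto)

lemma sg_energy_lift: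
  assumes t: "0 < t" and w: "w \<in> L2 (N \<Otimes>\<^sub>M M)"
  shows "integrable N (\<lambda>y. sg_energy M (\<lambda>t. kernel_op (p t)) t (sec w y) (sec w y))"
    and "sg_energy (N \<Otimes>\<^sub>M M) lift t w w = (LINT y|N. sg_energy M (\<lambda>t. kernel_op (p t)) t (sec w y) (sec w y))"
proof -
  have wm: "w \<in> borel_measurable (N \<Otimes>\<^sub>M M)" using w by (rule L2_measurable)
  have d: "(\<lambda>z. w z - lift t w z) \<in> L2 (N \<Otimes>\<^sub>M M)"
    by (rule L2_diff[OF w sg_L2[OF L2_semigroup_lift t w]])
  have eq: "L2_inner M (sec (\<lambda>z. w z - lift t w z) y) (sec w y) / t = sg_energy M (\<lambda>t. kernel_op (p t)) t (sec w y) (sec w y)"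
    if "y \<in> space N" for y
    unfolding sg_energy_def
    by (intro arg_cong2[where f="(/)"] refl L2_inner_cong) (simp_all add: lift_sec[OF t wm that])
  have "integrable N (\<lambda>y. L2_inner M (sec (\<lambda>z. w z - lift t w z) y) (sec w y) / t)"
    using L2_inner_sec(1)[OF d w] by simp
  then show "integrable N (\<lambda>y. sg_energy M (\<lambda>t. kernel_op (p t)) t (sec w y) (sec w y))"
    using eq by (simp cong: Bochner_Integration.integrable_cong)
  have "sg_energy (N \<Otimes>\<^sub>M M) lift t w w = (LINT y|N. L2_inner M (sec (\<lambda>z. w z - lift t w z) y) (sec w y) / t)"
    unfolding sg_energy_def L2_inner_sec(2)[OF d w] by simp
  also have "\<dots> = (LINT y|N. sg_energy M (\<lambda>t. kernel_op (p t)) t (sec w y) (sec w y))"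
    by (rule Bochner_Integration.integral_cong) (simp_all add: eq)
  finally show "sg_energy (N \<Otimes>\<^sub>M M) lift t w w = (LINT y|N. sg_energy M (\<lambda>t. kernel_op (p t)) t (sec w y) (sec w y))" .
qed

definition sec_energy :: "'a form \<Rightarrow> ('a \<Rightarrow> real) set \<Rightarrow> ('c \<times> 'a \<Rightarrow> real) \<Rightarrow> 'c \<Rightarrow> real" where
  "sec_energy E F w y = (if sec w y \<in> F then E (sec w y) (sec w y) else 0)"

context
  fixes E :: "'a form" and F :: "('a \<Rightarrow> real) set"
  assumes SF: "semigroup_of_form M E F (\<lambda>t. kernel_op (p t))"
begin

text \<open>Since the energies of a section increase to its form value, an integrable bound on the form
  values of the sections bounds the energy of the lifted semigroup at all times.\<close>

lemma sg_domain_liftI: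
  assumes w: "w \<in> L2 (N \<Otimes>\<^sub>M M)" and F: "AE y in N. sec w y \<in> F \<and> E (sec w y) (sec w y) \<le> g y" and g: "integrable N g"
  shows "w \<in> sg_domain (N \<Otimes>\<^sub>M M) lift" and "sg_form (N \<Otimes>\<^sub>M M) lift w w \<le> (LINT y|N. g y)"
proof -
  have le: "sg_energy (N \<Otimes>\<^sub>M M) lift t w w \<le> (LINT y|N. g y)" if t: "0 < t" for t
    unfolding sg_energy_lift(2)[OF t w]
  proof (rule integral_mono_AE[OF sg_energy_lift(1)[OF t w] g])
    show "AE y in N. sg_energy M (\<lambda>t. kernel_op (p t)) t (sec w y) (sec w y) \<le> g y"
      using F by eventually_elim (use sof_energy_le[OF SF _ t] in force)
  qed
  show D: "w \<in> sg_domain (N \<Otimes>\<^sub>M M) lift" by (rule sg_domainI[OF L2_semigroup_lift w le])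
  note SL = semigroup_of_form_iff[OF L2_semigroup_lift, of "sg_form (N \<Otimes>\<^sub>M M) lift" "sg_domain (N \<Otimes>\<^sub>M M) lift", simplified]
  show "sg_form (N \<Otimes>\<^sub>M M) lift w w \<le> (LINT y|N. g y)" by (rule sof_form_le[OF SL D le])
qed

text \<open>Along \<open>t = 1 / (n + 1)\<close> the energies of the sections increase to their form values, so
  measurability in the parameter and the integral formula both come from monotone convergence.\<close>

lemma
  assumes w: "w \<in> L2 (N \<Otimes>\<^sub>M M)"
  shows sec_domain_sets: "{y \<in> space N. sec w y \<in> F} \<in> sets N"
    and sec_energy_measurable: "sec_energy E F w \<in> borel_measurable N"
    and sg_domain_liftD: "w \<in> sg_domain (N \<Otimes>\<^sub>M M) lift \<Longrightarrow>
      (AE y in N. sec w y \<in> F) \<and> integrable N (sec_energy E F w) \<and>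
      sg_form (N \<Otimes>\<^sub>M M) lift w w = (LINT y|N. sec_energy E F w y)"
proof -
  let ?T = "\<lambda>t. kernel_op (p t)"
  have [measurable]: "w \<in> borel_measurable (N \<Otimes>\<^sub>M M)" using w by (rule L2_measurable)
  define \<tau> where "\<tau> n = inverse (real (Suc n))" for n
  have \<tau>: "0 < \<tau> n" for n by (simp add: \<tau>_def)
  have \<tau>_lim: "filterlim \<tau> (at_right 0) sequentially"
    unfolding filterlim_at \<tau>_def[abs_def] using LIMSEQ_inverse_real_of_nat by (auto intro: always_eventually)
  define e where "e n y = sg_energy M ?T (\<tau> n) (sec w y) (sec w y)" for n y
  have em[measurable]: "e n \<in> borel_measurable N" for n
    unfolding e_def using borel_measurable_integrable[OF sg_energy_lift(1)[OF \<tau> w]] .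
  define S where "S y = (SUP n. ennreal (e n y))" for y
  have Sm[measurable]: "S \<in> borel_measurable N" unfolding S_def[abs_def] by measurable
  have e0: "0 \<le> e n y" if "sec w y \<in> L2 M" for n y
    unfolding e_def by (rule form_nonneg[OF symmetric_form_sg_energy[OF K.semigroup \<tau>] that])
  have emono: "e m y \<le> e n y" if "sec w y \<in> L2 M" "m \<le> n" for m n y
    unfolding e_def by (rule sg_energy_antimono[OF K.semigroup \<tau> _ that(1)]) (use that(2) in \<open>simp add: \<tau>_def\<close>)
  have S_F: "S y = ennreal (E (sec w y) (sec w y))" if y: "sec w y \<in> F" for y
  proof -
    have "(\<lambda>n. e n y) \<longlonglongrightarrow> E (sec w y) (sec w y)"
      unfolding e_def by (rule filterlim_compose[OF sof_tendsto[OF SF y y] \<tau>_lim])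
    then have 1: "(\<lambda>n. ennreal (e n y)) \<longlonglongrightarrow> ennreal (E (sec w y) (sec w y))" by (rule tendsto_ennrealI)
    have "incseq (\<lambda>n. ennreal (e n y))"
      using emono[OF sof_L2[OF SF y]] by (auto simp: incseq_def intro: ennreal_leI)
    from LIMSEQ_unique[OF 1 LIMSEQ_SUP[OF this]] show ?thesis by (simp add: S_def)
  qed
  have S_notF: "S y = \<infinity>" if L: "sec w y \<in> L2 M" and F: "sec w y \<notin> F" for y
  proof (rule ccontr)
    assume "S y \<noteq> \<infinity>"
    then obtain c where c: "0 \<le> c" "S y = ennreal c" by (cases "S y") auto
    have ec: "e n y \<le> c" for n
    proof -
      have "ennreal (e n y) \<le> ennreal c" unfolding c(2)[symmetric] S_def by (rule SUP_upper) simp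
      then show ?thesis using c(1) by (simp add: ennreal_le_iff)
    qed
    have "sec w y \<in> F"
    proof (rule sof_memI[OF SF L])
      fix t :: real assume t: "0 < t"
      obtain n where n: "\<tau> n < t" using reals_Archimedean[OF t] by (auto simp: \<tau>_def)
      have "sg_energy M ?T t (sec w y) (sec w y) \<le> e n y"
        unfolding e_def by (rule sg_energy_antimono[OF K.semigroup \<tau> less_imp_le[OF n] L])
      also have "\<dots> \<le> c" by (rule ec)
      finally show "sg_energy M ?T t (sec w y) (sec w y) \<le> c" .
    qed
    with F show False by blast
  qed
  \<comment> \<open>Sections outside the domain are recognized by unbounded energies.\<close>
  have F_eq: "{y \<in> space N. sec w y \<in> F} = {y \<in> space N. sec w y \<in> L2 M} \<inter> {y \<in> space N. S y < \<infinity>}"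
  proof (intro equalityI subsetI)
    fix y assume "y \<in> {y \<in> space N. sec w y \<in> F}"
    then show "y \<in> {y \<in> space N. sec w y \<in> L2 M} \<inter> {y \<in> space N. S y < \<infinity>}"
      using S_F[of y] sof_L2[OF SF, of "sec w y"] by simp
  next
    fix y assume "y \<in> {y \<in> space N. sec w y \<in> L2 M} \<inter> {y \<in> space N. S y < \<infinity>}"
    then show "y \<in> {y \<in> space N. sec w y \<in> F}" using S_notF[of y] by (cases "sec w y \<in> F") auto
  qed
  show F_sets: "{y \<in> space N. sec w y \<in> F} \<in> sets N"
    unfolding F_eq by (intro sets.Int sec_L2_sets) measurable
  have E0: "0 \<le> E (sec w y) (sec w y)" if "sec w y \<in> F" for y
    by (rule form_nonneg[OF symmetric_form_sof[OF SF] that])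
  have energy_eq: "sec_energy E F w y = (if y \<in> {y \<in> space N. sec w y \<in> F} then enn2real (S y) else 0)" if "y \<in> space N" for y
    using that by (simp add: sec_energy_def S_F E0)
  show em': "sec_energy E F w \<in> borel_measurable N"
  proof (rule measurable_cong[OF energy_eq, THEN iffD2])
    show "(\<lambda>y. if y \<in> {y \<in> space N. sec w y \<in> F} then enn2real (S y) else 0) \<in> borel_measurable N"
      by (rule measurable_If_set) (use F_sets in \<open>auto simp: Int_absorb2\<close>)
  qed
  show "(AE y in N. sec w y \<in> F) \<and> integrable N (sec_energy E F w) \<and>
      sg_form (N \<Otimes>\<^sub>M M) lift w w = (LINT y|N. sec_energy E F w y)"
    if D: "w \<in> sg_domain (N \<Otimes>\<^sub>M M) lift"
  proof -
    note SL = semigroup_of_form_iff[OF L2_semigroup_lift, of "sg_form (N \<Otimes>\<^sub>M M) lift" "sg_domain (N \<Otimes>\<^sub>M M) lift", simplified]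
    have "(\<integral>\<^sup>+y. S y \<partial>N) = (SUP n. \<integral>\<^sup>+y. ennreal (e n y) \<partial>N)"
      unfolding S_def
    proof (rule nn_integral_monotone_convergence_SUP_AE)
      show "AE y in N. ennreal (e n y) \<le> ennreal (e (Suc n) y)" for n
        using sec_L2_AE[OF w] by eventually_elim (auto intro!: ennreal_leI emono)
    qed simp
    also have "(\<lambda>n. \<integral>\<^sup>+y. ennreal (e n y) \<partial>N) = (\<lambda>n. ennreal (sg_energy (N \<Otimes>\<^sub>M M) lift (\<tau> n) w w))"
    proof
      fix n
      have "AE y in N. 0 \<le> e n y" using sec_L2_AE[OF w] by eventually_elim (rule e0)
      then show "(\<integral>\<^sup>+y. ennreal (e n y) \<partial>N) = ennreal (sg_energy (N \<Otimes>\<^sub>M M) lift (\<tau> n) w w)"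
        unfolding sg_energy_lift(2)[OF \<tau> w] e_def
        by (rule nn_integral_eq_integral[OF sg_energy_lift(1)[OF \<tau> w]])
    qed
    also have "(SUP n. ennreal (sg_energy (N \<Otimes>\<^sub>M M) lift (\<tau> n) w w)) = ennreal (sg_form (N \<Otimes>\<^sub>M M) lift w w)"
    proof -
      have conv: "(\<lambda>n. ennreal (sg_energy (N \<Otimes>\<^sub>M M) lift (\<tau> n) w w)) \<longlonglongrightarrow> ennreal (sg_form (N \<Otimes>\<^sub>M M) lift w w)"
        by (rule tendsto_ennrealI[OF filterlim_compose[OF sof_tendsto[OF SL D D] \<tau>_lim]])
      have inc: "incseq (\<lambda>n. ennreal (sg_energy (N \<Otimes>\<^sub>M M) lift (\<tau> n) w w))"
        unfolding incseq_def
      proof (intro allI impI ennreal_leI)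
        fix m n :: nat assume "m \<le> n"
        then show "sg_energy (N \<Otimes>\<^sub>M M) lift (\<tau> m) w w \<le> sg_energy (N \<Otimes>\<^sub>M M) lift (\<tau> n) w w"
          by (intro sg_energy_antimono[OF L2_semigroup_lift \<tau> _ w]) (simp add: \<tau>_def)
      qed
      from LIMSEQ_unique[OF LIMSEQ_SUP[OF inc] conv] show ?thesis .
    qed
    finally have S_int: "(\<integral>\<^sup>+y. S y \<partial>N) = ennreal (sg_form (N \<Otimes>\<^sub>M M) lift w w)" .
    then have "AE y in N. S y \<noteq> \<infinity>" by (intro nn_integral_PInf_AE) auto
    with sec_L2_AE[OF w] have AEF: "AE y in N. sec w y \<in> F"
    proof eventually_elim
      case (elim y)
      then show ?case using S_notF[of y] by blast
    qed
    have "(\<integral>\<^sup>+y. S y \<partial>N) = (\<integral>\<^sup>+y. ennreal (sec_energy E F w y) \<partial>N)"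
      by (rule nn_integral_cong_AE, use AEF in eventually_elim) (simp add: S_F sec_energy_def)
    with S_int have eq: "(\<integral>\<^sup>+y. ennreal (sec_energy E F w y) \<partial>N) = ennreal (sg_form (N \<Otimes>\<^sub>M M) lift w w)" by simp
    have pos: "0 \<le> sec_energy E F w y" for y by (simp add: sec_energy_def E0)
    have int: "integrable N (sec_energy E F w)"
      by (rule integrableI_nonneg[OF em']) (use pos eq in auto)
    have "ennreal (LINT y|N. sec_energy E F w y) = ennreal (sg_form (N \<Otimes>\<^sub>M M) lift w w)"
      using nn_integral_eq_integral[OF int] pos eq by simp
    moreover have "0 \<le> sg_form (N \<Otimes>\<^sub>M M) lift w w" by (rule form_nonneg[OF symmetric_form_sof[OF SL] D])
    ultimately have "sg_form (N \<Otimes>\<^sub>M M) lift w w = (LINT y|N. sec_energy E F w y)"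
      using pos by (subst (asm) ennreal_inj) (auto intro: integral_nonneg_AE)
    with AEF int show ?thesis by blast
  qed
qed

end

end

context kernel_sections
begin

context
  fixes E :: "'a form" and F :: "('a \<Rightarrow> real) set"
  assumes SF: "semigroup_of_form M E F (\<lambda>t. kernel_op (p t))"
begin

lemma L2_sections_snd_eq: "L2_sections_snd N M E F = sg_domain (N \<Otimes>\<^sub>M M) lift"
proof (intro equalityI subsetI)
  fix w assume "w \<in> L2_sections_snd N M E F"
  then have w: "w \<in> L2 (N \<Otimes>\<^sub>M M)" and wF: "AE y in N. sec w y \<in> F"
    and h: "(\<lambda>y. if sec w y \<in> F then form1_norm M E (sec w y) else 0) \<in> L2 N"
    by (auto simp: L2_sections_snd_def)
  have "AE y in N. sec w y \<in> F \<and>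
      E (sec w y) (sec w y) \<le> (if sec w y \<in> F then form1_norm M E (sec w y) else 0)\<^sup>2"
    using wF
  proof eventually_elim
    case (elim y)
    then show ?case
      using form1_norm_eq[OF SF sof_L2[OF SF elim]] form_nonneg[OF symmetric_form_sof[OF SF] elim] by simp
  qed
  then show "w \<in> sg_domain (N \<Otimes>\<^sub>M M) lift"
    by (rule sg_domain_liftI(1)[OF SF w _ L2_square_integrable[OF h]])
next
  fix w assume D: "w \<in> sg_domain (N \<Otimes>\<^sub>M M) lift"
  have w: "w \<in> L2 (N \<Otimes>\<^sub>M M)" by (rule sg_domain_L2[OF L2_semigroup_lift D])
  define h where "h y = (if sec w y \<in> F then form1_norm M E (sec w y) else 0)" for y
  define k where "k y = sec_energy E F w y + (if y \<in> {y \<in> space N. sec w y \<in> F} then L2_inner M (sec w y) (sec w y) else 0)" for y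
  note liftD = sg_domain_liftD[OF SF w D]
  have iw: "integrable N (\<lambda>y. L2_inner M (sec w y) (sec w y))" by (rule L2_inner_sec(1)[OF w w])
  have km: "k \<in> borel_measurable N"
    unfolding k_def
    by (intro borel_measurable_add sec_energy_measurable[OF SF w] measurable_If_set)
      (use sec_domain_sets[OF SF w] iw in \<open>auto simp: Int_absorb2\<close>)
  have hk: "h y = sqrt (k y)" and k0: "0 \<le> k y" if "y \<in> space N" for y
    using that form_nonneg[OF symmetric_form_sof[OF SF], of "sec w y"]
      form_nonneg[OF symmetric_form_L2 sof_L2[OF SF], of "sec w y"]
    by (auto simp: h_def k_def sec_energy_def form1_norm_def form1_def)
  have "integrable N k"
  proof (rule Bochner_Integration.integrable_bound[OF _ km])
    show "integrable N (\<lambda>y. sec_energy E F w y + L2_inner M (sec w y) (sec w y))"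
      using liftD iw by simp
    show "AE y in N. norm (k y) \<le> norm (sec_energy E F w y + L2_inner M (sec w y) (sec w y))"
      using liftD[THEN conjunct1] AE_space by eventually_elim (simp add: k_def)
  qed
  moreover have "(h y)\<^sup>2 = k y" if "y \<in> space N" for y using hk[OF that] k0[OF that] by simp
  ultimately have "h \<in> L2 N"
    using km by (auto simp: L2_def hk cong: measurable_cong Bochner_Integration.integrable_cong)
  then show "w \<in> L2_sections_snd N M E F"
    using w liftD by (simp add: L2_sections_snd_def h_def[abs_def])
qed

text \<open>Polarization of the diagonal case, carried out for almost every section; on the null set where
  a section leaves the domain the integrand is zero.\<close>

lemma sg_form_lift_eq:
  assumes u: "u \<in> sg_domain (N \<Otimes>\<^sub>M M) lift" and v: "v \<in> sg_domain (N \<Otimes>\<^sub>M M) lift"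
  shows "(LINT y|N. (if sec u y \<in> F \<and> sec v y \<in> F then E (sec u y) (sec v y) else 0)) = sg_form (N \<Otimes>\<^sub>M M) lift u v"
proof -
  note SL = semigroup_of_form_iff[OF L2_semigroup_lift, of "sg_form (N \<Otimes>\<^sub>M M) lift" "sg_domain (N \<Otimes>\<^sub>M M) lift", simplified]
  note S = symmetric_form_sof[OF SL] and SE = symmetric_form_sof[OF SF]
  have uL: "u \<in> L2 (N \<Otimes>\<^sub>M M)" and vL: "v \<in> L2 (N \<Otimes>\<^sub>M M)" by (rule sof_L2[OF SL u], rule sof_L2[OF SL v])
  let ?s = "\<lambda>z. u z + v z" and ?d = "\<lambda>z. u z - v z"
  have s: "?s \<in> sg_domain (N \<Otimes>\<^sub>M M) lift" and d: "?d \<in> sg_domain (N \<Otimes>\<^sub>M M) lift"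
    by (rule form_add_mem[OF S u v], rule form_diff_mem[OF S u v])
  note sL = sof_L2[OF SL s] and dL = sof_L2[OF SL d]
  note Du = sg_domain_liftD[OF SF uL u] and Dv = sg_domain_liftD[OF SF vL v]
    and Ds = sg_domain_liftD[OF SF sL s] and Dd = sg_domain_liftD[OF SF dL d]
  define q where "q y = (sec_energy E F ?s y - sec_energy E F ?d y) / 4" for y
  have qm: "q \<in> borel_measurable N"
    unfolding q_def using sec_energy_measurable[OF SF sL] sec_energy_measurable[OF SF dL] by measurable
  let ?W = "{y \<in> space N. sec u y \<in> F} \<inter> {y \<in> space N. sec v y \<in> F}"
  have W: "?W \<in> sets N" by (intro sets.Int sec_domain_sets[OF SF] uL vL)
  have int_eq: "(if sec u y \<in> F \<and> sec v y \<in> F then E (sec u y) (sec v y) else 0) = (if y \<in> ?W then q y else 0)"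
    if y: "y \<in> space N" for y
  proof (cases "sec u y \<in> F \<and> sec v y \<in> F")
    case True
    then have Fu: "sec u y \<in> F" and Fv: "sec v y \<in> F" by auto
    show ?thesis
      using y True form_polarization[OF SE Fu Fv] form_add_mem[OF SE Fu Fv] form_diff_mem[OF SE Fu Fv]
      by (simp add: q_def sec_energy_def)
  next
    case False
    then show ?thesis using y by auto
  qed
  have "(LINT y|N. (if sec u y \<in> F \<and> sec v y \<in> F then E (sec u y) (sec v y) else 0)) = (LINT y|N. (if y \<in> ?W then q y else 0))"
    by (rule Bochner_Integration.integral_cong[OF refl int_eq])
  also have "\<dots> = (LINT y|N. q y)"
  proof (rule integral_cong_AE[OF _ qm])
    show "(\<lambda>y. if y \<in> ?W then q y else 0) \<in> borel_measurable N"
      by (rule measurable_If_set[OF qm]) (use W in \<open>auto simp: Int_absorb2\<close>)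
    show "AE y in N. (if y \<in> ?W then q y else 0) = q y"
      using Du[THEN conjunct1] Dv[THEN conjunct1] AE_space by eventually_elim simp
  qed
  also have "\<dots> = (sg_form (N \<Otimes>\<^sub>M M) lift ?s ?s - sg_form (N \<Otimes>\<^sub>M M) lift ?d ?d) / 4"
    unfolding q_def using Ds Dd by simp
  also have "\<dots> = sg_form (N \<Otimes>\<^sub>M M) lift u v" by (rule form_polarization[OF S u v, symmetric])
  finally show ?thesis .
qed

lemma sg_domain_lift_unit_contraction:
  assumes mk: "markovian_form E F" and u: "u \<in> sg_domain (N \<Otimes>\<^sub>M M) lift"
  defines "v \<equiv> (\<lambda>z. min (max (u z) 0) 1)"
  shows "v \<in> sg_domain (N \<Otimes>\<^sub>M M) lift" and "sg_form (N \<Otimes>\<^sub>M M) lift v v \<le> sg_form (N \<Otimes>\<^sub>M M) lift u u"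
proof -
  have uL: "u \<in> L2 (N \<Otimes>\<^sub>M M)" by (rule sg_domain_L2[OF L2_semigroup_lift u])
  note Du = sg_domain_liftD[OF SF uL u]
  have [measurable]: "u \<in> borel_measurable (N \<Otimes>\<^sub>M M)" using uL by (rule L2_measurable)
  have vL: "v \<in> L2 (N \<Otimes>\<^sub>M M)"
  proof (rule L2_I)
    show vm: "v \<in> borel_measurable (N \<Otimes>\<^sub>M M)" unfolding v_def by measurable
    have "\<bar>v z\<bar> \<le> \<bar>u z\<bar>" for z by (auto simp: v_def)
    then have "(v z)\<^sup>2 \<le> (u z)\<^sup>2" for z by (simp add: abs_le_square_iff)
    then show "integrable (N \<Otimes>\<^sub>M M) (\<lambda>z. (v z)\<^sup>2)"
      by (intro Bochner_Integration.integrable_bound[OF L2_square_integrable[OF uL]] borel_measurable_power vm AE_I2) simp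
  qed
  have *: "AE y in N. sec v y \<in> F \<and> E (sec v y) (sec v y) \<le> sec_energy E F u y"
    using Du[THEN conjunct1]
  proof eventually_elim
    case (elim y)
    then show ?case using mk[unfolded markovian_form_def, THEN bspec, OF elim] by (simp add: v_def sec_energy_def)
  qed
  have iu: "integrable N (sec_energy E F u)" using Du by blast
  show "v \<in> sg_domain (N \<Otimes>\<^sub>M M) lift" by (rule sg_domain_liftI(1)[OF SF vL * iu])
  show "sg_form (N \<Otimes>\<^sub>M M) lift v v \<le> sg_form (N \<Otimes>\<^sub>M M) lift u u"
    using sg_domain_liftI(2)[OF SF vL * iu] Du by simp
qed

end

end

section \<open>The product form\<close>

lemma measurable_swap:
  "u \<in> M \<Otimes>\<^sub>M N \<rightarrow>\<^sub>M L \<Longrightarrow> (\<lambda>z. u (snd z, fst z)) \<in> N \<Otimes>\<^sub>M M \<rightarrow>\<^sub>M L"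
  by (rule measurable_compose[OF measurable_Pair[OF measurable_snd measurable_fst]])

lemma (in pair_sigma_finite) L2_inner_swap:
  assumes "u \<in> borel_measurable (M1 \<Otimes>\<^sub>M M2)" "v \<in> borel_measurable (M1 \<Otimes>\<^sub>M M2)"
  shows "L2_inner (M2 \<Otimes>\<^sub>M M1) (\<lambda>z. u (snd z, fst z)) (\<lambda>z. v (snd z, fst z)) = L2_inner (M1 \<Otimes>\<^sub>M M2) u v"
  unfolding L2_inner_def using integral_product_swap[OF borel_measurable_times[OF assms]]
  by (simp add: case_prod_beta')

lemma (in pair_sigma_finite) L2_swap:
  assumes "u \<in> L2 (M1 \<Otimes>\<^sub>M M2)"
  shows "(\<lambda>z. u (snd z, fst z)) \<in> L2 (M2 \<Otimes>\<^sub>M M1)"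
  using assms integrable_product_swap[of "\<lambda>z. (u z)\<^sup>2"]
  by (auto simp: L2_def case_prod_beta' intro: measurable_swap)

lemma L2_swap_iff:
  assumes "sigma_finite_measure M" "sigma_finite_measure N"
  shows "(\<lambda>z. u (snd z, fst z)) \<in> L2 (N \<Otimes>\<^sub>M M) \<longleftrightarrow> u \<in> L2 (M \<Otimes>\<^sub>M N)"
proof -
  interpret M: sigma_finite_measure M by fact
  interpret N: sigma_finite_measure N by fact
  interpret MN: pair_sigma_finite M N ..
  interpret NM: pair_sigma_finite N M ..
  show ?thesis using MN.L2_swap[of u] NM.L2_swap[of "\<lambda>z. u (snd z, fst z)"] by auto
qed

lemma L2_sections_fst_swap:
  assumes "sigma_finite_measure M" "sigma_finite_measure N"
  shows "u \<in> L2_sections_fst M N E F \<longleftrightarrow> (\<lambda>z. u (snd z, fst z)) \<in> L2_sections_snd N M E F"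
  unfolding L2_sections_fst_def L2_sections_snd_def mem_Collect_eq fst_conv snd_conv L2_swap_iff[OF assms] ..

text \<open>\<open>SY.lift\<close> acts on the second variable. The semigroup \<open>A\<close> on the first variable is transferred
  from \<open>SX.lift\<close>, which acts on the second variable of the swapped product.\<close>

locale product_of_forms =
  X: symmetric_kernel_semigroup MX p + Y: symmetric_kernel_semigroup MY q
  for MX :: "'a measure" and p and MY :: "'b measure" and q +
  fixes \<E>X :: "'a form" and \<F>X and \<E>Y :: "'b form" and \<F>Y
  assumes SX: "semigroup_of_form MX \<E>X \<F>X (\<lambda>t. kernel_op (p t))"
    and SY: "semigroup_of_form MY \<E>Y \<F>Y (\<lambda>t. kernel_op (q t))"
begin

sublocale pair_sigma_finite MX MY ..
sublocale SX: kernel_sections MX p MY ..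
sublocale SY: kernel_sections MY q MX ..

abbreviation sw :: "('a \<times> 'b \<Rightarrow> real) \<Rightarrow> 'b \<times> 'a \<Rightarrow> real" where
  "sw u \<equiv> (\<lambda>z. u (snd z, fst z))"

definition A :: "real \<Rightarrow> ('a \<times> 'b \<Rightarrow> real) \<Rightarrow> 'a \<times> 'b \<Rightarrow> real" where
  "A t = kernel_op (prod_kernel (p t) (return MY))"

definition T :: "real \<Rightarrow> ('a \<times> 'b \<Rightarrow> real) \<Rightarrow> 'a \<times> 'b \<Rightarrow> real" where
  "T t = kernel_op (prod_kernel (p t) (q t))"

abbreviation "MXY \<equiv> MX \<Otimes>\<^sub>M MY"
abbreviation "\<F>XY \<equiv> prod_domain MX MY \<E>X \<F>X \<E>Y \<F>Y"
abbreviation "\<E>XY \<equiv> prod_form MX MY \<E>X \<F>X \<E>Y \<F>Y"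

lemma sw_L2: "u \<in> L2 MXY \<Longrightarrow> sw u \<in> L2 (MY \<Otimes>\<^sub>M MX)"
  by (rule L2_swap)

lemma A_sw:
  assumes t: "0 < t" and u: "u \<in> borel_measurable MXY" and z: "z \<in> space (MY \<Otimes>\<^sub>M MX)"
  shows "sw (A t u) z = SX.lift t (sw u) z"
proof -
  obtain y x where z_eq: "z = (y, x)" and y: "y \<in> space MY" and x: "x \<in> space MX"
    using z by (auto simp: space_pair_measure)
  have "A t u (x, y) = kernel_op (p t) (\<lambda>x. u (x, y)) x"
    unfolding A_def by (rule kernel_op_prod_return_right[OF X.symmetric[OF t] u x y])
  moreover have "SX.lift t (sw u) (y, x) = kernel_op (p t) (\<lambda>x. u (x, y)) x"
    using SX.lift_sec[OF t measurable_swap[OF u] y x] by simp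
  ultimately show ?thesis by (simp add: z_eq)
qed

lemma symmetric_kernel_A: "0 < t \<Longrightarrow> symmetric_kernel MXY (prod_kernel (p t) (return MY))"
proof -
  assume t: "0 < t"
  interpret p: symmetric_kernel MX "p t" by (rule X.symmetric[OF t])
  interpret r: symmetric_kernel MY "return MY" by (rule symmetric_kernel_return)
  interpret symmetric_kernel_pair MX "p t" MY "return MY" ..
  show ?thesis by (rule symmetric_kernel_prod)
qed

lemma symmetric_kernel_T: "0 < t \<Longrightarrow> symmetric_kernel MXY (prod_kernel (p t) (q t))"
proof -
  assume t: "0 < t"
  interpret p: symmetric_kernel MX "p t" by (rule X.symmetric[OF t])
  interpret q: symmetric_kernel MY "q t" by (rule Y.symmetric[OF t])
  interpret symmetric_kernel_pair MX "p t" MY "q t" ..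
  show ?thesis by (rule symmetric_kernel_prod)
qed

lemma A_sw_inner:
  assumes t: "0 < t" and u: "u \<in> L2 MXY"
  shows "L2_norm MXY (\<lambda>z. A t u z - u z) = L2_norm (MY \<Otimes>\<^sub>M MX) (\<lambda>z. SX.lift t (sw u) z - sw u z)"
    and "sg_energy MXY A t u u = sg_energy (MY \<Otimes>\<^sub>M MX) SX.lift t (sw u) (sw u)"
proof -
  have um: "u \<in> borel_measurable MXY" using u by (rule L2_measurable)
  have Au: "A t u \<in> borel_measurable MXY"
    unfolding A_def by (rule symmetric_kernel.kernel_op_measurable[OF symmetric_kernel_A[OF t] um])
  have d: "(\<lambda>z. A t u z - u z) \<in> borel_measurable MXY" "(\<lambda>z. u z - A t u z) \<in> borel_measurable MXY"
    using um Au by auto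
  show "L2_norm MXY (\<lambda>z. A t u z - u z) = L2_norm (MY \<Otimes>\<^sub>M MX) (\<lambda>z. SX.lift t (sw u) z - sw u z)"
    unfolding L2_norm_def L2_inner_swap[OF d(1,1), symmetric]
    by (intro arg_cong[where f=sqrt] L2_inner_cong) (simp_all add: A_sw[OF t um])
  show "sg_energy MXY A t u u = sg_energy (MY \<Otimes>\<^sub>M MX) SX.lift t (sw u) (sw u)"
    unfolding sg_energy_def L2_inner_swap[OF d(2) um, symmetric]
    by (intro arg_cong2[where f="(/)"] refl L2_inner_cong) (simp_all add: A_sw[OF t um])
qed

lemma L2_semigroup_A: "L2_semigroup MXY A"
  unfolding A_def[abs_def]
proof (rule L2_semigroup_kernel[OF symmetric_kernel_A])
  fix s t :: real and z assume s: "0 < s" and t: "0 < t" and z: "z \<in> space MXY"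
  then have z': "fst z \<in> space MX" "snd z \<in> space MY" by (auto simp: space_pair_measure)
  have "prod_kernel (p s) (return MY) z \<bind> prod_kernel (p t) (return MY) =
      prod_kernel (\<lambda>x. p s x \<bind> p t) (\<lambda>y. return MY y \<bind> return MY) z"
    by (rule bind_prod_kernel[OF X.symmetric[OF s] X.symmetric[OF t] symmetric_kernel_return
          symmetric_kernel_return X.sigma_finite_measure_axioms Y.sigma_finite_measure_axioms z])
  also have "\<dots> = prod_kernel (p (s + t)) (return MY) z"
    unfolding prod_kernel_def using z' X.bind[OF s t z'(1)] bind_return[OF return_measurable z'(2)] by simp
  finally show "prod_kernel (p (s + t)) (return MY) z = prod_kernel (p s) (return MY) z \<bind> prod_kernel (p t) (return MY)" ..
next
  fix u assume u: "u \<in> L2 MXY"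
  have "((\<lambda>t. L2_norm MXY (\<lambda>z. A t u z - u z)) \<longlongrightarrow> 0) (at_right 0)"
    by (rule Lim_transform_eventually[OF SX.lift_tendsto[OF sw_L2[OF u]]])
      (use A_sw_inner(1)[OF _ u] in \<open>auto simp: eventually_at_right_field intro!: exI[of _ 1]\<close>)
  then show "((\<lambda>t. L2_norm MXY (\<lambda>z. kernel_op (prod_kernel (p t) (return MY)) u z - u z)) \<longlongrightarrow> 0) (at_right 0)"
    by (simp add: A_def)
qed

lemma sg_domain_A: "u \<in> sg_domain MXY A \<longleftrightarrow> sw u \<in> sg_domain (MY \<Otimes>\<^sub>M MX) SX.lift"
proof (cases "u \<in> L2 MXY")
  case True
  then show ?thesis using sw_L2[OF True] A_sw_inner(2)[OF _ True] by (simp add: sg_domain_def)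
next
  case False
  then show ?thesis
    using L2_swap_iff[OF X.sigma_finite_measure_axioms Y.sigma_finite_measure_axioms, of u]
    by (simp add: sg_domain_def)
qed

lemma sg_form_A:
  assumes u: "u \<in> sg_domain MXY A"
  shows "sg_form MXY A u u = sg_form (MY \<Otimes>\<^sub>M MX) SX.lift (sw u) (sw u)"
proof (rule tendsto_unique[OF trivial_limit_at_right_real sg_domain_tendsto_diag[OF L2_semigroup_A u]
      Lim_transform_eventually[OF sg_domain_tendsto_diag[OF SX.L2_semigroup_lift u[unfolded sg_domain_A]]]])
  show "\<forall>\<^sub>F t in at_right 0. sg_energy (MY \<Otimes>\<^sub>M MX) SX.lift t (sw u) (sw u) = sg_energy MXY A t u u"
    using A_sw_inner(2)[OF _ sg_domain_L2[OF L2_semigroup_A u]]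
    by (auto simp: eventually_at_right_field intro!: exI[of _ 1])
qed

lemma A_lift_commute:
  assumes s: "0 < s" and t: "0 < t" and u: "u \<in> L2 MXY"
  shows "AE z in MXY. A s (SY.lift t u) z = kernel_op (prod_kernel (p s) (q t)) u z"
    and "AE z in MXY. SY.lift t (A s u) z = kernel_op (prod_kernel (p s) (q t)) u z"
proof -
  interpret p: symmetric_kernel MX "p s" by (rule X.symmetric[OF s])
  interpret q: symmetric_kernel MY "q t" by (rule Y.symmetric[OF t])
  have sp: "fst z \<in> space MX" "snd z \<in> space MY" if "z \<in> space MXY" for z
    using that by (auto simp: space_pair_measure)
  have 1: "prod_kernel (p s) (return MY) z \<bind> prod_kernel (return MX) (q t) = prod_kernel (p s) (q t) z"
    if z: "z \<in> space MXY" for z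
    unfolding bind_prod_kernel[OF p.symmetric_kernel_axioms symmetric_kernel_return symmetric_kernel_return
        q.symmetric_kernel_axioms X.sigma_finite_measure_axioms Y.sigma_finite_measure_axioms z]
    unfolding prod_kernel_def bind_return[OF q.kernel sp(2)[OF z]] bind_return''[OF p.sets_p[OF sp(1)[OF z]]] ..
  have 2: "prod_kernel (return MX) (q t) z \<bind> prod_kernel (p s) (return MY) = prod_kernel (p s) (q t) z"
    if z: "z \<in> space MXY" for z
    unfolding bind_prod_kernel[OF symmetric_kernel_return p.symmetric_kernel_axioms q.symmetric_kernel_axioms
        symmetric_kernel_return X.sigma_finite_measure_axioms Y.sigma_finite_measure_axioms z]
    unfolding prod_kernel_def bind_return[OF p.kernel sp(1)[OF z]] bind_return''[OF q.sets_p[OF sp(2)[OF z]]] ..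
  show "AE z in MXY. A s (SY.lift t u) z = kernel_op (prod_kernel (p s) (q t)) u z"
    using kernel_op_bind_AE[OF symmetric_kernel_A[OF s] SY.symmetric_kernel_lift[OF t] u] AE_space
    unfolding A_def by eventually_elim (simp add: kernel_op_def 1)
  show "AE z in MXY. SY.lift t (A s u) z = kernel_op (prod_kernel (p s) (q t)) u z"
    using kernel_op_bind_AE[OF SY.symmetric_kernel_lift[OF t] symmetric_kernel_A[OF s] u] AE_space
    unfolding A_def by eventually_elim (simp add: kernel_op_def 2)
qed

text \<open>Strong continuity follows from
  \<open>A\<^sub>t B\<^sub>t u - u = A\<^sub>t (B\<^sub>t u - u) + (A\<^sub>t u - u)\<close> and the contraction property of \<open>A\<^sub>t\<close>.\<close>

lemma L2_semigroup_T: "L2_semigroup MXY T"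
  unfolding T_def[abs_def]
proof (rule L2_semigroup_kernel[OF symmetric_kernel_T])
  fix s t :: real and z assume s: "0 < s" and t: "0 < t" and z: "z \<in> space MXY"
  then have z': "fst z \<in> space MX" "snd z \<in> space MY" by (auto simp: space_pair_measure)
  show "prod_kernel (p (s + t)) (q (s + t)) z = prod_kernel (p s) (q s) z \<bind> prod_kernel (p t) (q t)"
    unfolding bind_prod_kernel[OF X.symmetric[OF s] X.symmetric[OF t] Y.symmetric[OF s] Y.symmetric[OF t]
          X.sigma_finite_measure_axioms Y.sigma_finite_measure_axioms z]
    unfolding prod_kernel_def using X.bind[OF s t z'(1)] Y.bind[OF s t z'(2)] by simp
next
  fix u assume u: "u \<in> L2 MXY"
  let ?K = "\<lambda>t. kernel_op (prod_kernel (p t) (q t)) u"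
  have bound: "L2_norm MXY (\<lambda>z. ?K t z - u z) \<le> L2_norm MXY (\<lambda>z. SY.lift t u z - u z) + L2_norm MXY (\<lambda>z. A t u z - u z)"
    if t: "0 < t" for t
  proof -
    note SA = L2_semigroup_A and SB = SY.L2_semigroup_lift
    have Bu: "SY.lift t u \<in> L2 MXY" by (rule sg_L2[OF SB t u])
    have Au: "A t u \<in> L2 MXY" by (rule sg_L2[OF SA t u])
    have d: "(\<lambda>z. SY.lift t u z - u z) \<in> L2 MXY" by (rule L2_diff[OF Bu u])
    have Ad: "A t (\<lambda>z. SY.lift t u z - u z) \<in> L2 MXY" by (rule sg_L2[OF SA t d])
    have K: "?K t \<in> L2 MXY" by (rule symmetric_kernel.kernel_op_L2(1)[OF symmetric_kernel_T[OF t] u])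
    have lin: "AE z in MXY. A t (\<lambda>z. SY.lift t u z - u z) z = A t (SY.lift t u) z - A t u z"
      using symmetric_kernel.kernel_op_linear_AE[OF symmetric_kernel_A[OF t] Bu u, of 1 "-1"]
      unfolding A_def by simp
    have eq: "AE z in MXY. ?K t z - u z = A t (\<lambda>z. SY.lift t u z - u z) z + (A t u z - u z)"
      using A_lift_commute(1)[OF t t u] lin by eventually_elim simp
    have "L2_norm MXY (\<lambda>z. ?K t z - u z) = L2_norm MXY (\<lambda>z. A t (\<lambda>z. SY.lift t u z - u z) z + (A t u z - u z))"
      by (rule L2_norm_cong_AE[OF eq])
        (rule L2_measurable[OF L2_diff[OF K u]], rule L2_measurable[OF L2_add[OF Ad L2_diff[OF Au u]]])
    also have "\<dots> \<le> L2_norm MXY (A t (\<lambda>z. SY.lift t u z - u z)) + L2_norm MXY (\<lambda>z. A t u z - u z)"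
      by (rule L2_triangle[OF Ad L2_diff[OF Au u]])
    also have "\<dots> \<le> L2_norm MXY (\<lambda>z. SY.lift t u z - u z) + L2_norm MXY (\<lambda>z. A t u z - u z)"
      using sg_norm_le[OF SA t d] by simp
    finally show ?thesis .
  qed
  have pos: "0 \<le> L2_norm MXY (\<lambda>z. ?K t z - u z)" if "0 < t" for t
    by (rule L2_norm_nonneg[OF L2_diff[OF symmetric_kernel.kernel_op_L2(1)[OF symmetric_kernel_T[OF that] u] u]])
  have "((\<lambda>t. L2_norm MXY (\<lambda>z. SY.lift t u z - u z) + L2_norm MXY (\<lambda>z. A t u z - u z)) \<longlongrightarrow> 0 + 0) (at_right 0)"
    by (intro tendsto_add SY.lift_tendsto[OF u] sg_tendsto[OF L2_semigroup_A u])
  then have lim: "((\<lambda>t. L2_norm MXY (\<lambda>z. SY.lift t u z - u z) + L2_norm MXY (\<lambda>z. A t u z - u z)) \<longlongrightarrow> 0) (at_right 0)"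
    by simp
  show "((\<lambda>t. L2_norm MXY (\<lambda>z. ?K t z - u z)) \<longlongrightarrow> 0) (at_right 0)"
  proof (rule tendsto_sandwich[OF _ _ tendsto_const lim])
    show "\<forall>\<^sub>F t in at_right 0. 0 \<le> L2_norm MXY (\<lambda>z. ?K t z - u z)"
      using pos by (auto simp: eventually_at_right_field intro!: exI[of _ 1])
    show "\<forall>\<^sub>F t in at_right 0. L2_norm MXY (\<lambda>z. ?K t z - u z) \<le> L2_norm MXY (\<lambda>z. SY.lift t u z - u z) + L2_norm MXY (\<lambda>z. A t u z - u z)"
      using bound by (auto simp: eventually_at_right_field intro!: exI[of _ 1])
  qed
qed

lemma T_domain_form:
  shows "sg_domain MXY T = sg_domain MXY A \<inter> sg_domain MXY SY.lift"
    and "u \<in> sg_domain MXY T \<Longrightarrow> sg_form MXY T u u = sg_form MXY A u u + sg_form MXY SY.lift u u"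
proof -
  have T: "AE z in MXY. T t u z = A t (SY.lift t u) z" if "0 < t" "u \<in> L2 MXY" for t u
    using A_lift_commute(1)[OF that(1,1,2)] unfolding T_def by eventually_elim simp
  have C: "AE z in MXY. A s (SY.lift t u) z = SY.lift t (A s u) z" if "0 < s" "0 < t" "u \<in> L2 MXY" for s t u
    using A_lift_commute[OF that] by eventually_elim simp
  note * = sg_form_commuting_product[where M=MXY and A=A and B=SY.lift and T=T,
      OF L2_semigroup_A SY.L2_semigroup_lift L2_semigroup_T T C]
  show "sg_domain MXY T = sg_domain MXY A \<inter> sg_domain MXY SY.lift" by (rule *(1))
  show "u \<in> sg_domain MXY T \<Longrightarrow> sg_form MXY T u u = sg_form MXY A u u + sg_form MXY SY.lift u u" by (rule *(2))
qed

lemma prod_domain_eq: "\<F>XY = sg_domain MXY T"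
proof -
  have "u \<in> L2_sections_fst MX MY \<E>X \<F>X \<longleftrightarrow> u \<in> sg_domain MXY A" for u
    unfolding L2_sections_fst_swap[OF X.sigma_finite_measure_axioms Y.sigma_finite_measure_axioms]
      SX.L2_sections_snd_eq[OF SX] sg_domain_A ..
  then show ?thesis
    unfolding prod_domain_def T_domain_form(1) SY.L2_sections_snd_eq[OF SY] by blast
qed

lemma prod_form_lift:
  assumes "u \<in> \<F>XY" "v \<in> \<F>XY"
  shows "\<E>XY u v = sg_form (MY \<Otimes>\<^sub>M MX) SX.lift (sw u) (sw v) + sg_form MXY SY.lift u v"
  using assms SX.sg_form_lift_eq[OF SX, of "sw u" "sw v", unfolded fst_conv snd_conv] SY.sg_form_lift_eq[OF SY, of u v]
  unfolding prod_domain_eq T_domain_form(1) prod_form_def by (simp add: sg_domain_A)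

text \<open>On the diagonal the form of \<open>T\<close> is the sum of the forms of \<open>A\<close> and \<open>SY.lift\<close>, and each summand
  is the integral of the form values of the sections. Both sides are bilinear, so the general case
  is polarization.\<close>

lemma semigroup_of_prod_form: "semigroup_of_form MXY \<E>XY \<F>XY T"
  unfolding semigroup_of_form_iff[OF L2_semigroup_T]
proof (intro conjI ballI prod_domain_eq)
  note ST = semigroup_of_form_iff[OF L2_semigroup_T, of "sg_form MXY T" "sg_domain MXY T", simplified]
    and SLX = semigroup_of_form_iff[OF SX.L2_semigroup_lift, of "sg_form (MY \<Otimes>\<^sub>M MX) SX.lift" "sg_domain (MY \<Otimes>\<^sub>M MX) SX.lift", simplified]
    and SLY = semigroup_of_form_iff[OF SY.L2_semigroup_lift, of "sg_form MXY SY.lift" "sg_domain MXY SY.lift", simplified]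
  have diag: "sg_form MXY T w w = sg_form (MY \<Otimes>\<^sub>M MX) SX.lift (sw w) (sw w) + sg_form MXY SY.lift w w"
    if "w \<in> sg_domain MXY T" for w
    using T_domain_form(2)[OF that] sg_form_A[of w] that unfolding T_domain_form(1) by simp
  fix u v assume uv: "u \<in> \<F>XY" "v \<in> \<F>XY"
  then have u: "u \<in> sg_domain MXY T" and v: "v \<in> sg_domain MXY T" by (simp_all add: prod_domain_eq)
  have uX: "sw u \<in> sg_domain (MY \<Otimes>\<^sub>M MX) SX.lift" and vX: "sw v \<in> sg_domain (MY \<Otimes>\<^sub>M MX) SX.lift"
    and uY: "u \<in> sg_domain MXY SY.lift" and vY: "v \<in> sg_domain MXY SY.lift"
    using u v unfolding T_domain_form(1) by (simp_all add: sg_domain_A)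
  show "\<E>XY u v = sg_form MXY T u v"
    unfolding prod_form_lift[OF uv] form_polarization[OF symmetric_form_sof[OF ST] u v]
      form_polarization[OF symmetric_form_sof[OF SLX] uX vX] form_polarization[OF symmetric_form_sof[OF SLY] uY vY]
      diag[OF form_add_mem[OF symmetric_form_sof[OF ST] u v]] diag[OF form_diff_mem[OF symmetric_form_sof[OF ST] u v]]
    by (simp add: diff_divide_distrib add_divide_distrib)
qed

lemma dirichlet_form_prod:
  assumes "markovian_form \<E>X \<F>X" "markovian_form \<E>Y \<F>Y"
  shows "dirichlet_form MXY \<E>XY \<F>XY"
  unfolding dirichlet_form_def
proof (intro conjI subsetI ballI allI impI)
  note S = semigroup_of_prod_form
  show "u \<in> L2 MXY" if "u \<in> \<F>XY" for u using sof_L2[OF S that] .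
  show "ae_invariant MXY \<E>XY \<F>XY" by (rule ae_invariant_sof[OF S])
  show "\<exists>v\<in>\<F>XY. L2_norm MXY (\<lambda>x. u x - v x) < \<epsilon>" if "u \<in> L2 MXY" "0 < \<epsilon>" for u \<epsilon>
    by (rule sof_dense[OF S that])
  show "symmetric_form \<E>XY \<F>XY" by (rule symmetric_form_sof[OF S])
  show "form_closed MXY \<E>XY \<F>XY" by (rule form_closed_sof[OF S])
  show "markovian_form \<E>XY \<F>XY"
    unfolding markovian_form_def
  proof (intro ballI)
    fix u assume u: "u \<in> \<F>XY"
    then have uX: "sw u \<in> sg_domain (MY \<Otimes>\<^sub>M MX) SX.lift" and uY: "u \<in> sg_domain MXY SY.lift"
      unfolding prod_domain_eq T_domain_form(1) by (simp_all add: sg_domain_A)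
    let ?v = "\<lambda>x. min (max (u x) 0) 1"
    note cX = SX.sg_domain_lift_unit_contraction[OF SX assms(1) uX]
      and cY = SY.sg_domain_lift_unit_contraction[OF SY assms(2) uY]
    have v: "?v \<in> \<F>XY"
      unfolding prod_domain_eq T_domain_form(1) using cX(1) cY(1) by (simp add: sg_domain_A)
    show "?v \<in> \<F>XY \<and> \<E>XY ?v ?v \<le> \<E>XY u u"
      using v cX(2) cY(2) by (simp add: prod_form_lift[OF v v] prod_form_lift[OF u u])
  qed
qed

end

section \<open>Tensor products of function spaces\<close>

lemma tensor_span_zero: "(\<lambda>_. 0) \<in> tensor_span C D"
  unfolding tensor_span_def by (auto intro!: exI[of _ 0])

lemma tensor_span_step:
  assumes w: "w \<in> tensor_span C D" and f: "f \<in> C" and g: "g \<in> D"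
  shows "(\<lambda>z. w z + c * (f (fst z) * g (snd z))) \<in> tensor_span C D"
proof -
  obtain n :: nat and c' f' g' where w_eq: "w = (\<lambda>(x, y). \<Sum>i<n. c' i * (f' i x * g' i y))"
    and "\<forall>i<n. f' i \<in> C" "\<forall>i<n. g' i \<in> D"
    using w unfolding tensor_span_def by blast
  then show ?thesis
    unfolding tensor_span_def using f g
    by (auto intro!: exI[of _ "Suc n"] exI[of _ "c'(n := c)"] exI[of _ "f'(n := f)"] exI[of _ "g'(n := g)"]
        simp: fun_eq_iff)
qed

lemma tensor_span_induct [consumes 1, case_names zero step]:
  assumes w: "w \<in> tensor_span C D" and zero: "P (\<lambda>_. 0)"
    and step: "\<And>w c f g. w \<in> tensor_span C D \<Longrightarrow> P w \<Longrightarrow> f \<in> C \<Longrightarrow> g \<in> D \<Longrightarrow>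
      P (\<lambda>z. w z + c * (f (fst z) * g (snd z)))"
  shows "P w"
proof -
  obtain n :: nat and c f g where w_eq: "w = (\<lambda>(x, y). \<Sum>i<n. c i * (f i x * g i y))"
    and f: "\<forall>i<n. f i \<in> C" and g: "\<forall>i<n. g i \<in> D"
    using w unfolding tensor_span_def by blast
  have "m \<le> n \<Longrightarrow> (\<lambda>(x, y). \<Sum>i<m. c i * (f i x * g i y)) \<in> tensor_span C D \<and>
      P (\<lambda>(x, y). \<Sum>i<m. c i * (f i x * g i y))" for m
  proof (induction m)
    case 0
    then show ?case using tensor_span_zero[of C D] zero by (simp add: case_prod_beta')
  next
    case (Suc m)
    have eq: "(\<lambda>(x, y). \<Sum>i<Suc m. c i * (f i x * g i y)) =
        (\<lambda>z. (\<lambda>(x, y). \<Sum>i<m. c i * (f i x * g i y)) z + c m * (f m (fst z) * g m (snd z)))"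
      by (simp add: case_prod_beta')
    show ?case
      unfolding eq using Suc f g by (intro conjI tensor_span_step step) auto
  qed
  then show ?thesis using w_eq by simp
qed

lemma tensor_span_tensor: "f \<in> C \<Longrightarrow> g \<in> D \<Longrightarrow> (\<lambda>z. c * (f (fst z) * g (snd z))) \<in> tensor_span C D"
  using tensor_span_step[OF tensor_span_zero] by fastforce

lemma tensor_span_add:
  assumes u: "u \<in> tensor_span C D" and v: "v \<in> tensor_span C D"
  shows "(\<lambda>z. u z + v z) \<in> tensor_span C D"
  using v
proof (induction rule: tensor_span_induct)
  case (step w c f g)
  then show ?case using tensor_span_step[OF step(4) step(2,3), of c] by (simp add: add.assoc)
qed (use u in simp)

lemma tensor_span_scale:
  assumes "u \<in> tensor_span C D"
  shows "(\<lambda>z. k * u z) \<in> tensor_span C D"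
  using assms
proof (induction rule: tensor_span_induct)
  case (step w c f g)
  then show ?case using tensor_span_step[OF step(4) step(2,3), of "k * c"] by (simp add: distrib_left mult.assoc)
qed (simp add: tensor_span_zero)

lemma tensor_span_sum:
  "finite I \<Longrightarrow> (\<And>i. i \<in> I \<Longrightarrow> u i \<in> tensor_span C D) \<Longrightarrow> (\<lambda>z. \<Sum>i\<in>I. u i z) \<in> tensor_span C D"
  by (induction rule: finite_induct) (simp_all add: tensor_span_zero tensor_span_add)

text \<open>Membership of \<open>w\<close> in the closure of \<open>V\<close> for the seminorm of \<open>B\<close>; the seminorms in question are
  those of \<open>L2_inner\<close> and \<open>form1\<close>.\<close>

definition adherent :: "'a form \<Rightarrow> ('a \<Rightarrow> real) set \<Rightarrow> ('a \<Rightarrow> real) \<Rightarrow> bool" where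
  "adherent B V w \<longleftrightarrow> (\<forall>e>0. \<exists>v\<in>V. sqrt (B (\<lambda>x. w x - v x) (\<lambda>x. w x - v x)) < e)"

context
  fixes B :: "'a form" and W V :: "('a \<Rightarrow> real) set"
  assumes S: "symmetric_form B W" and V: "V \<subseteq> W"
begin

lemma adherentI:
  assumes w: "w \<in> W" and approx: "\<And>e. 0 < e \<Longrightarrow> \<exists>w'\<in>W. adherent B V w' \<and> sqrt (B (\<lambda>x. w x - w' x) (\<lambda>x. w x - w' x)) < e"
  shows "adherent B V w"
  unfolding adherent_def
proof (intro allI impI)
  fix e :: real assume e: "0 < e"
  then obtain w' where w': "w' \<in> W" "adherent B V w'" "sqrt (B (\<lambda>x. w x - w' x) (\<lambda>x. w x - w' x)) < e/2"
    using approx[of "e/2"] by auto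
  obtain v where v: "v \<in> V" "sqrt (B (\<lambda>x. w' x - v x) (\<lambda>x. w' x - v x)) < e/2"
    using w'(2) e unfolding adherent_def by (meson half_gt_zero)
  have vW: "v \<in> W" using v(1) V by auto
  have "sqrt (B (\<lambda>x. w x - v x) (\<lambda>x. w x - v x)) < e"
    using form_triangle[OF S form_diff_mem[OF S w w'(1)] form_diff_mem[OF S w'(1) vW]] w'(3) v(2) by simp
  with v(1) show "\<exists>v\<in>V. sqrt (B (\<lambda>x. w x - v x) (\<lambda>x. w x - v x)) < e" by blast
qed

lemma adherent_mem: "v \<in> V \<Longrightarrow> adherent B V v"
  unfolding adherent_def using form_zero[OF S] by (auto intro!: bexI[of _ v])

lemma adherent_add:
  assumes add: "\<And>u v. u \<in> V \<Longrightarrow> v \<in> V \<Longrightarrow> (\<lambda>x. u x + v x) \<in> V"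
    and u: "u \<in> W" "adherent B V u" and w: "w \<in> W" "adherent B V w"
  shows "adherent B V (\<lambda>x. u x + w x)"
  unfolding adherent_def
proof (intro allI impI)
  fix e :: real assume e: "0 < e"
  obtain u' where u': "u' \<in> V" "sqrt (B (\<lambda>x. u x - u' x) (\<lambda>x. u x - u' x)) < e/2"
    using u(2) e unfolding adherent_def by (meson half_gt_zero)
  obtain w' where w': "w' \<in> V" "sqrt (B (\<lambda>x. w x - w' x) (\<lambda>x. w x - w' x)) < e/2"
    using w(2) e unfolding adherent_def by (meson half_gt_zero)
  have mem: "(\<lambda>x. u x - u' x) \<in> W" "(\<lambda>x. w x - w' x) \<in> W"
    using u'(1) w'(1) V by (auto intro: form_diff_mem[OF S] u w)
  have eq: "(\<lambda>x. u x + w x - (u' x + w' x)) = (\<lambda>x. (u x - u' x) + (w x - w' x))" by (simp add: fun_eq_iff)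
  have "sqrt (B (\<lambda>x. u x + w x - (u' x + w' x)) (\<lambda>x. u x + w x - (u' x + w' x))) < e"
    unfolding eq using form_triangle[OF S mem] u'(2) w'(2) by linarith
  with add[OF u'(1) w'(1)] show "\<exists>v\<in>V. sqrt (B (\<lambda>x. u x + w x - v x) (\<lambda>x. u x + w x - v x)) < e"
    by (intro bexI[of _ "\<lambda>x. u' x + w' x"])
qed

lemma adherent_scale:
  assumes scale: "\<And>c u. u \<in> V \<Longrightarrow> (\<lambda>x. c * u x) \<in> V" and u: "u \<in> W" "adherent B V u"
  shows "adherent B V (\<lambda>x. c * u x)"
  unfolding adherent_def
proof (intro allI impI)
  fix e :: real assume e: "0 < e"
  then have "0 < e / (\<bar>c\<bar> + 1)" by simp
  then obtain u' where u': "u' \<in> V" "sqrt (B (\<lambda>x. u x - u' x) (\<lambda>x. u x - u' x)) < e / (\<bar>c\<bar> + 1)"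
    using u(2) unfolding adherent_def by blast
  let ?n = "sqrt (B (\<lambda>x. u x - u' x) (\<lambda>x. u x - u' x))"
  have mem: "(\<lambda>x. u x - u' x) \<in> W" using u'(1) V by (auto intro: form_diff_mem[OF S] u)
  have eq: "(\<lambda>x. c * u x - c * u' x) = (\<lambda>x. c * (u x - u' x))" by (simp add: fun_eq_iff algebra_simps)
  have "0 \<le> ?n" using form_nonneg[OF S mem] by simp
  then have "\<bar>c\<bar> * ?n \<le> (\<bar>c\<bar> + 1) * ?n" by (intro mult_right_mono) simp_all
  also have "\<dots> < e" using u'(2) by (simp add: field_simps)
  finally have "sqrt (B (\<lambda>x. c * u x - c * u' x) (\<lambda>x. c * u x - c * u' x)) < e"
    unfolding eq form_norm_scale[OF S mem] .
  with scale[OF u'(1)] show "\<exists>v\<in>V. sqrt (B (\<lambda>x. c * u x - v x) (\<lambda>x. c * u x - v x)) < e"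
    by (intro bexI[of _ "\<lambda>x. c * u' x"])
qed

end

lemma adherent_L2_dominated:
  assumes V: "V \<subseteq> L2 M" and w: "w \<in> borel_measurable M" and u: "\<And>n. u n \<in> L2 M" "\<And>n. adherent (L2_inner M) V (u n)"
    and g: "g \<in> L2 M" and bound: "\<And>n x. x \<in> space M \<Longrightarrow> \<bar>u n x\<bar> \<le> g x" and bound': "\<And>x. x \<in> space M \<Longrightarrow> \<bar>w x\<bar> \<le> g x"
    and lim: "\<And>x. x \<in> space M \<Longrightarrow> (\<lambda>n. u n x) \<longlonglongrightarrow> w x"
  shows "w \<in> L2 M" and "adherent (L2_inner M) V w"
proof -
  have sq: "(f x)\<^sup>2 \<le> (g x)\<^sup>2" if "\<bar>f x\<bar> \<le> g x" for f :: "'a \<Rightarrow> real" and x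
    using power_mono[OF that, of 2] by simp
  have sqw: "(w x)\<^sup>2 \<le> (g x)\<^sup>2" if "x \<in> space M" for x using sq[of w x] bound'[OF that] .
  show wL: "w \<in> L2 M"
    by (rule L2_I[OF w], rule Bochner_Integration.integrable_bound[OF L2_square_integrable[OF g]])
      (use w sqw in \<open>auto intro!: AE_I2\<close>)
  have d: "(\<lambda>x. w x - u n x) \<in> L2 M" for n by (rule L2_diff[OF wL u(1)])
  have "(\<lambda>n. LINT x|M. (w x - u n x)\<^sup>2) \<longlonglongrightarrow> (LINT x|M. 0)"
  proof (rule integral_dominated_convergence[where w="\<lambda>x. 4 * (g x)\<^sup>2"])
    show "integrable M (\<lambda>x. 4 * (g x)\<^sup>2)" using L2_square_integrable[OF g] by simp
    show "AE x in M. (\<lambda>n. (w x - u n x)\<^sup>2) \<longlonglongrightarrow> 0"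
    proof (rule AE_I2)
      fix x assume "x \<in> space M"
      from tendsto_power[OF tendsto_diff[OF tendsto_const lim[OF this]], of "w x" 2]
      show "(\<lambda>n. (w x - u n x)\<^sup>2) \<longlonglongrightarrow> 0" by simp
    qed
    show "AE x in M. norm ((w x - u n x)\<^sup>2) \<le> 4 * (g x)\<^sup>2" for n
    proof (rule AE_I2)
      fix x assume x: "x \<in> space M"
      have "\<bar>w x - u n x\<bar> \<le> 2 * g x" using bound[OF x, of n] bound'[OF x] by linarith
      from power_mono[OF this, of 2] show "norm ((w x - u n x)\<^sup>2) \<le> 4 * (g x)\<^sup>2" by (simp add: power_mult_distrib)
    qed
  qed (use L2_square_integrable[OF d] in \<open>auto dest: borel_measurable_integrable\<close>)
  then have "(\<lambda>n. sqrt (LINT x|M. (w x - u n x)\<^sup>2)) \<longlonglongrightarrow> sqrt 0" by (intro tendsto_real_sqrt) simp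
  then have conv: "(\<lambda>n. sqrt (L2_inner M (\<lambda>x. w x - u n x) (\<lambda>x. w x - u n x))) \<longlonglongrightarrow> 0"
    by (simp add: L2_inner_def power2_eq_square)
  show "adherent (L2_inner M) V w"
  proof (rule adherentI[OF symmetric_form_L2 V wL])
    fix e :: real assume "0 < e"
    from order_tendstoD(2)[OF conv this] obtain n where
      "sqrt (L2_inner M (\<lambda>x. w x - u n x) (\<lambda>x. w x - u n x)) < e" by (auto simp: eventually_sequentially)
    with u show "\<exists>w'\<in>L2 M. adherent (L2_inner M) V w' \<and> sqrt (L2_inner M (\<lambda>x. w x - w' x) (\<lambda>x. w x - w' x)) < e" by blast
  qed
qed

lemma indicator_L2: "A \<in> sets M \<Longrightarrow> emeasure M A < \<infinity> \<Longrightarrow> (indicator A :: 'a \<Rightarrow> real) \<in> L2 M"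
proof (rule L2_I)
  assume A: "A \<in> sets M" "emeasure M A < \<infinity>"
  have "(\<lambda>x. (indicat_real A x)\<^sup>2) = indicat_real A" by (auto simp: indicator_def)
  then show "integrable M (\<lambda>x. (indicat_real A x)\<^sup>2)" using integrable_real_indicator[OF A] by simp
qed simp

context pair_sigma_finite
begin

lemma tensor_L2:
  assumes f: "f \<in> L2 M1" and g: "g \<in> L2 M2"
  shows "(\<lambda>z. f (fst z) * g (snd z)) \<in> L2 (M1 \<Otimes>\<^sub>M M2)"
    and "L2_inner (M1 \<Otimes>\<^sub>M M2) (\<lambda>z. f (fst z) * g (snd z)) (\<lambda>z. f (fst z) * g (snd z)) = L2_inner M1 f f * L2_inner M2 g g"
proof -
  have [measurable]: "f \<in> borel_measurable M1" "g \<in> borel_measurable M2" using f g by (auto intro: L2_measurable)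
  have "(\<integral>\<^sup>+z. ennreal ((f (fst z) * g (snd z))\<^sup>2) \<partial>(M1 \<Otimes>\<^sub>M M2)) =
      (\<integral>\<^sup>+x. \<integral>\<^sup>+y. ennreal ((f x * g y)\<^sup>2) \<partial>M2 \<partial>M1)"
    by (subst M2.nn_integral_fst[symmetric]) simp_all
  also have "\<dots> = (\<integral>\<^sup>+x. \<integral>\<^sup>+y. ennreal ((f x)\<^sup>2) * ennreal ((g y)\<^sup>2) \<partial>M2 \<partial>M1)"
    by (simp add: power_mult_distrib ennreal_mult)
  also have "\<dots> = (\<integral>\<^sup>+x. ennreal ((f x)\<^sup>2) \<partial>M1) * (\<integral>\<^sup>+y. ennreal ((g y)\<^sup>2) \<partial>M2)"
    by (simp add: nn_integral_cmult nn_integral_multc)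
  also have "\<dots> = ennreal (L2_inner M1 f f * L2_inner M2 g g)"
    using form_nonneg[OF symmetric_form_L2 f] form_nonneg[OF symmetric_form_L2 g]
    by (simp add: L2_inner_nn_integral[OF f, symmetric] L2_inner_nn_integral[OF g, symmetric] ennreal_mult)
  finally have eq: "(\<integral>\<^sup>+z. ennreal ((f (fst z) * g (snd z))\<^sup>2) \<partial>(M1 \<Otimes>\<^sub>M M2)) = ennreal (L2_inner M1 f f * L2_inner M2 g g)" .
  then show fg: "(\<lambda>z. f (fst z) * g (snd z)) \<in> L2 (M1 \<Otimes>\<^sub>M M2)" by (simp add: L2_iff_nn_integral)
  show "L2_inner (M1 \<Otimes>\<^sub>M M2) (\<lambda>z. f (fst z) * g (snd z)) (\<lambda>z. f (fst z) * g (snd z)) = L2_inner M1 f f * L2_inner M2 g g"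
    using eq unfolding L2_inner_nn_integral[OF fg, symmetric]
    by (subst (asm) ennreal_inj)
      (auto intro!: mult_nonneg_nonneg form_nonneg[OF symmetric_form_L2] fg f g)
qed

lemma tensor_span_L2: "tensor_span (L2 M1) (L2 M2) \<subseteq> L2 (M1 \<Otimes>\<^sub>M M2)"
proof
  fix w assume "w \<in> tensor_span (L2 M1) (L2 M2)"
  then show "w \<in> L2 (M1 \<Otimes>\<^sub>M M2)"
    by (induction rule: tensor_span_induct) (auto intro!: L2_zero L2_add L2_cmult tensor_L2(1))
qed

text \<open>Indicators of rectangles of finite measure are tensors; a Dynkin argument inside an
  exhausting sequence of such rectangles reaches all measurable sets of finite measure.\<close>

lemma tensor_span_dense_L2:
  assumes w: "w \<in> L2 (M1 \<Otimes>\<^sub>M M2)"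
  shows "adherent (L2_inner (M1 \<Otimes>\<^sub>M M2)) (tensor_span (L2 M1) (L2 M2)) w"
proof -
  let ?M = "M1 \<Otimes>\<^sub>M M2" and ?V = "tensor_span (L2 M1) (L2 M2)"
  let ?adh = "adherent (L2_inner (M1 \<Otimes>\<^sub>M M2)) (tensor_span (L2 M1) (L2 M2))"
  note V = tensor_span_L2
  have adh_add: "?adh (\<lambda>x. u x + v x)" if "u \<in> L2 ?M" "?adh u" "v \<in> L2 ?M" "?adh v" for u v
    by (rule adherent_add[OF symmetric_form_L2 V _ that]) (rule tensor_span_add)
  have adh_scale: "?adh (\<lambda>x. c * u x)" if "u \<in> L2 ?M" "?adh u" for c u
    by (rule adherent_scale[OF symmetric_form_L2 V _ that]) (rule tensor_span_scale)
  obtain A where A: "range A \<subseteq> sets M1" "(\<Union>i. A i) = space M1" "\<And>i::nat. emeasure M1 (A i) \<noteq> \<infinity>" "incseq A"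
    using M1.sigma_finite_incseq by blast
  obtain B where B: "range B \<subseteq> sets M2" "(\<Union>i. B i) = space M2" "\<And>i::nat. emeasure M2 (B i) \<noteq> \<infinity>" "incseq B"
    using M2.sigma_finite_incseq by blast
  have rect: "indicator (a \<times> b) \<in> ?V"
    if "a \<in> sets M1" "emeasure M1 a < \<infinity>" "b \<in> sets M2" "emeasure M2 b < \<infinity>" for a b
  proof -
    have "(\<lambda>z. 1 * (indicat_real a (fst z) * indicat_real b (snd z))) \<in> ?V"
      by (rule tensor_span_tensor[OF indicator_L2[OF that(1,2)] indicator_L2[OF that(3,4)]])
    moreover have "(\<lambda>z. 1 * (indicat_real a (fst z) * indicat_real b (snd z))) = indicator (a \<times> b)"
      by (simp add: fun_eq_iff indicator_times)
    ultimately show ?thesis by simp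
  qed
  have in_rect: "indicator (S \<inter> R) \<in> L2 ?M \<and> ?adh (indicator (S \<inter> R))"
    if S: "S \<in> sets ?M" and R: "R = A n \<times> B n" for S R and n :: nat
  proof -
    have An: "A n \<in> sets M1" "emeasure M1 (A n) < \<infinity>" and Bn: "B n \<in> sets M2" "emeasure M2 (B n) < \<infinity>"
      using A B by (auto simp: less_top[symmetric])
    have Rs: "R \<in> sets ?M" unfolding R using An Bn by simp
    have Rfin: "emeasure ?M R < \<infinity>"
      unfolding R using M2.emeasure_pair_measure_Times[OF An(1) Bn(1)] An(2) Bn(2) by (simp add: ennreal_mult_less_top)
    have L: "indicator (S \<inter> R) \<in> L2 ?M" if "S \<in> sets ?M" for S
    proof (rule indicator_L2)
      show "S \<inter> R \<in> sets ?M" using that Rs by auto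
      have "emeasure ?M (S \<inter> R) \<le> emeasure ?M R" using Rs by (intro emeasure_mono) auto
      then show "emeasure ?M (S \<inter> R) < \<infinity>" using Rfin by simp
    qed
    have adhR: "?adh (indicator R)"
      unfolding R by (rule adherent_mem[OF symmetric_form_L2 V rect[OF An Bn]])
    have S': "S \<in> sigma_sets (space M1 \<times> space M2) {a \<times> b |a b. a \<in> sets M1 \<and> b \<in> sets M2}"
      using S by (simp add: sets_pair_measure)
    have "?adh (indicator (S \<inter> R))"
      using Int_stable_pair_measure_generator pair_measure_closed S'
    proof (induction rule: sigma_sets_induct_disjoint)
      case (basic S)
      then obtain a b where ab: "a \<in> sets M1" "b \<in> sets M2" "S = a \<times> b" by auto
      have "S \<inter> R = (a \<inter> A n) \<times> (b \<inter> B n)" using ab R by auto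
      moreover have "indicator ((a \<inter> A n) \<times> (b \<inter> B n)) \<in> ?V"
      proof (rule rect)
        have "emeasure M1 (a \<inter> A n) \<le> emeasure M1 (A n)" using An by (intro emeasure_mono) auto
        then show "emeasure M1 (a \<inter> A n) < \<infinity>" using An(2) by simp
        have "emeasure M2 (b \<inter> B n) \<le> emeasure M2 (B n)" using Bn by (intro emeasure_mono) auto
        then show "emeasure M2 (b \<inter> B n) < \<infinity>" using Bn(2) by simp
      qed (use ab An Bn in auto)
      ultimately show ?case using adherent_mem[OF symmetric_form_L2 V] by simp
    next
      case empty
      show ?case using adherent_mem[OF symmetric_form_L2 V tensor_span_zero] by (simp add: indicator_def)
    next
      case (compl S)
      then have S: "S \<in> sets ?M" by (simp add: sets_pair_measure)
      have "R \<subseteq> space M1 \<times> space M2" using sets.sets_into_space[OF Rs] by (simp add: space_pair_measure)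
      then have eq: "indicat_real ((space M1 \<times> space M2 - S) \<inter> R) = (\<lambda>z. indicat_real R z + (-1) * indicat_real (S \<inter> R) z)"
        by (auto simp: indicator_def fun_eq_iff)
      have RL: "indicat_real R \<in> L2 ?M" by (rule indicator_L2[OF Rs Rfin])
      show ?case
        unfolding eq by (rule adh_add[OF RL adhR L2_cmult[OF L[OF S]] adh_scale[OF L[OF S] compl(2)]])
    next
      case (union S)
      then have Ss: "S i \<in> sets ?M" for i using union(2) by (auto simp: sets_pair_measure)
      have US: "(\<Union>i. S i) \<in> sets ?M" using Ss by auto
      define u where "u k = (\<lambda>z. \<Sum>i<k. indicat_real (S i \<inter> R) z)" for k
      have u_eq: "u k = indicat_real ((\<Union>i<k. S i) \<inter> R)" for k
      proof (induction k)
        case (Suc k)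
        have "S i \<inter> S k = {}" if "i < k" for i
          by (rule disjoint_family_onD[OF union(1)]) (use that in auto)
        then have "(\<Union>i<k. S i) \<inter> S k = {}" by blast
        moreover have "u (Suc k) = (\<lambda>z. u k z + indicat_real (S k \<inter> R) z)" by (simp add: u_def)
        moreover have "indicat_real ((\<Union>i<Suc k. S i) \<inter> R) z = indicat_real ((\<Union>i<k. S i) \<inter> R) z + indicat_real (S k \<inter> R) z"
          if "(\<Union>i<k. S i) \<inter> S k = {}" for z
          using that unfolding lessThan_Suc UN_insert indicator_def by auto
        ultimately show ?case unfolding Suc by (simp add: fun_eq_iff)
      qed (simp add: u_def fun_eq_iff)
      have u: "u k \<in> L2 ?M \<and> ?adh (u k)" for k
      proof (induction k)
        case 0
        then show ?case using L2_zero adherent_mem[OF symmetric_form_L2 V tensor_span_zero] by (simp add: u_def)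
      next
        case (Suc k)
        have eq: "u (Suc k) = (\<lambda>z. u k z + indicat_real (S k \<inter> R) z)" by (simp add: u_def)
        show ?case unfolding eq
          using L2_add[OF Suc[THEN conjunct1] L[OF Ss]]
            adh_add[OF Suc[THEN conjunct1] Suc[THEN conjunct2] L[OF Ss] union(3)] by (rule conjI)
      qed
      show ?case
      proof (rule adherent_L2_dominated(2)[OF V, where u=u and g="indicat_real R"])
        show "indicat_real ((\<Union>i. S i) \<inter> R) \<in> borel_measurable ?M" by (rule L2_measurable[OF L[OF US]])
        show "indicat_real R \<in> L2 ?M" by (rule indicator_L2[OF Rs Rfin])
        fix z
        show "(\<lambda>k. u k z) \<longlonglongrightarrow> indicat_real ((\<Union>i. S i) \<inter> R) z"
        proof (cases "z \<in> (\<Union>i. S i) \<inter> R")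
          case True
          then obtain i where i: "z \<in> S i" "z \<in> R" by auto
          then have "u k z = 1" if "k > i" for k using that by (auto simp: u_eq indicator_def)
          then show ?thesis using True
            by (intro tendsto_eventually eventually_sequentiallyI[of "Suc i"]) auto
        next
          case False
          then have "u k z = 0" for k by (auto simp: u_eq indicator_def)
          then show ?thesis using False by simp
        qed
      qed (use u in \<open>auto simp: u_eq indicator_def\<close>)
    qed
    with L[OF S] show ?thesis by blast
  qed
  have set_adh: "?adh (indicator S)" if S: "S \<in> sets ?M" and L: "indicat_real S \<in> L2 ?M" for S
  proof (rule adherent_L2_dominated(2)[OF V, where u="\<lambda>n. indicat_real (S \<inter> (A n \<times> B n))" and g="indicat_real S"])
    fix z assume z: "z \<in> space ?M"
    then obtain i j where "fst z \<in> A i" "snd z \<in> B j" using A(2) B(2) by (force simp: space_pair_measure)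
    then have "z \<in> A n \<times> B n" if "n \<ge> max i j" for n
      using that A(4) B(4) unfolding incseq_def by (auto simp: mem_Times_iff; blast)
    then show "(\<lambda>n. indicat_real (S \<inter> (A n \<times> B n)) z) \<longlonglongrightarrow> indicat_real S z"
      by (intro tendsto_eventually eventually_sequentiallyI[of "max i j"]) (auto simp: indicator_def)
  qed (use in_rect[OF S refl] L in \<open>auto simp: indicator_def intro: L2_measurable\<close>)
  have dom: "u \<in> L2 ?M" if "v \<in> L2 ?M" "u \<in> borel_measurable ?M" "\<And>x. x \<in> space ?M \<Longrightarrow> \<bar>u x\<bar> \<le> \<bar>v x\<bar>" for u v
    by (rule L2_I[OF that(2)], rule Bochner_Integration.integrable_bound[OF L2_square_integrable[OF that(1)]])
      (use that(2,3) in \<open>auto intro!: AE_I2 simp: abs_le_square_iff\<close>)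
  have nonneg: "u \<in> L2 ?M \<longrightarrow> ?adh u" if u: "u \<in> borel_measurable ?M" "\<And>x. 0 \<le> u x" for u
    using u
  proof (induction rule: borel_measurable_induct_real)
    case (set S)
    then show ?case using set_adh by blast
  next
    case (mult u c)
    show ?case
    proof (cases "c = 0")
      case True
      then show ?thesis using adherent_mem[OF symmetric_form_L2 V tensor_span_zero] by simp
    next
      case False
      show ?thesis
      proof
        assume "(\<lambda>x. c * u x) \<in> L2 ?M"
        from L2_cmult[OF this, of "1/c"] False have uL: "u \<in> L2 ?M" by simp
        then show "?adh (\<lambda>x. c * u x)" using mult(4) by (intro adh_scale[OF uL]) blast
      qed
    qed
  next
    case (add u v)
    show ?case
    proof
      assume s: "(\<lambda>x. v x + u x) \<in> L2 ?M"
      have le: "\<bar>u x\<bar> \<le> \<bar>v x + u x\<bar>" "\<bar>v x\<bar> \<le> \<bar>v x + u x\<bar>" for x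
        using add.hyps(2)[of x] add.hyps(4)[of x] by simp_all
      have uv: "u \<in> L2 ?M" "v \<in> L2 ?M"
        by (rule dom[OF s add.hyps(1) le(1)], rule dom[OF s add.hyps(3) le(2)])
      show "?adh (\<lambda>x. v x + u x)"
        using add.IH uv
        by (intro adh_add) auto
    qed
  next
    case (seq U)
    show ?case
    proof
      assume uL: "u \<in> L2 ?M"
      have le: "U i x \<le> u x" if "x \<in> space ?M" for i x
        by (rule incseq_le[OF _ seq.hyps(4)[OF that]]) (use incseqD[OF seq.hyps(3)] in \<open>simp add: incseq_def le_fun_def del: split_paired_All\<close>)
      have UL: "U i \<in> L2 ?M" for i
        by (rule dom[OF uL seq.hyps(1)]) (use le seq.hyps(2) in \<open>simp add: order_trans[OF seq.hyps(2) le]\<close>)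
      show "?adh u"
        by (rule adherent_L2_dominated(2)[OF V, where u=U and g=u])
          (use uL UL seq.IH seq.hyps(2,4) le in \<open>auto intro: L2_measurable simp: order_trans[OF seq.hyps(2) le]\<close>)
    qed
  qed
  have "?adh (\<lambda>x. max (w x) 0 + (-1) * max (- w x) 0)"
    using L2_pos_part[OF w] L2_neg_part[OF w] nonneg[OF L2_measurable[OF L2_pos_part[OF w]]]
      nonneg[OF L2_measurable[OF L2_neg_part[OF w]]]
    by (intro adh_add adh_scale L2_cmult) auto
  moreover have "(\<lambda>x. max (w x) 0 + (-1) * max (- w x) 0) = w" by (auto simp: max_def)
  ultimately show ?thesis by simp
qed

end

section \<open>Tensors form a core\<close>

context product_of_forms
begin

text \<open>The form of \<open>f \<otimes> g\<close> is \<open>\<E>X f f * \<parallel>g\<parallel>\<^sup>2 + \<parallel>f\<parallel>\<^sup>2 * \<E>Y g g\<close>; the product of the squared form norms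
  exceeds the squared form norm by \<open>\<E>X f f * \<E>Y g g\<close>.\<close>

lemma tensor_prod_domain:
  assumes f: "f \<in> \<F>X" and g: "g \<in> \<F>Y"
  defines "u \<equiv> (\<lambda>z. f (fst z) * g (snd z))"
  shows "u \<in> \<F>XY" and "form1_norm MXY \<E>XY u \<le> form1_norm MX \<E>X f * form1_norm MY \<E>Y g"
proof -
  have fL: "f \<in> L2 MX" and gL: "g \<in> L2 MY" by (rule sof_L2[OF SX f], rule sof_L2[OF SY g])
  note SXf = symmetric_form_sof[OF SX] and SYf = symmetric_form_sof[OF SY]
    and SX1 = symmetric_form_form1[OF SX] and SY1 = symmetric_form_form1[OF SY]
  have secX: "(\<lambda>x. u (x, y)) = (\<lambda>x. g y * f x)" for y by (simp add: u_def mult.commute)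
  have secY: "(\<lambda>y. u (x, y)) = (\<lambda>y. f x * g y)" for x by (simp add: u_def)
  have memX: "(\<lambda>x. g y * f x) \<in> \<F>X" for y by (rule form_scale_mem[OF SXf f])
  have memY: "(\<lambda>y. f x * g y) \<in> \<F>Y" for x by (rule form_scale_mem[OF SYf g])
  have normX: "form1_norm MX \<E>X (\<lambda>x. g y * f x) = form1_norm MX \<E>X f * \<bar>g y\<bar>" for y
    unfolding form1_norm_def using form_norm_scale[OF SX1 f, of "g y"] by simp
  have normY: "form1_norm MY \<E>Y (\<lambda>y. f x * g y) = form1_norm MY \<E>Y g * \<bar>f x\<bar>" for x
    unfolding form1_norm_def using form_norm_scale[OF SY1 g, of "f x"] by simp
  have abs_L2: "(\<lambda>x. c * \<bar>h x\<bar>) \<in> L2 M" if "h \<in> L2 M" for c and h :: "'x \<Rightarrow> real" and M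
  proof (rule L2_cmult)
    show "(\<lambda>x. \<bar>h x\<bar>) \<in> L2 M" using that by (auto simp: L2_def)
  qed
  have uL: "u \<in> L2 MXY" unfolding u_def by (rule tensor_L2(1)[OF fL gL])
  show u: "u \<in> \<F>XY"
    unfolding prod_domain_def L2_sections_fst_def L2_sections_snd_def
    using uL by (simp add: secX secY memX memY normX normY abs_L2 fL gL)
  have "\<E>XY u u = (LINT y|MY. (g y)\<^sup>2 * \<E>X f f) + (LINT x|MX. (f x)\<^sup>2 * \<E>Y g g)"
    unfolding prod_form_def by (simp add: secX secY memX memY form_expand_scale[OF SXf f] form_expand_scale[OF SYf g])
  also have "\<dots> = L2_inner MY g g * \<E>X f f + L2_inner MX f f * \<E>Y g g"
    by (simp add: L2_inner_def power2_eq_square)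
  finally have "form1 MXY \<E>XY u u = L2_inner MY g g * \<E>X f f + L2_inner MX f f * \<E>Y g g + L2_inner MX f f * L2_inner MY g g"
    unfolding form1_def using tensor_L2(2)[OF fL gL] by (simp add: u_def)
  also have "\<dots> \<le> form1 MX \<E>X f f * form1 MY \<E>Y g g"
    using mult_nonneg_nonneg[OF form_nonneg[OF SXf f] form_nonneg[OF SYf g]]
    by (simp add: form1_def algebra_simps)
  finally show "form1_norm MXY \<E>XY u \<le> form1_norm MX \<E>X f * form1_norm MY \<E>Y g"
    unfolding form1_norm_def by (simp flip: real_sqrt_mult)
qed

lemma tensor_span_prod_domain: "C \<subseteq> \<F>X \<Longrightarrow> D \<subseteq> \<F>Y \<Longrightarrow> tensor_span C D \<subseteq> \<F>XY"
proof
  assume CD: "C \<subseteq> \<F>X" "D \<subseteq> \<F>Y"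
  note S = symmetric_form_sof[OF semigroup_of_prod_form]
  fix w assume "w \<in> tensor_span C D"
  then show "w \<in> \<F>XY"
  proof (induction rule: tensor_span_induct)
    case (step w c f g)
    then have "f \<in> \<F>X" "g \<in> \<F>Y" using CD by auto
    from tensor_prod_domain(1)[OF this] show ?case
      by (rule form_add_mem[OF S step.IH form_scale_mem[OF S]])
  qed (rule form_zero_mem[OF S])
qed

lemma form1_norm_cong_AE:
  assumes u: "u \<in> \<F>XY" and u': "u' \<in> borel_measurable MXY" and ae: "AE z in MXY. u z = u' z"
  shows "u' \<in> \<F>XY" and "form1_norm MXY \<E>XY u' = form1_norm MXY \<E>XY u"
proof -
  note S = symmetric_form_sof[OF semigroup_of_prod_form]
  have inv: "u' \<in> \<F>XY \<and> (\<forall>v\<in>\<F>XY. \<E>XY u v = \<E>XY u' v)"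
    using ae_invariant_sof[OF semigroup_of_prod_form] u u' ae unfolding ae_invariant_def by blast
  then show u'F: "u' \<in> \<F>XY" ..
  have "\<E>XY u' u' = \<E>XY u u'" using inv u'F by simp
  also have "\<dots> = \<E>XY u' u" by (rule form_sym[OF S u u'F])
  also have "\<dots> = \<E>XY u u" using inv u by simp
  finally have E: "\<E>XY u' u' = \<E>XY u u" .
  have "L2_inner MXY u' u' = L2_inner MXY u u"
    by (rule L2_inner_cong_AE)
      (use ae u' L2_measurable[OF sof_L2[OF semigroup_of_prod_form u]] in auto)
  then show "form1_norm MXY \<E>XY u' = form1_norm MXY \<E>XY u" by (simp add: form1_norm_def form1_def E)
qed

text \<open>The product kernel maps \<open>f \<otimes> g\<close> to \<open>p\<^sub>t f \<otimes> q\<^sub>t g\<close>, and the smoothing property puts both factors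
  into the domains of the forms.\<close>

lemma T_tensor_span:
  assumes t: "0 < t" and w: "w \<in> tensor_span (L2 MX) (L2 MY)"
  shows "\<exists>v\<in>tensor_span \<F>X \<F>Y. AE z in MXY. T t w z = v z"
  using w
proof (induction rule: tensor_span_induct)
  case zero
  have "T t (\<lambda>_. 0) z = 0" for z by (simp add: T_def kernel_op_def)
  then show ?case using tensor_span_zero by fastforce
next
  case (step w c f g)
  then obtain v where v: "v \<in> tensor_span \<F>X \<F>Y" "AE z in MXY. T t w z = v z" by blast
  let ?u = "\<lambda>z. f (fst z) * g (snd z)"
  have wL: "w \<in> L2 MXY" using step.hyps(1) tensor_span_L2 by blast
  have uL: "?u \<in> L2 MXY" by (rule tensor_L2(1)[OF step.hyps(2,3)])
  have fm: "f \<in> borel_measurable MX" and gm: "g \<in> borel_measurable MY"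
    using step.hyps(2,3) by (auto intro: L2_measurable)
  let ?f = "kernel_op (p t) f" and ?g = "kernel_op (q t) g"
  have lin: "AE z in MXY. T t (\<lambda>z. 1 * w z + c * ?u z) z = 1 * T t w z + c * T t ?u z"
    unfolding T_def by (rule symmetric_kernel.kernel_op_linear_AE[OF symmetric_kernel_T[OF t] wL uL])
  have gm': "?g \<in> borel_measurable MY" by (rule symmetric_kernel.kernel_op_measurable[OF Y.symmetric[OF t] gm])
  have lift_u: "SY.lift t ?u z = f (fst z) * ?g (snd z)" if z: "z \<in> space MXY" for z
  proof -
    obtain x y where z_eq: "z = (x, y)" and x: "x \<in> space MX" and y: "y \<in> space MY"
      using z by (auto simp: space_pair_measure)
    show ?thesis using SY.lift_sec[OF t L2_measurable[OF uL] x y] by (simp add: z_eq kernel_op_def)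
  qed
  have m1: "(\<lambda>z. f (fst z) * ?g (snd z)) \<in> borel_measurable MXY"
    by (intro borel_measurable_times measurable_compose[OF measurable_fst fm] measurable_compose[OF measurable_snd gm'])
  have A_eq: "A t (\<lambda>z. f (fst z) * ?g (snd z)) z = ?f (fst z) * ?g (snd z)" if z: "z \<in> space MXY" for z
  proof -
    obtain x y where z_eq: "z = (x, y)" and x: "x \<in> space MX" and y: "y \<in> space MY"
      using z by (auto simp: space_pair_measure)
    have "A t (\<lambda>z. f (fst z) * ?g (snd z)) (x, y) = kernel_op (p t) (\<lambda>x. f x * ?g y) x"
      unfolding A_def using kernel_op_prod_return_right[OF X.symmetric[OF t] m1 x y] by simp
    then show ?thesis by (simp add: z_eq kernel_op_def[of "p t"])
  qed
  have "AE z in MXY. A t (SY.lift t ?u) z = A t (\<lambda>z. f (fst z) * ?g (snd z)) z"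
    unfolding A_def
    by (rule symmetric_kernel.kernel_op_cong_AE[OF symmetric_kernel_A[OF t] AE_I2[OF lift_u] _ m1])
      (auto intro: L2_measurable[OF sg_L2[OF SY.L2_semigroup_lift t uL]])
  with A_lift_commute(1)[OF t t uL] AE_space have Tu: "AE z in MXY. T t ?u z = ?f (fst z) * ?g (snd z)"
    unfolding T_def by eventually_elim (simp add: A_eq)
  show ?case
  proof (rule bexI)
    show "(\<lambda>z. v z + c * (?f (fst z) * ?g (snd z))) \<in> tensor_span \<F>X \<F>Y"
      by (rule tensor_span_step[OF v(1) sof_smooth(1)[OF SX t step.hyps(2)] sof_smooth(1)[OF SY t step.hyps(3)]])
    show "AE z in MXY. T t (\<lambda>z. w z + c * ?u z) z = v z + c * (?f (fst z) * ?g (snd z))"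
      using lin v(2) Tu by eventually_elim simp
  qed
qed

text \<open>\<open>T\<^sub>t u\<close> approximates \<open>u\<close> in the form norm, and \<open>T\<^sub>t\<close> maps \<open>L\<^sup>2\<close>-convergent sequences to
  sequences that converge in the form norm; it also maps tensors of \<open>L\<^sup>2\<close>-functions to tensors of
  functions in the two domains.\<close>

lemma tensor_span_form_dense:
  assumes u: "u \<in> \<F>XY"
  shows "adherent (form1 MXY \<E>XY) (tensor_span \<F>X \<F>Y) u"
proof (rule adherentI[OF symmetric_form_form1[OF semigroup_of_prod_form] tensor_span_prod_domain[OF order_refl order_refl] u])
  note SF = semigroup_of_prod_form
  note S1 = symmetric_form_form1[OF SF]
  fix e :: real assume e: "0 < e"
  have uL: "u \<in> L2 MXY" by (rule sof_L2[OF SF u])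
  have "\<forall>\<^sub>F t in at_right 0. form1_norm MXY \<E>XY (\<lambda>z. T t u z - u z) < e"
    by (rule order_tendstoD(2)[OF sof_semigroup_tendsto[OF SF u] e])
  then obtain b where b: "0 < b" "\<And>t. 0 < t \<Longrightarrow> t < b \<Longrightarrow> form1_norm MXY \<E>XY (\<lambda>z. T t u z - u z) < e"
    by (auto simp: eventually_at_right_field)
  define t where "t = b / 2"
  have t: "0 < t" "t < b" using b(1) by (simp_all add: t_def)
  have Tu: "T t u \<in> \<F>XY" by (rule sof_smooth(1)[OF SF t(1) uL])
  have "adherent (form1 MXY \<E>XY) (tensor_span \<F>X \<F>Y) (T t u)"
    unfolding adherent_def
  proof (intro allI impI)
    fix \<delta> :: real assume \<delta>: "0 < \<delta>"
    define K where "K = 1 / (2 * t) + 1"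
    have K: "0 < K" using t(1) by (simp add: K_def add_pos_pos)
    have "0 < \<delta> / sqrt K" using \<delta> K by simp
    then obtain w where w: "w \<in> tensor_span (L2 MX) (L2 MY)"
      and uw: "sqrt (L2_inner MXY (\<lambda>z. u z - w z) (\<lambda>z. u z - w z)) < \<delta> / sqrt K"
      using tensor_span_dense_L2[OF uL] unfolding adherent_def by blast
    obtain v where v: "v \<in> tensor_span \<F>X \<F>Y" and Tw: "AE z in MXY. T t w z = v z"
      using T_tensor_span[OF t(1) w] by blast
    have wL: "w \<in> L2 MXY" using w tensor_span_L2 by blast
    have vF: "v \<in> \<F>XY" using v tensor_span_prod_domain[OF order_refl order_refl] by blast
    have d: "(\<lambda>z. u z - w z) \<in> L2 MXY" by (rule L2_diff[OF uL wL])
    let ?d = "T t (\<lambda>z. u z - w z)"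
    have dF: "?d \<in> \<F>XY" by (rule sof_smooth(1)[OF SF t(1) d])
    have "AE z in MXY. ?d z = T t u z - T t w z"
      using symmetric_kernel.kernel_op_linear_AE[OF symmetric_kernel_T[OF t(1)] uL wL, of 1 "-1"]
      unfolding T_def by simp
    with Tw have ae: "AE z in MXY. ?d z = T t u z - v z" by eventually_elim simp
    have m: "(\<lambda>z. T t u z - v z) \<in> borel_measurable MXY"
      by (rule L2_measurable[OF L2_diff[OF sof_L2[OF SF Tu] sof_L2[OF SF vF]]])
    have "form1 MXY \<E>XY ?d ?d \<le> L2_inner MXY (\<lambda>z. u z - w z) (\<lambda>z. u z - w z) * K"
      using sof_smooth(2)[OF SF t(1) d] sg_square_le[OF sof_semigroup[OF SF] t(1) d]
      unfolding form1_def K_def by (simp add: distrib_left)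
    then have "form1_norm MXY \<E>XY ?d \<le> sqrt (L2_inner MXY (\<lambda>z. u z - w z) (\<lambda>z. u z - w z)) * sqrt K"
      unfolding form1_norm_def real_sqrt_mult[symmetric] by simp
    also have "\<dots> < \<delta>" using uw K by (simp add: field_simps)
    finally have "form1_norm MXY \<E>XY (\<lambda>z. T t u z - v z) < \<delta>"
      using form1_norm_cong_AE(2)[OF dF m ae] by simp
    then show "\<exists>v\<in>tensor_span \<F>X \<F>Y. sqrt (form1 MXY \<E>XY (\<lambda>x. T t u x - v x) (\<lambda>x. T t u x - v x)) < \<delta>"
      using v by (auto simp: form1_norm_def)
  qed
  moreover have "sqrt (form1 MXY \<E>XY (\<lambda>z. u z - T t u z) (\<lambda>z. u z - T t u z)) < e"
    using b(2)[OF t] form_norm_minus_commute[OF S1 u Tu] by (simp add: form1_norm_def)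
  ultimately show "\<exists>w'\<in>\<F>XY. adherent (form1 MXY \<E>XY) (tensor_span \<F>X \<F>Y) w' \<and>
      sqrt (form1 MXY \<E>XY (\<lambda>x. u x - w' x) (\<lambda>x. u x - w' x)) < e" using Tu by blast
qed

lemma tensor_span_form_dense_core:
  assumes C: "C \<subseteq> \<F>X" "\<And>u e. u \<in> \<F>X \<Longrightarrow> 0 < e \<Longrightarrow> \<exists>v\<in>C. form1_norm MX \<E>X (\<lambda>x. u x - v x) < e"
    and D: "D \<subseteq> \<F>Y" "\<And>u e. u \<in> \<F>Y \<Longrightarrow> 0 < e \<Longrightarrow> \<exists>v\<in>D. form1_norm MY \<E>Y (\<lambda>x. u x - v x) < e"
    and u: "u \<in> \<F>XY"
  shows "adherent (form1 MXY \<E>XY) (tensor_span C D) u"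
proof -
  note S1 = symmetric_form_form1[OF semigroup_of_prod_form]
  note SXf = symmetric_form_sof[OF SX] and SYf = symmetric_form_sof[OF SY]
  note sub = tensor_span_prod_domain[OF C(1) D(1)]
  have tensor: "adherent (form1 MXY \<E>XY) (tensor_span C D) (\<lambda>z. f (fst z) * g (snd z))"
    if f: "f \<in> \<F>X" and g: "g \<in> \<F>Y" for f g
    unfolding adherent_def
  proof (intro allI impI)
    fix e :: real assume e: "0 < e"
    have n0: "0 \<le> form1_norm MX \<E>X h" if "h \<in> \<F>X" for h
      unfolding form1_norm_def using form_nonneg[OF symmetric_form_form1[OF SX] that] by simp
    have n0': "0 \<le> form1_norm MY \<E>Y h" if "h \<in> \<F>Y" for h
      unfolding form1_norm_def using form_nonneg[OF symmetric_form_form1[OF SY] that] by simp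
    define G where "G = form1_norm MY \<E>Y g + 1"
    have G: "0 < G" using n0'[OF g] by (simp add: G_def)
    obtain f' where f': "f' \<in> C" "form1_norm MX \<E>X (\<lambda>x. f x - f' x) < e / (2 * G)"
      using C(2)[OF f, of "e / (2 * G)"] e G by auto
    define H where "H = form1_norm MX \<E>X f' + 1"
    have f'F: "f' \<in> \<F>X" using f'(1) C(1) by auto
    have H: "0 < H" using n0[OF f'F] by (simp add: H_def)
    obtain g' where g': "g' \<in> D" "form1_norm MY \<E>Y (\<lambda>x. g x - g' x) < e / (2 * H)"
      using D(2)[OF g, of "e / (2 * H)"] e H by auto
    have g'F: "g' \<in> \<F>Y" using g'(1) D(1) by auto
    have df: "(\<lambda>x. f x - f' x) \<in> \<F>X" by (rule form_diff_mem[OF SXf f f'F])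
    have dg: "(\<lambda>x. g x - g' x) \<in> \<F>Y" by (rule form_diff_mem[OF SYf g g'F])
    let ?a = "\<lambda>z. (f (fst z) - f' (fst z)) * g (snd z)" and ?b = "\<lambda>z. f' (fst z) * (g (snd z) - g' (snd z))"
    have a: "?a \<in> \<F>XY" "form1_norm MXY \<E>XY ?a \<le> form1_norm MX \<E>X (\<lambda>x. f x - f' x) * form1_norm MY \<E>Y g"
      using tensor_prod_domain[OF df g] by auto
    have b: "?b \<in> \<F>XY" "form1_norm MXY \<E>XY ?b \<le> form1_norm MX \<E>X f' * form1_norm MY \<E>Y (\<lambda>x. g x - g' x)"
      using tensor_prod_domain[OF f'F dg] by auto
    have eq: "(\<lambda>z. f (fst z) * g (snd z) - 1 * (f' (fst z) * g' (snd z))) = (\<lambda>z. ?a z + ?b z)"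
      by (simp add: fun_eq_iff algebra_simps)
    have 1: "form1_norm MX \<E>X (\<lambda>x. f x - f' x) * form1_norm MY \<E>Y g \<le> e / (2 * G) * form1_norm MY \<E>Y g"
      using f'(2) by (intro mult_right_mono n0'[OF g]) simp
    also have "\<dots> < e / (2 * G) * G" using e G by (intro mult_strict_left_mono) (simp_all add: G_def)
    also have "\<dots> = e / 2" using G by simp
    finally have A: "form1_norm MXY \<E>XY ?a < e / 2" using a(2) by simp
    have "form1_norm MX \<E>X f' * form1_norm MY \<E>Y (\<lambda>x. g x - g' x) \<le> H * form1_norm MY \<E>Y (\<lambda>x. g x - g' x)"
      by (intro mult_right_mono n0'[OF dg]) (simp add: H_def)
    also have "\<dots> < H * (e / (2 * H))" using g'(2) H by (intro mult_strict_left_mono) simp_all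
    also have "\<dots> = e / 2" using H by simp
    finally have B: "form1_norm MXY \<E>XY ?b < e / 2" using b(2) by simp
    have "form1_norm MXY \<E>XY (\<lambda>z. f (fst z) * g (snd z) - 1 * (f' (fst z) * g' (snd z))) < e"
      unfolding eq using form_triangle[OF S1 a(1) b(1)] A B by (simp add: form1_norm_def)
    then show "\<exists>v\<in>tensor_span C D. sqrt (form1 MXY \<E>XY (\<lambda>x. f (fst x) * g (snd x) - v x) (\<lambda>x. f (fst x) * g (snd x) - v x)) < e"
      using tensor_span_tensor[OF f'(1) g'(1), of 1] unfolding form1_norm_def by (intro bexI)
  qed
  have "adherent (form1 MXY \<E>XY) (tensor_span C D) w" if "w \<in> tensor_span \<F>X \<F>Y" for w
    using that
  proof (induction rule: tensor_span_induct)
    case zero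
    show ?case by (rule adherent_mem[OF S1 sub tensor_span_zero])
  next
    case (step w c f g)
    have wF: "w \<in> \<F>XY" using step.hyps(1) tensor_span_prod_domain[OF order_refl order_refl] by blast
    note fgF = tensor_prod_domain(1)[OF step.hyps(2,3)]
    show ?case
      by (rule adherent_add[OF S1 sub _ wF step.IH form_scale_mem[OF S1 fgF] adherent_scale[OF S1 sub _ fgF tensor[OF step.hyps(2,3)]]])
        (rule tensor_span_add, assumption+, rule tensor_span_scale)
  qed
  then show ?thesis
  proof (intro adherentI[OF S1 sub u])
    assume *: "\<And>w. w \<in> tensor_span \<F>X \<F>Y \<Longrightarrow> adherent (form1 MXY \<E>XY) (tensor_span C D) w"
    fix e :: real assume "0 < e"
    then obtain v where "v \<in> tensor_span \<F>X \<F>Y" "sqrt (form1 MXY \<E>XY (\<lambda>x. u x - v x) (\<lambda>x. u x - v x)) < e"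
      using tensor_span_form_dense[OF u] unfolding adherent_def by blast
    with * tensor_span_prod_domain[OF order_refl order_refl]
    show "\<exists>w'\<in>\<F>XY. adherent (form1 MXY \<E>XY) (tensor_span C D) w' \<and>
        sqrt (form1 MXY \<E>XY (\<lambda>x. u x - w' x) (\<lambda>x. u x - w' x)) < e" by blast
  qed
qed

end

section \<open>Uniform approximation by tensors\<close>

lemma Cc_continuous: "f \<in> Cc \<Longrightarrow> continuous_on UNIV f"
  and Cc_compact: "f \<in> Cc \<Longrightarrow> compact (fun_support f)"
  by (auto simp: Cc_def)

lemma fun_support_nonzero: "f x \<noteq> 0 \<Longrightarrow> x \<in> fun_support f"
  unfolding fun_support_def by (rule subsetD[OF closure_subset]) simp

lemma CcI:
  fixes f :: "'a::t2_space \<Rightarrow> real"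
  assumes "continuous_on UNIV f" "compact K" "\<And>x. f x \<noteq> 0 \<Longrightarrow> x \<in> K"
  shows "f \<in> Cc"
proof -
  have "{x. f x \<noteq> 0} \<subseteq> K" using assms(3) by auto
  then have "fun_support f \<subseteq> K"
    unfolding fun_support_def using closure_minimal compact_imp_closed[OF assms(2)] by blast
  then have "compact (K \<inter> fun_support f)" "K \<inter> fun_support f = fun_support f"
    by (auto simp: fun_support_def intro!: compact_Int_closed assms(2))
  then show ?thesis using assms(1) by (simp add: Cc_def)
qed

lemma Cc_bounded:
  assumes "f \<in> Cc"
  shows "\<exists>K>0. \<forall>x. \<bar>f x\<bar> \<le> K"
proof -
  have "compact (f ` fun_support f)"
    by (rule compact_continuous_image[OF continuous_on_subset[OF Cc_continuous[OF assms]] Cc_compact[OF assms]]) simp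
  then have "bounded (f ` fun_support f)" by (rule compact_imp_bounded)
  then obtain K where "\<forall>y\<in>f ` fun_support f. norm y \<le> K" unfolding bounded_iff by blast
  then have K: "\<And>x. x \<in> fun_support f \<Longrightarrow> \<bar>f x\<bar> \<le> K" by simp
  have "\<bar>f x\<bar> \<le> max K 1" for x
    using K[of x] fun_support_nonzero[of f x] by (cases "f x = 0") (simp_all add: max.coboundedI1)
  then show ?thesis by (intro exI[of _ "max K 1"]) auto
qed

lemma tensor_span_Cc:
  fixes C :: "('a::metric_space \<Rightarrow> real) set" and D :: "('b::metric_space \<Rightarrow> real) set"
  assumes "C \<subseteq> Cc" "D \<subseteq> Cc" "w \<in> tensor_span C D"
  shows "w \<in> Cc"
  using assms(3)
proof (induction rule: tensor_span_induct)
  case zero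
  show ?case by (rule CcI[where K="{}"]) auto
next
  case (step w c f g)
  then have fg: "f \<in> Cc" "g \<in> Cc" using assms by auto
  show ?case
  proof (rule CcI)
    have "continuous_on UNIV (\<lambda>z. f (fst z))" "continuous_on UNIV (\<lambda>z. g (snd z))"
      by (rule continuous_on_compose2[OF Cc_continuous[OF fg(1)] continuous_on_fst[OF continuous_on_id]], simp,
          rule continuous_on_compose2[OF Cc_continuous[OF fg(2)] continuous_on_snd[OF continuous_on_id]], simp)
    then show "continuous_on UNIV (\<lambda>z. w z + c * (f (fst z) * g (snd z)))"
      using Cc_continuous[OF step.IH] by (intro continuous_intros)
    show "compact (fun_support w \<union> fun_support f \<times> fun_support g)"
      by (intro compact_Un compact_Times Cc_compact step.IH fg)
    fix z assume "w z + c * (f (fst z) * g (snd z)) \<noteq> 0"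
    then have "w z \<noteq> 0 \<or> f (fst z) \<noteq> 0 \<and> g (snd z) \<noteq> 0" by auto
    then show "z \<in> fun_support w \<union> fun_support f \<times> fun_support g"
      using fun_support_nonzero[of w z] fun_support_nonzero[of f "fst z"] fun_support_nonzero[of g "snd z"]
      by (auto simp: mem_Times_iff)
  qed
qed

lemma locally_compact_cball:
  fixes x :: "'a::metric_space"
  assumes "locally compact (UNIV :: 'a set)"
  shows "\<exists>r>0. compact (cball x r)"
proof -
  obtain U K where U: "open U" "compact K" "x \<in> U" "U \<subseteq> K"
    using assms unfolding locally_def by (metis UNIV_I open_UNIV openin_open_eq top_greatest open_openin)
  then obtain r where r: "0 < r" "cball x r \<subseteq> U" using open_contains_cball by blast
  have "compact (K \<inter> cball x r)" by (rule compact_Int_closed[OF U(2) closed_cball])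
  moreover have "K \<inter> cball x r = cball x r" using r U by auto
  ultimately show ?thesis using r(1) by auto
qed

lemma Cc_section:
  fixes h :: "'a::metric_space \<times> 'b::metric_space \<Rightarrow> real"
  assumes h: "h \<in> Cc"
  shows "(\<lambda>y. h (x, y)) \<in> Cc"
proof (rule CcI)
  show "continuous_on UNIV (\<lambda>y. h (x, y))"
    by (rule continuous_on_compose2[OF Cc_continuous[OF h]]) (auto intro!: continuous_intros)
  show "compact (snd ` fun_support h)"
    by (rule compact_continuous_image[OF continuous_on_snd[OF continuous_on_id] Cc_compact[OF h]])
  show "y \<in> snd ` fun_support h" if "h (x, y) \<noteq> 0" for y
    using fun_support_nonzero[of h "(x, y)"] that by force
qed

text \<open>Points violating the estimate have second coordinates in the compact projection of the support,
  so a sequence of them with first coordinates tending to \<open>x0\<close> has a convergent subsequence, which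
  contradicts continuity.\<close>

lemma Cc_tube:
  fixes h :: "'a::metric_space \<times> 'b::metric_space \<Rightarrow> real"
  assumes h: "h \<in> Cc" and e: "0 < e"
  shows "\<exists>r>0. \<forall>x. dist x x0 < r \<longrightarrow> (\<forall>y. \<bar>h (x, y) - h (x0, y)\<bar> < e)"
proof (rule ccontr)
  assume "\<not> ?thesis"
  then have "\<exists>x y. dist x x0 < r \<and> e \<le> \<bar>h (x, y) - h (x0, y)\<bar>" if "0 < r" for r
    using that by (meson not_le)
  then have "\<exists>x y. dist x x0 < inverse (real (Suc n)) \<and> e \<le> \<bar>h (x, y) - h (x0, y)\<bar>" for n by simp
  then obtain x y where x: "\<And>n. dist (x n) x0 < inverse (real (Suc n))"
    and far: "\<And>n. e \<le> \<bar>h (x n, y n) - h (x0, y n)\<bar>" by metis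
  have y: "y n \<in> snd ` fun_support h" for n
  proof -
    have "h (x n, y n) \<noteq> 0 \<or> h (x0, y n) \<noteq> 0" using far[of n] e by auto
    then show ?thesis using fun_support_nonzero[of h "(x n, y n)"] fun_support_nonzero[of h "(x0, y n)"] by force
  qed
  have "compact (snd ` fun_support h)"
    by (rule compact_continuous_image[OF continuous_on_snd[OF continuous_on_id] Cc_compact[OF h]])
  then obtain l r where r: "strict_mono (r :: nat \<Rightarrow> nat)" and l: "(y \<circ> r) \<longlonglongrightarrow> l"
    using y unfolding compact_def by metis
  have "(\<lambda>n. dist (x n) x0) \<longlonglongrightarrow> 0"
    by (rule tendsto_sandwich[OF _ _ tendsto_const LIMSEQ_inverse_real_of_nat])
      (use x in \<open>auto intro!: always_eventually less_imp_le\<close>)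
  then have "x \<longlonglongrightarrow> x0" by (subst tendsto_dist_iff)
  then have xr: "(x \<circ> r) \<longlonglongrightarrow> x0" by (rule LIMSEQ_subseq_LIMSEQ[OF _ r])
  have hc: "isCont h z" for z using Cc_continuous[OF h] unfolding continuous_on_eq_continuous_at[OF open_UNIV] by blast
  have "(\<lambda>n. h ((x \<circ> r) n, (y \<circ> r) n)) \<longlonglongrightarrow> h (x0, l)" by (rule isCont_tendsto_compose[OF hc tendsto_Pair[OF xr l]])
  moreover have "(\<lambda>n. h (x0, (y \<circ> r) n)) \<longlonglongrightarrow> h (x0, l)" by (rule isCont_tendsto_compose[OF hc tendsto_Pair[OF tendsto_const l]])
  ultimately have "(\<lambda>n. \<bar>h ((x \<circ> r) n, (y \<circ> r) n) - h (x0, (y \<circ> r) n)\<bar>) \<longlonglongrightarrow> \<bar>h (x0, l) - h (x0, l)\<bar>"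
    by (intro tendsto_intros)
  then have "e \<le> \<bar>h (x0, l) - h (x0, l)\<bar>"
    by (rule tendsto_lowerbound) (use far in \<open>auto intro: always_eventually\<close>)
  with e show False by simp
qed

text \<open>A partition of unity in the first variable alone suffices: each of its functions \<open>\<phi>\<^sub>i\<close> lives
  where \<open>h (x, \<cdot>)\<close> is uniformly close to \<open>h (x\<^sub>i, \<cdot>)\<close>, so \<open>h\<close> is uniformly close to the sum of the
  tensors \<open>\<phi>\<^sub>i (x) h (x\<^sub>i, y)\<close>.\<close>

lemma Cc_tensor_span_dense:
  fixes h :: "'a::metric_space \<times> 'b::metric_space \<Rightarrow> real"
  assumes lc: "locally compact (UNIV :: 'a set)" and h: "h \<in> Cc" and e: "0 < e"
  shows "\<exists>v\<in>tensor_span Cc Cc. \<forall>z. \<bar>h z - v z\<bar> < e"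
proof (cases "fun_support h = {}")
  case True
  then have "h z = 0" for z using fun_support_nonzero[of h z] by auto
  then show ?thesis using e by (intro bexI[OF _ tensor_span_zero]) simp
next
  case False
  define K where "K = fst ` fun_support h"
  have K: "compact K" "K \<noteq> {}"
    unfolding K_def using False
    by (auto intro!: compact_continuous_image continuous_on_fst continuous_on_id Cc_compact h)
  have hK: "x \<in> K" if "h (x, y) \<noteq> 0" for x y
    using fun_support_nonzero[of h "(x, y)"] that unfolding K_def by force
  have "\<exists>r>0. compact (cball a r) \<and> (\<forall>x. dist x a < r \<longrightarrow> (\<forall>y. \<bar>h (x, y) - h (a, y)\<bar> < e))" for a
  proof -
    obtain r1 where r1: "r1 > 0" "compact (cball a r1)" using locally_compact_cball[OF lc] by blast
    obtain r2 where r2: "r2 > 0" "\<forall>x. dist x a < r2 \<longrightarrow> (\<forall>y. \<bar>h (x, y) - h (a, y)\<bar> < e)" using Cc_tube[OF h e] by blast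
    have "compact (cball a r1 \<inter> cball a (min r1 r2))" by (rule compact_Int_closed[OF r1(2) closed_cball])
    moreover have "cball a r1 \<inter> cball a (min r1 r2) = cball a (min r1 r2)" by auto
    ultimately show ?thesis using r1 r2 by (intro exI[of _ "min r1 r2"]) auto
  qed
  then obtain r where r: "\<And>a. 0 < r a" "\<And>a. compact (cball a (r a))"
    and near: "\<And>a x y. dist x a < r a \<Longrightarrow> \<bar>h (x, y) - h (a, y)\<bar> < e" by metis
  obtain I where I: "finite I" "K \<subseteq> (\<Union>a\<in>I. ball a (r a))"
  proof (rule compactE_image[OF K(1), of K "\<lambda>a. ball a (r a)"])
    show "K \<subseteq> (\<Union>a\<in>K. ball a (r a))" using r(1) by auto
  qed auto
  define \<psi> where "\<psi> a x = max 0 (r a - dist x a)" for a x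
  define s where "s x = (\<Sum>a\<in>I. \<psi> a x)" for x
  have \<psi>_cont: "continuous_on UNIV (\<psi> a)" for a unfolding \<psi>_def[abs_def] by (intro continuous_intros)
  have s_cont: "continuous_on UNIV s" unfolding s_def[abs_def] by (intro continuous_intros \<psi>_cont)
  have \<psi>0: "0 \<le> \<psi> a x" for a x by (simp add: \<psi>_def)
  have s_pos: "0 < s x" if xK: "x \<in> K" for x
  proof -
    have "x \<in> (\<Union>a\<in>I. ball a (r a))" using I(2) xK by blast
    then obtain a where a: "a \<in> I" "dist x a < r a" by (auto simp: dist_commute)
    have "0 < \<psi> a x" using a(2) by (simp add: \<psi>_def)
    also have "\<dots> \<le> s x" unfolding s_def by (rule member_le_sum[OF a(1)]) (use \<psi>0 I(1) in auto)
    finally show ?thesis .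
  qed
  obtain m where m: "m \<in> K" "\<And>x. x \<in> K \<Longrightarrow> s m \<le> s x"
    using continuous_attains_inf[OF K continuous_on_subset[OF s_cont subset_UNIV]] by blast
  define \<eta> where "\<eta> = s m"
  have \<eta>: "0 < \<eta>" unfolding \<eta>_def by (rule s_pos[OF m(1)])
  \<comment> \<open>Dividing by \<open>max \<eta> s\<close> instead of \<open>s\<close> keeps the quotient continuous off \<open>K\<close>.\<close>
  define \<phi> where "\<phi> a x = \<psi> a x / max \<eta> (s x)" for a x
  have max_pos: "0 < max \<eta> (s x)" for x using \<eta> by simp
  have \<phi>0: "0 \<le> \<phi> a x" for a x unfolding \<phi>_def using \<psi>0 max_pos by (simp add: less_imp_le)
  have \<phi>_sum: "(\<Sum>a\<in>I. \<phi> a x) = s x / max \<eta> (s x)" for x unfolding \<phi>_def s_def by (simp add: sum_divide_distrib)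
  have \<phi>_le: "(\<Sum>a\<in>I. \<phi> a x) \<le> 1" for x unfolding \<phi>_sum using max_pos[of x] by simp
  have \<phi>_1: "(\<Sum>a\<in>I. \<phi> a x) = 1" if "x \<in> K" for x
    unfolding \<phi>_sum using m(2)[OF that] \<eta> s_pos[OF that] by (simp add: \<eta>_def max_def)
  have \<phi>_Cc: "\<phi> a \<in> Cc" for a
  proof (rule CcI[OF _ r(2)[of a]])
    have "continuous_on UNIV (\<lambda>x. \<psi> a x / max \<eta> (s x))"
      using max_pos by (intro continuous_intros \<psi>_cont s_cont) (metis less_irrefl)
    then show "continuous_on UNIV (\<phi> a)" by (simp add: \<phi>_def[abs_def])
    show "x \<in> cball a (r a)" if "\<phi> a x \<noteq> 0" for x
      using that by (auto simp: \<phi>_def \<psi>_def max_def dist_commute split: if_splits)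
  qed
  define v where "v z = (\<Sum>a\<in>I. 1 * (\<phi> a (fst z) * h (a, snd z)))" for z
  have "v \<in> tensor_span Cc Cc"
    unfolding v_def[abs_def] by (intro tensor_span_sum I(1) tensor_span_tensor \<phi>_Cc Cc_section[OF h])
  moreover have "\<bar>h (x, y) - v (x, y)\<bar> < e" for x y
  proof -
    have "h (x, y) = (\<Sum>a\<in>I. \<phi> a x) * h (x, y)"
      using hK[of x y] \<phi>_1[of x] by (cases "h (x, y) = 0") auto
    then have "h (x, y) - v (x, y) = (\<Sum>a\<in>I. \<phi> a x * (h (x, y) - h (a, y)))"
      by (simp add: v_def sum_distrib_right right_diff_distrib sum_subtractf)
    then have le: "\<bar>h (x, y) - v (x, y)\<bar> \<le> (\<Sum>a\<in>I. \<phi> a x * \<bar>h (x, y) - h (a, y)\<bar>)"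
      using sum_abs[of "\<lambda>a. \<phi> a x * (h (x, y) - h (a, y))" I] by (simp add: abs_mult \<phi>0)
    have summand: "\<phi> a x * \<bar>h (x, y) - h (a, y)\<bar> \<le> \<phi> a x * e" for a
    proof (cases "dist x a < r a")
      case True
      then show ?thesis using near[OF True, of y] \<phi>0 by (intro mult_left_mono) auto
    next
      case False
      then have "\<phi> a x = 0" by (simp add: \<phi>_def \<psi>_def)
      then show ?thesis by simp
    qed
    show ?thesis
    proof (cases "\<exists>a\<in>I. 0 < \<phi> a x")
      case True
      then obtain a where a: "a \<in> I" "0 < \<phi> a x" by blast
      then have "dist x a < r a" using max_pos[of x] by (auto simp: \<phi>_def \<psi>_def zero_less_divide_iff max_def split: if_splits)
      then have "\<phi> a x * \<bar>h (x, y) - h (a, y)\<bar> < \<phi> a x * e" using near[of x a y] a(2) by simp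
      then have "(\<Sum>a\<in>I. \<phi> a x * \<bar>h (x, y) - h (a, y)\<bar>) < (\<Sum>a\<in>I. \<phi> a x * e)"
        using a(1) I(1) summand by (intro sum_strict_mono_ex1) auto
      also have "\<dots> \<le> e" using mult_right_mono[OF \<phi>_le[of x], of e] e by (simp add: sum_distrib_right)
      finally show ?thesis using le by simp
    next
      case False
      then have "\<phi> a x = 0" if "a \<in> I" for a using that \<phi>0[of a x] by (force simp: less_le)
      then show ?thesis using le e by simp
    qed
  qed
  ultimately show ?thesis by auto
qed

lemma tensor_span_uniformly_dense:
  fixes C :: "('a::metric_space \<Rightarrow> real) set" and D :: "('b::metric_space \<Rightarrow> real) set"
  assumes lc: "locally compact (UNIV :: 'a set)"
    and C: "\<And>f e. f \<in> Cc \<Longrightarrow> 0 < e \<Longrightarrow> \<exists>g\<in>C. \<forall>x. \<bar>f x - g x\<bar> < e"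
    and D: "\<And>f e. f \<in> Cc \<Longrightarrow> 0 < e \<Longrightarrow> \<exists>g\<in>D. \<forall>x. \<bar>f x - g x\<bar> < e"
    and h: "h \<in> Cc" and e: "0 < e"
  shows "\<exists>v\<in>tensor_span C D. \<forall>z. \<bar>h z - v z\<bar> < e"
proof -
  have approx: "\<exists>v\<in>tensor_span C D. \<forall>z. \<bar>w z - v z\<bar> < e" if "w \<in> tensor_span Cc Cc" "0 < e" for w and e :: real
    using that
  proof (induction arbitrary: e rule: tensor_span_induct)
    case zero
    then show ?case by (intro bexI[OF _ tensor_span_zero]) simp
  next
    case (step w c f g)
    obtain v where v: "v \<in> tensor_span C D" "\<And>z. \<bar>w z - v z\<bar> < e / 2" using step.IH[of "e / 2"] step.prems by auto
    obtain G where G: "0 < G" "\<And>y. \<bar>g y\<bar> \<le> G" using Cc_bounded[OF step.hyps(3)] by blast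
    obtain H where H: "0 < H" "\<And>x. \<bar>f x\<bar> \<le> H" using Cc_bounded[OF step.hyps(2)] by blast
    define k where "k = \<bar>c\<bar> + 1"
    have k: "0 < k" "\<bar>c\<bar> \<le> k" by (simp_all add: k_def)
    have "0 < e / (4 * k * G)" using step.prems k G by simp
    then obtain f' where f': "f' \<in> C" "\<And>x. \<bar>f x - f' x\<bar> < min 1 (e / (4 * k * G))"
      using C[OF step.hyps(2), of "min 1 (e / (4 * k * G))"] by auto
    have "0 < e / (4 * k * (H + 1))" using step.prems k H by simp
    then obtain g' where g': "g' \<in> D" "\<And>y. \<bar>g y - g' y\<bar> < e / (4 * k * (H + 1))" using D[OF step.hyps(3)] by blast
    have tensor: "\<bar>c * (f x * g y) - c * (f' x * g' y)\<bar> \<le> e / 2" for x y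
    proof -
      have f'b: "\<bar>f' x\<bar> \<le> H + 1" using H(2)[of x] f'(2)[of x] by linarith
      have "f x * g y - f' x * g' y = (f x - f' x) * g y + f' x * (g y - g' y)" by (simp add: algebra_simps)
      then have "\<bar>f x * g y - f' x * g' y\<bar> \<le> \<bar>f x - f' x\<bar> * \<bar>g y\<bar> + \<bar>f' x\<bar> * \<bar>g y - g' y\<bar>"
        by (metis abs_mult abs_triangle_ineq)
      also have "\<dots> \<le> e / (4 * k * G) * G + (H + 1) * (e / (4 * k * (H + 1)))"
        using f'(2)[of x] g'(2)[of y] G(2)[of y] f'b H(1) by (intro add_mono mult_mono) auto
      also have "\<dots> = e / (2 * k)"
      proof -
        have "e / (4 * k * G) * G = e / (4 * k)" using G(1) by simp
        moreover have "(H + 1) * (e / (4 * k * (H + 1))) = e / (4 * k)" using H(1) by simp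
        ultimately show ?thesis by (simp add: field_simps)
      qed
      finally have le: "\<bar>f x * g y - f' x * g' y\<bar> \<le> e / (2 * k)" .
      have "\<bar>c * (f x * g y) - c * (f' x * g' y)\<bar> = \<bar>c\<bar> * \<bar>f x * g y - f' x * g' y\<bar>"
        by (metis abs_mult right_diff_distrib)
      also have "\<dots> \<le> k * (e / (2 * k))" using le k step.prems by (intro mult_mono) auto
      also have "\<dots> = e / 2" using k(1) by simp
      finally show ?thesis .
    qed
    show ?case
    proof (intro bexI allI)
      show "(\<lambda>z. v z + c * (f' (fst z) * g' (snd z))) \<in> tensor_span C D" by (rule tensor_span_step[OF v(1) f'(1) g'(1)])
      fix z
      show "\<bar>w z + c * (f (fst z) * g (snd z)) - (v z + c * (f' (fst z) * g' (snd z)))\<bar> < e"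
        using v(2)[of z] tensor[of "fst z" "snd z"] by linarith
    qed
  qed
  obtain w where w: "w \<in> tensor_span Cc Cc" "\<And>z. \<bar>h z - w z\<bar> < e / 2"
    using Cc_tensor_span_dense[OF lc h, of "e / 2"] e by auto
  obtain v where v: "v \<in> tensor_span C D" "\<And>z. \<bar>w z - v z\<bar> < e / 2" using approx[OF w(1), of "e / 2"] e by auto
  have "\<bar>h z - v z\<bar> < e" for z using w(2)[of z] v(2)[of z] by linarith
  with v(1) show ?thesis by blast
qed

section \<open>The independent coupling and its form\<close>

text \<open>The space is Lindelof, so countably many balls contained in compact balls cover it.\<close>

lemma sigma_finite_radon_measure:
  fixes M :: "'a::{metric_space,second_countable_topology} measure"
  assumes lc: "locally compact (UNIV :: 'a set)" and M: "radon_measure M"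
  shows "sigma_finite_measure M"
proof
  have sets: "sets M = sets borel" and fin: "\<And>K. compact K \<Longrightarrow> emeasure M K < \<infinity>"
    using M by (auto simp: radon_measure_def)
  have sp: "space M = UNIV" using sets_eq_imp_space_eq[OF sets] by simp
  obtain r :: "'a \<Rightarrow> real" where r: "\<And>x. 0 < r x" "\<And>x. compact (cball x (r x))"
    using locally_compact_cball[OF lc] by metis
  obtain \<B> where \<B>: "\<B> \<subseteq> range (\<lambda>x. ball x (r x))" "countable \<B>" "\<Union>\<B> = \<Union>(range (\<lambda>x. ball x (r x)))"
    using Lindelof[of "range (\<lambda>x. ball x (r x))"] by auto
  have "emeasure M B \<noteq> \<infinity>" if B\<B>: "B \<in> \<B>" for B
  proof -
    obtain x where B: "B = ball x (r x)" using subsetD[OF \<B>(1) B\<B>] by blast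
    have "emeasure M B \<le> emeasure M (cball x (r x))" unfolding B by (rule emeasure_mono) (auto simp: sets)
    then show ?thesis using fin[OF r(2)[of x]] by (auto simp: top_unique)
  qed
  moreover have "\<B> \<subseteq> sets M" using \<B>(1) by (auto simp: sets)
  moreover have "\<Union>\<B> = space M" unfolding \<B>(3) sp using r(1) by (auto intro: centre_in_ball[THEN iffD2])
  ultimately show "\<exists>A. countable A \<and> A \<subseteq> sets M \<and> \<Union>A = space M \<and> (\<forall>a\<in>A. emeasure M a \<noteq> \<infinity>)"
    using \<B>(2) by blast
qed

lemma transition_operator_kernel_op: "transition_operator P X = (\<lambda>t. kernel_op (transition P X t))"
  by (simp add: transition_operator_def kernel_op_def fun_eq_iff)

lemma symmetric_kernel_semigroup_transition:
  fixes M :: "'a::{metric_space,second_countable_topology} measure"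
  assumes "locally compact (UNIV :: 'a set)" and M: "radon_measure M" and P: "markov_process P X"
    and sym: "m_symmetric M P X" and form: "form_of_process M E F P X"
  shows "symmetric_kernel_semigroup M (transition P X)"
proof -
  interpret sigma_finite_measure M by (rule sigma_finite_radon_measure) fact+
  have sets: "sets M = sets borel" using M by (simp add: radon_measure_def)
  show ?thesis
  proof (intro symmetric_kernel_semigroup.intro symmetric_kernel_semigroup_axioms.intro sigma_finite_measure_axioms)
    show "symmetric_kernel M (transition P X t)" if "0 < t" for t
      by (rule symmetric_kernel_transition[OF P sets sym]) (use that in simp)
    show "transition P X (s + t) x = transition P X s x \<bind> transition P X t" if "0 < s" "0 < t" for s t x
      by (rule Chapman_Kolmogorov[OF P]) (use that in simp_all)
    show "L2_semigroup M (\<lambda>t. kernel_op (transition P X t))"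
      using form by (simp add: form_of_process_def semigroup_of_form_def transition_operator_kernel_op)
  qed
qed

lemma semigroup_of_form_cong:
  assumes eq: "\<And>t. 0 < t \<Longrightarrow> S t = T t" and T: "semigroup_of_form M E F T"
  shows "semigroup_of_form M E F S"
proof -
  have lim: "((\<lambda>t. h (S t) t) \<longlongrightarrow> l) (at_right 0) \<longleftrightarrow> ((\<lambda>t. h (T t) t) \<longlongrightarrow> l) (at_right (0::real))"
    for h :: "(('a \<Rightarrow> real) \<Rightarrow> 'a \<Rightarrow> real) \<Rightarrow> real \<Rightarrow> real" and l
    by (rule tendsto_cong) (auto simp: eventually_at_right_field eq intro!: exI[of _ 1])
  show ?thesis
    using T unfolding semigroup_of_form_def L2_semigroup_def
      lim[of "\<lambda>f t. L2_norm M (\<lambda>x. f _ x - _ x)"] lim[of "\<lambda>f t. L2_inner M (\<lambda>x. _ x - f _ x) _ / t"]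
    by (simp add: eq)
qed

theorem proposition3p2:
  fixes MX :: "'a::{metric_space,second_countable_topology} measure"
    and MY :: "'b::{metric_space,second_countable_topology} measure"
    and PX :: "'a \<Rightarrow> 'v measure" and X :: "real \<Rightarrow> 'v \<Rightarrow> 'a option"
    and PY :: "'b \<Rightarrow> 'w measure" and Y :: "real \<Rightarrow> 'w \<Rightarrow> 'b option"
    and \<E>X :: "'a form" and \<F>X :: "('a \<Rightarrow> real) set"
    and \<E>Y :: "'b form" and \<F>Y :: "('b \<Rightarrow> real) set"
  assumes "locally compact (UNIV :: 'a set)" and "locally compact (UNIV :: 'b set)"
    and "radon_measure MX" and "full_support MX"
    and "radon_measure MY" and "full_support MY"
    and "markov_process PX X" and "m_symmetric MX PX X"
    and "regular_dirichlet_form MX \<E>X \<F>X" and "form_of_process MX \<E>X \<F>X PX X"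
    and "no_killing_inside \<E>X \<F>X"
    and "markov_process PY Y" and "m_symmetric MY PY Y"
    and "regular_dirichlet_form MY \<E>Y \<F>Y" and "form_of_process MY \<E>Y \<F>Y PY Y"
    and "no_killing_inside \<E>Y \<F>Y"
  shows "markov_process (coupling_law PX PY) (coupling_process X Y) \<and>
    m_symmetric (MX \<Otimes>\<^sub>M MY) (coupling_law PX PY) (coupling_process X Y) \<and>
    regular_dirichlet_form (MX \<Otimes>\<^sub>M MY)
      (prod_form MX MY \<E>X \<F>X \<E>Y \<F>Y) (prod_domain MX MY \<E>X \<F>X \<E>Y \<F>Y) \<and>
    form_of_process (MX \<Otimes>\<^sub>M MY)
      (prod_form MX MY \<E>X \<F>X \<E>Y \<F>Y) (prod_domain MX MY \<E>X \<F>X \<E>Y \<F>Y)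
      (coupling_law PX PY) (coupling_process X Y) \<and>
    (\<forall>CX CY. core MX \<E>X \<F>X CX \<longrightarrow> core MY \<E>Y \<F>Y CY \<longrightarrow>
      core (MX \<Otimes>\<^sub>M MY)
        (prod_form MX MY \<E>X \<F>X \<E>Y \<F>Y) (prod_domain MX MY \<E>X \<F>X \<E>Y \<F>Y) (tensor_span CX CY))"
proof -
  note lcX = assms(1) and lcY = assms(2) and rX = assms(3) and rY = assms(5)
  note mpX = assms(7) and symX = assms(8) and dfX = assms(9) and foX = assms(10)
  note mpY = assms(12) and symY = assms(13) and dfY = assms(14) and foY = assms(15)
  interpret X: symmetric_kernel_semigroup MX "transition PX X"
    by (rule symmetric_kernel_semigroup_transition[OF lcX rX mpX symX foX])
  interpret Y: symmetric_kernel_semigroup MY "transition PY Y"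
    by (rule symmetric_kernel_semigroup_transition[OF lcY rY mpY symY foY])
  have SX: "semigroup_of_form MX \<E>X \<F>X (\<lambda>t. kernel_op (transition PX X t))"
    and SY: "semigroup_of_form MY \<E>Y \<F>Y (\<lambda>t. kernel_op (transition PY Y t))"
    using foX foY by (simp_all add: form_of_process_def transition_operator_kernel_op)
  interpret product_of_forms MX "transition PX X" MY "transition PY Y" \<E>X \<F>X \<E>Y \<F>Y
    by (intro product_of_forms.intro product_of_forms_axioms.intro X.symmetric_kernel_semigroup_axioms
        Y.symmetric_kernel_semigroup_axioms SX SY)
  have sets: "sets MX = sets borel" "sets MY = sets borel"
    using rX rY by (simp_all add: radon_measure_def)
  have dX: "dirichlet_form MX \<E>X \<F>X" "core MX \<E>X \<F>X (\<F>X \<inter> Cc)"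
    and dY: "dirichlet_form MY \<E>Y \<F>Y" "core MY \<E>Y \<F>Y (\<F>Y \<inter> Cc)"
    using dfX dfY by (simp_all add: regular_dirichlet_form_def)
  have markov: "markov_process (coupling_law PX PY) (coupling_process X Y)"
    by (rule markov_process_coupling[OF mpX mpY])
  have symm: "m_symmetric MXY (coupling_law PX PY) (coupling_process X Y)"
    by (rule m_symmetric_coupling[OF mpX mpY sets X.sigma_finite_measure_axioms
          Y.sigma_finite_measure_axioms symX symY])
  have dir: "dirichlet_form MXY \<E>XY \<F>XY"
    by (rule dirichlet_form_prod) (use dX(1) dY(1) in \<open>simp_all add: dirichlet_form_def\<close>)
  have form: "form_of_process MXY \<E>XY \<F>XY (coupling_law PX PY) (coupling_process X Y)"
  proof -
    have "transition_operator (coupling_law PX PY) (coupling_process X Y) t = T t" if "0 < t" for t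
      using transition_coupling[OF mpX mpY, of t] that
      by (simp add: transition_operator_kernel_op T_def)
    then show ?thesis
      unfolding form_of_process_def by (rule semigroup_of_form_cong[OF _ semigroup_of_prod_form])
  qed
  have core: "core MXY \<E>XY \<F>XY (tensor_span CX CY)"
    if CX: "core MX \<E>X \<F>X CX" and CY: "core MY \<E>Y \<F>Y CY" for CX CY
  proof -
    have CX': "CX \<subseteq> \<F>X" "CX \<subseteq> Cc"
      "\<And>u e. u \<in> \<F>X \<Longrightarrow> 0 < e \<Longrightarrow> \<exists>v\<in>CX. form1_norm MX \<E>X (\<lambda>x. u x - v x) < e"
      "\<And>f e. f \<in> Cc \<Longrightarrow> 0 < e \<Longrightarrow> \<exists>g\<in>CX. \<forall>x. \<bar>f x - g x\<bar> < e"
      using CX unfolding core_def by auto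
    have CY': "CY \<subseteq> \<F>Y" "CY \<subseteq> Cc"
      "\<And>u e. u \<in> \<F>Y \<Longrightarrow> 0 < e \<Longrightarrow> \<exists>v\<in>CY. form1_norm MY \<E>Y (\<lambda>x. u x - v x) < e"
      "\<And>f e. f \<in> Cc \<Longrightarrow> 0 < e \<Longrightarrow> \<exists>g\<in>CY. \<forall>x. \<bar>f x - g x\<bar> < e"
      using CY unfolding core_def by auto
    show ?thesis
      unfolding core_def
    proof (intro conjI ballI allI impI)
      show "tensor_span CX CY \<subseteq> \<F>XY \<inter> Cc"
        using tensor_span_prod_domain[OF CX'(1) CY'(1)] tensor_span_Cc[OF CX'(2) CY'(2)] by blast
      show "\<exists>v\<in>tensor_span CX CY. form1_norm MXY \<E>XY (\<lambda>z. u z - v z) < e"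
        if u: "u \<in> \<F>XY" and e: "0 < e" for u e
        using tensor_span_form_dense_core[OF CX'(1,3) CY'(1,3) u] e
        unfolding adherent_def form1_norm_def by blast
      show "\<exists>g\<in>tensor_span CX CY. \<forall>z. \<bar>h z - g z\<bar> < e" if h: "h \<in> Cc" and e: "0 < e" for h e
        by (rule tensor_span_uniformly_dense[OF lcX CX'(4) CY'(4) h e])
    qed
  qed
  \<comment> \<open>Density is inherited from the smaller set of tensors of functions in the two largest cores.\<close>
  have "core MXY \<E>XY \<F>XY (\<F>XY \<inter> Cc)"
  proof -
    let ?C = "tensor_span (\<F>X \<inter> Cc) (\<F>Y \<inter> Cc)"
    have C: "core MXY \<E>XY \<F>XY ?C" by (rule core[OF dX(2) dY(2)])
    then have "?C \<subseteq> \<F>XY \<inter> Cc" by (simp add: core_def)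
    then show ?thesis using C unfolding core_def by (meson order_refl subsetD)
  qed
  with dir have "regular_dirichlet_form MXY \<E>XY \<F>XY" by (simp add: regular_dirichlet_form_def)
  with markov symm form core show ?thesis by blast
qed


end
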